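(* Let $E,F$ be complex Banach spaces, $U\subseteq E$ open, $v$ a weight on $U$, $p\in[1,\infty]$, and $f\in\mathcal H_v^\infty(U,F)$. Let $\mathcal I$ be any one of the Banach operator ideals $\mathcal K_p,\mathcal K_{wp},\mathcal K_{up}$. The following are equivalent: (i) $f\in\mathcal H^\infty_{v\mathcal I}(U,F)$; (ii) $T_f\in\mathcal I(\mathcal G_v^\infty(U),F)$. In this case, $\|f\|_{\mathcal H^\infty_{v\mathcal I}}=\|T_f\|_{\mathcal I}$. Furthermore, the correspondence $f\mapsto T_f$ is an isometric isomorphism from $(\mathcal H^\infty_{v\mathcal I}(U,F),\|\cdot\|_{\mathcal H^\infty_{v\mathcal I}})$ onto $(\mathcal I(\mathcal G_v^\infty(U),F),\|\cdot\|_{\mathcal I})$. As a consequence, $(\mathcal H^\infty_{v\mathcal I}(U,F),\|\cdot\|_{\mathcal H^\infty_{v\mathcal I}})$ is a Banach space.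
   Context: A weight on $U$ is a strictly positive continuous function. $\mathcal H_v^\infty(U,F)$ is the Banach space of holomorphic $f\colon U\to F$ with $\|f\|_v:=\sup_{x\in U}v(x)\|f(x)\|<\infty$; $\mathcal H_v^\infty(U):=\mathcal H_v^\infty(U,\mathbb C)$. $\mathcal L(X,Y)$ denotes the bounded linear operators. Linearization: $\mathcal G_v^\infty(U)$ is the closed subspace of $\mathcal H_v^\infty(U)^*$ consisting of all linear functionals on $\mathcal H_v^\infty(U)$ whose restriction to the closed unit ball of $\mathcal H_v^\infty(U)$ is continuous for the compact-open topology. $\Delta_v\colon U\to\mathcal G_v^\infty(U)$ is $\Delta_v(x)=\delta_x$, where $\delta_x(g)=g(x)$. For $f\in\mathcal H_v^\infty(U,F)$, $T_f$ is the unique operator in $\mathcal L(\mathcal G_v^\infty(U),F)$ with $T_f\circ\Delta_v=f$ (it exists and $\|T_f\|=\|f\|_v$). Sequences in a Banach space $X$: for $1\le p<\infty$, $\ell_p(X)$ is the space of sequences with $\|(x_n)\|_p=(\sum\|x_n\|^p)^{1/p}<\infty$; $\ell_p^w(X)$ of those with $\|(x_n)\|_p^w=\sup_{x^*\in B_{X^*}}(\sum|x^*(x_n)|^p)^{1/p}<\infty$; $\ell_p^u(X)$ of those $(x_n)\in\ell_p^w(X)$ with $\|(x_n)_{n\ge m}\|_p^w\to0$ as $m\to\infty$. $c_0(X)$, $c_0^w(X)$ are the norm null and the weakly null sequences, with the supremum norm. $p\text{-}\mathrm{conv}(x_n)=\{\sum_n a_nx_n:(a_n)\in B\}$, where $B=B_{\ell_{p^*}}$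 if $1<p<\infty$ ($p^*$ the conjugate index), $B=B_{c_0}$ if $p=1$, $B=B_{\ell_1}$ if $p=\infty$. A set $K\subseteq X$ is relatively $p$-compact (resp. relatively weakly $p$-compact, relatively unconditionally $p$-compact) if $K\subseteq p\text{-}\mathrm{conv}(x_n)$ for some $(x_n)$ in $\ell_p(X)$ (resp. $\ell_p^w(X)$, $\ell_p^u(X)$) when $p<\infty$, or in $c_0(X)$ (resp. $c_0^w(X)$, $c_0(X)$) when $p=\infty$. The corresponding sizes $m_{\mathcal K_p}(K)$, $m_{\mathcal K_{wp}}(K)$, $m_{\mathcal K_{up}}(K)$ are the infima over all such sequences of $\|(x_n)\|_p$ (resp. $\|(x_n)\|_p^w$, $\|(x_n)\|_p^w$) when $p<\infty$, and of the supremum norm when $p=\infty$. An operator $T\in\mathcal L(X,Y)$ is in $\mathcal K_p(X,Y)$ (resp. $\mathcal K_{wp}(X,Y)$, $\mathcal K_{up}(X,Y)$) if $T(B_X)$ is relatively $p$-compact (resp. relatively weakly, relatively unconditionally $p$-compact), with $\|T\|_{\mathcal I}=m_{\mathcal I}(T(B_X))$. For $\mathcal I=\mathcal K_p,\mathcal K_{wp},\mathcal K_{up}$, $\mathcal H^\infty_{v\mathcal I}(U,F)$ is the set of $f\in\mathcal H_v^\infty(U,F)$ such that $(vf)(U)=\{v(x)f(x):x\in U\}$ is relatively $p$-compact (resp. relatively weakly, relatively unconditionally $p$-compact), with $\|f\|_{\mathcal H^\infty_{v\mathcal I}}=m_{\mathcal I}((vf)(U))$. *)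

theory Defs
  imports "HOL-Analysis.Analysis" "HOL-Library.Function_Algebras"
begin

text \<open>
  Complex Banach spaces that are ambient (the domain space \<open>E\<close> and the target space \<open>F\<close>) are types of
  class \<open>cbanach\<close>. Spaces that depend on the open set and the weight are given by a carrier set
  \<open>S\<close> in a complex vector space type together with a norm function \<open>N\<close> that is only
  meaningful on \<open>S\<close>. A function on a proper subset is represented by its extension by zero,
  so that equality of HOL functions is equality of functions on that subset and the pointwise vector
  space operations of the function type are the right ones.
\<close>

subsection \<open>Complex normed and Banach spaces\<close>

class scaleC =
  fixes scaleC :: "complex \<Rightarrow> 'a \<Rightarrow> 'a"  (infixr "*\<^sub>C" 75)

class complex_vector = scaleC + ab_group_add +
  assumes scaleC_add_right: "a *\<^sub>C (x + y) = a *\<^sub>C x + a *\<^sub>C y"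
    and scaleC_add_left: "(a + b) *\<^sub>C x = a *\<^sub>C x + b *\<^sub>C x"
    and scaleC_scaleC: "a *\<^sub>C b *\<^sub>C x = (a * b) *\<^sub>C x"
    and scaleC_one: "1 *\<^sub>C x = x"

class complex_normed_vector = complex_vector + real_normed_vector +
  assumes scaleR_scaleC: "r *\<^sub>R x = complex_of_real r *\<^sub>C x"
    and norm_scaleC: "norm (a *\<^sub>C x) = cmod a * norm x"

class cbanach = complex_normed_vector + complete_space

instantiation complex :: cbanach
begin
definition scaleC_complex :: "complex \<Rightarrow> complex \<Rightarrow> complex"
  where "scaleC_complex a x = a * x"
instance
  by standard (auto simp: scaleC_complex_def algebra_simps scaleR_conv_of_real norm_mult)
end

instantiation "fun" :: (type, complex_vector) complex_vector
begin
definition scaleC_fun :: "complex \<Rightarrow> ('a \<Rightarrow> 'b) \<Rightarrow> 'a \<Rightarrow> 'b"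
  where "scaleC_fun a f = (\<lambda>x. a *\<^sub>C f x)"
instance
  by standard
    (auto simp: scaleC_fun_def fun_eq_iff scaleC_add_right scaleC_add_left scaleC_scaleC scaleC_one)
end

definition csubspace :: "'a::complex_vector set \<Rightarrow> bool"
  where "csubspace S \<longleftrightarrow>
    0 \<in> S \<and> (\<forall>x\<in>S. \<forall>y\<in>S. x + y \<in> S) \<and> (\<forall>c. \<forall>x\<in>S. c *\<^sub>C x \<in> S)"

definition cnormed_space_on :: "'a::complex_vector set \<Rightarrow> ('a \<Rightarrow> real) \<Rightarrow> bool"
  where "cnormed_space_on S N \<longleftrightarrow> csubspace S \<and>
    (\<forall>x\<in>S. 0 \<le> N x \<and> (N x = 0 \<longleftrightarrow> x = 0)) \<and>
    (\<forall>x\<in>S. \<forall>y\<in>S. N (x + y) \<le> N x + N y) \<and>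
    (\<forall>c. \<forall>x\<in>S. N (c *\<^sub>C x) = cmod c * N x)"

definition cbanach_space_on :: "'a::complex_vector set \<Rightarrow> ('a \<Rightarrow> real) \<Rightarrow> bool"
  where "cbanach_space_on S N \<longleftrightarrow> cnormed_space_on S N \<and>
    (\<forall>X. range X \<subseteq> S \<longrightarrow> (\<forall>e>0. \<exists>M. \<forall>m\<ge>M. \<forall>n\<ge>M. N (X m - X n) < e) \<longrightarrow>
      (\<exists>L\<in>S. (\<lambda>n::nat. N (X n - L)) \<longlonglongrightarrow> 0))"

definition unit_ball :: "'a set \<Rightarrow> ('a \<Rightarrow> real) \<Rightarrow> 'a set"
  where "unit_ball S N = {x \<in> S. N x \<le> 1}"

definition isometric_isomorphism ::
  "'a::complex_vector set \<Rightarrow> ('a \<Rightarrow> real) \<Rightarrow> 'b::complex_vector set \<Rightarrow> ('b \<Rightarrow> real) \<Rightarrow> ('a \<Rightarrow> 'b) \<Rightarrow> bool"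
  where "isometric_isomorphism S N S' N' \<Phi> \<longleftrightarrow>
    cnormed_space_on S N \<and> cnormed_space_on S' N' \<and> bij_betw \<Phi> S S' \<and>
    (\<forall>x\<in>S. \<forall>y\<in>S. \<Phi> (x + y) = \<Phi> x + \<Phi> y) \<and>
    (\<forall>c. \<forall>x\<in>S. \<Phi> (c *\<^sub>C x) = c *\<^sub>C \<Phi> x) \<and>
    (\<forall>x\<in>S. N' (\<Phi> x) = N x)"

subsection \<open>Bounded operators and dual spaces\<close>

definition bounded_ops ::
  "'a::complex_vector set \<Rightarrow> ('a \<Rightarrow> real) \<Rightarrow> ('a \<Rightarrow> 'b::complex_normed_vector) set"
  where "bounded_ops S N = {T.
    (\<forall>x\<in>S. \<forall>y\<in>S. T (x + y) = T x + T y) \<and>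
    (\<forall>c. \<forall>x\<in>S. T (c *\<^sub>C x) = c *\<^sub>C T x) \<and>
    (\<exists>C. \<forall>x\<in>S. norm (T x) \<le> C * N x) \<and>
    (\<forall>x. x \<notin> S \<longrightarrow> T x = 0)}"

definition op_norm :: "'a set \<Rightarrow> ('a \<Rightarrow> real) \<Rightarrow> ('a \<Rightarrow> 'b::real_normed_vector) \<Rightarrow> real"
  where "op_norm S N T = (SUP x\<in>unit_ball S N. norm (T x))"

definition dual :: "'a::complex_vector set \<Rightarrow> ('a \<Rightarrow> real) \<Rightarrow> ('a \<Rightarrow> complex) set"
  where "dual S N = bounded_ops S N"

definition dual_ball :: "('a::complex_normed_vector \<Rightarrow> complex) set"
  where "dual_ball = unit_ball (dual UNIV norm) (op_norm UNIV norm)"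

subsection \<open>Weighted spaces of holomorphic functions\<close>

definition weight_on :: "'e::topological_space set \<Rightarrow> ('e \<Rightarrow> real) \<Rightarrow> bool"
  where "weight_on U v \<longleftrightarrow> continuous_on U v \<and> (\<forall>x\<in>U. 0 < v x)"

text \<open>
  Holomorphy between complex Banach spaces is complex Frechet differentiability at each point of the
  open set: the derivative is a bounded real-linear map that is moreover complex homogeneous.
\<close>

definition holo_on ::
  "'e::complex_normed_vector set \<Rightarrow> ('e \<Rightarrow> 'f::complex_normed_vector) \<Rightarrow> bool"
  where "holo_on U f \<longleftrightarrow>
    (\<forall>x\<in>U. \<exists>f'. (f has_derivative f') (at x) \<and> (\<forall>c h. f' (c *\<^sub>C h) = c *\<^sub>C f' h))"

definition Hv ::
  "'e::complex_normed_vector set \<Rightarrow> ('e \<Rightarrow> real) \<Rightarrow> ('e \<Rightarrow> 'f::complex_normed_vector) set"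
  where "Hv U v = {f. holo_on U f \<and> bdd_above ((\<lambda>x. v x * norm (f x)) ` U) \<and> (\<forall>x. x \<notin> U \<longrightarrow> f x = 0)}"

text \<open>The supremum is taken in \<open>[0,\<infinity>)\<close>; the inserted \<open>0\<close> only matters for empty \<open>U\<close>.\<close>

definition Hv_norm :: "'e set \<Rightarrow> ('e \<Rightarrow> real) \<Rightarrow> ('e \<Rightarrow> 'f::real_normed_vector) \<Rightarrow> real"
  where "Hv_norm U v f = Sup (insert 0 ((\<lambda>x. v x * norm (f x)) ` U))"

definition compact_open :: "'e::topological_space set \<Rightarrow> ('e \<Rightarrow> 'f::topological_space) topology"
  where "compact_open U =
    topology_generated_by {{f. f ` K \<subseteq> V} | K V. compact K \<and> K \<subseteq> U \<and> open V}"

subsection \<open>Linearization\<close>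

definition Gv :: "'e::complex_normed_vector set \<Rightarrow> ('e \<Rightarrow> real) \<Rightarrow> (('e \<Rightarrow> complex) \<Rightarrow> complex) set"
  where "Gv U v = {\<phi> \<in> dual (Hv U v) (Hv_norm U v).
    continuous_map (subtopology (compact_open U) (unit_ball (Hv U v) (Hv_norm U v))) euclidean \<phi>}"

definition Gv_norm ::
  "'e::complex_normed_vector set \<Rightarrow> ('e \<Rightarrow> real) \<Rightarrow> (('e \<Rightarrow> complex) \<Rightarrow> complex) \<Rightarrow> real"
  where "Gv_norm U v = op_norm (Hv U v) (Hv_norm U v)"

definition \<Delta>v ::
  "'e::complex_normed_vector set \<Rightarrow> ('e \<Rightarrow> real) \<Rightarrow> 'e \<Rightarrow> ('e \<Rightarrow> complex) \<Rightarrow> complex"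
  where "\<Delta>v U v x = (\<lambda>g. if g \<in> Hv U v then g x else 0)"

definition linearization ::
  "'e::complex_normed_vector set \<Rightarrow> ('e \<Rightarrow> real) \<Rightarrow> ('e \<Rightarrow> 'f::complex_normed_vector)
    \<Rightarrow> (('e \<Rightarrow> complex) \<Rightarrow> complex) \<Rightarrow> 'f"
  where "linearization U v f =
    (THE T. T \<in> bounded_ops (Gv U v) (Gv_norm U v) \<and> (\<forall>x\<in>U. T (\<Delta>v U v x) = f x))"

subsection \<open>Sequence spaces\<close>

definition lp :: "real \<Rightarrow> (nat \<Rightarrow> 'a::real_normed_vector) set"
  where "lp q = {x. summable (\<lambda>n. norm (x n) powr q)}"

definition lp_norm :: "real \<Rightarrow> (nat \<Rightarrow> 'a::real_normed_vector) \<Rightarrow> real"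
  where "lp_norm q x = (\<Sum>n. norm (x n) powr q) powr (1 / q)"

definition lpw :: "real \<Rightarrow> (nat \<Rightarrow> 'a::complex_normed_vector) set"
  where "lpw q = {x. (\<forall>\<phi>\<in>dual_ball. (\<lambda>n. \<phi> (x n)) \<in> lp q) \<and>
    bdd_above ((\<lambda>\<phi>. lp_norm q (\<lambda>n. \<phi> (x n))) ` dual_ball)}"

definition lpw_norm :: "real \<Rightarrow> (nat \<Rightarrow> 'a::complex_normed_vector) \<Rightarrow> real"
  where "lpw_norm q x = (SUP \<phi>\<in>dual_ball. lp_norm q (\<lambda>n. \<phi> (x n)))"

definition lpu :: "real \<Rightarrow> (nat \<Rightarrow> 'a::complex_normed_vector) set"
  where "lpu q = {x \<in> lpw q. (\<lambda>m. lpw_norm q (\<lambda>n. x (n + m))) \<longlonglongrightarrow> 0}"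

definition c0 :: "(nat \<Rightarrow> 'a::real_normed_vector) set"
  where "c0 = {x. x \<longlonglongrightarrow> 0}"

definition c0w :: "(nat \<Rightarrow> 'a::complex_normed_vector) set"
  where "c0w = {x. \<forall>\<phi>\<in>dual UNIV norm. (\<lambda>n. \<phi> (x n)) \<longlonglongrightarrow> 0}"

definition sup_norm :: "(nat \<Rightarrow> 'a::real_normed_vector) \<Rightarrow> real"
  where "sup_norm x = (SUP n. norm (x n))"

subsection \<open>The three kinds of \<open>p\<close>-compactness\<close>

text \<open>The index \<open>p \<in> [1,\<infinity>]\<close> is an extended nonnegative real.\<close>

definition coeff_ball :: "ennreal \<Rightarrow> (nat \<Rightarrow> complex) set"
  where "coeff_ball p =
    (if p = 1 then unit_ball c0 sup_norm
     else if p = \<infinity> then unit_ball (lp 1) (lp_norm 1)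
     else let q = enn2real p / (enn2real p - 1) in unit_ball (lp q) (lp_norm q))"

definition pconv :: "ennreal \<Rightarrow> (nat \<Rightarrow> 'a::complex_normed_vector) \<Rightarrow> 'a set"
  where "pconv p x = {y. \<exists>a\<in>coeff_ball p. (\<lambda>n. a n *\<^sub>C x n) sums y}"

datatype ideal_kind = Kp | Kwp | Kup

fun seq_space :: "ideal_kind \<Rightarrow> ennreal \<Rightarrow> (nat \<Rightarrow> 'a::complex_normed_vector) set"
  where
    "seq_space Kp p = (if p = \<infinity> then c0 else lp (enn2real p))"
  | "seq_space Kwp p = (if p = \<infinity> then c0w else lpw (enn2real p))"
  | "seq_space Kup p = (if p = \<infinity> then c0 else lpu (enn2real p))"

fun seq_norm :: "ideal_kind \<Rightarrow> ennreal \<Rightarrow> (nat \<Rightarrow> 'a::complex_normed_vector) \<Rightarrow> real"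
  where
    "seq_norm Kp p x = (if p = \<infinity> then sup_norm x else lp_norm (enn2real p) x)"
  | "seq_norm Kwp p x = (if p = \<infinity> then sup_norm x else lpw_norm (enn2real p) x)"
  | "seq_norm Kup p x = (if p = \<infinity> then sup_norm x else lpw_norm (enn2real p) x)"

definition rel_compact :: "ideal_kind \<Rightarrow> ennreal \<Rightarrow> 'a::complex_normed_vector set \<Rightarrow> bool"
  where "rel_compact I p K \<longleftrightarrow> (\<exists>x\<in>seq_space I p. K \<subseteq> pconv p x)"

text \<open>The size is only meaningful for sets \<open>K\<close> satisfying \<open>rel_compact I p K\<close>.\<close>

definition size_of :: "ideal_kind \<Rightarrow> ennreal \<Rightarrow> 'a::complex_normed_vector set \<Rightarrow> real"
  where "size_of I p K = Inf {seq_norm I p x | x. x \<in> seq_space I p \<and> K \<subseteq> pconv p x}"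

definition op_ideal ::
  "ideal_kind \<Rightarrow> ennreal \<Rightarrow> 'a::complex_vector set \<Rightarrow> ('a \<Rightarrow> real) \<Rightarrow> ('a \<Rightarrow> 'b::complex_normed_vector) set"
  where "op_ideal I p S N = {T \<in> bounded_ops S N. rel_compact I p (T ` unit_ball S N)}"

definition op_ideal_norm ::
  "ideal_kind \<Rightarrow> ennreal \<Rightarrow> 'a set \<Rightarrow> ('a \<Rightarrow> real) \<Rightarrow> ('a \<Rightarrow> 'b::complex_normed_vector) \<Rightarrow> real"
  where "op_ideal_norm I p S N T = size_of I p (T ` unit_ball S N)"

definition HvI ::
  "ideal_kind \<Rightarrow> ennreal \<Rightarrow> 'e::complex_normed_vector set \<Rightarrow> ('e \<Rightarrow> real)
    \<Rightarrow> ('e \<Rightarrow> 'f::complex_normed_vector) set"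
  where "HvI I p U v = {f \<in> Hv U v. rel_compact I p ((\<lambda>x. v x *\<^sub>R f x) ` U)}"

definition HvI_norm ::
  "ideal_kind \<Rightarrow> ennreal \<Rightarrow> 'e set \<Rightarrow> ('e \<Rightarrow> real) \<Rightarrow> ('e \<Rightarrow> 'f::complex_normed_vector) \<Rightarrow> real"
  where "HvI_norm I p U v f = size_of I p ((\<lambda>x. v x *\<^sub>R f x) ` U)"

end

theory Submission
  imports Defs "HOL-Complex_Analysis.Cauchy_Integral_Formula" "HOL-Library.Nat_Bijection"
begin

text \<open>
  Every \<open>\<phi>\<close> in the unit ball of the predual is a series \<open>\<Sum>n. \<psi> n\<close> of finite combinations of the atoms
  \<open>v x \<delta>\<^sub>x\<close> whose total masses are at most \<open>1 + e\<close> for \<open>n = 0\<close> and \<open>e / 4 ^ n\<close> for the \<open>n\<close>-th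
  correction, with a bound that does not depend on \<open>\<phi>\<close>. This follows from the Hahn-Banach theorem: finite
  combinations are dense because a functional that is continuous for the compact-open topology on the
  ball is almost determined by finitely many point values, and they are dense with the sharp constant
  because a separating functional restricts along \<open>\<Delta>\<^sub>v\<close> to a function in the unit ball of \<open>\<H>\<^sub>v\<close>.
  The operator \<open>T\<^sub>f\<close> is the unique \<open>T\<close> with \<open>y (T \<phi>) = \<phi> (y \<circ> f)\<close> for all functionals \<open>y\<close>.

  If \<open>(vf)(U)\<close> lies in the \<open>p\<close>-convex hull of \<open>x\<close>, then \<open>T\<^sub>f \<phi>\<close> is a sum of elements of \<open>(1 + e)\<close> and
  \<open>e / 4 ^ n\<close> times that hull. Weighting countably many sequences and the reciprocal of their
  coefficients shows that such sums lie in the hull of one sequence of norm at most \<open>(1 + C e)\<close> times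
  that of \<open>x\<close>. No closedness of \<open>p\<close>-convex hulls is needed; they are not closed for \<open>p = 1\<close>.
  The statement on countable sums also gives the triangle inequality and completeness.
\<close>

subsection \<open>Complex vector spaces and linear maps on subspaces\<close>

text \<open>Knowing only that the image of the unit ball lies in the closed absolutely convex hull
  of the images of the atoms is not enough, because \<open>pconv\<close> hulls need not be closed.
  Uniformity replaces closedness: the mass bounds depend on n alone, so the n-th terms for all
  \<phi> together lie in one fixed multiple of one hull, and the image of the ball is covered by a
  sum of countably many sets. The powers of 4 leave room: masses decaying like 4^-n stay summable
  after multiplication by factors of order 2^n, and such unbounded factors produce null tails at
  \<open>p = 1\<close> and \<open>p = \<infinity>\<close>, where bounded sections alone do not. As
  sizes are infima, a constant \<open>1 + C e\<close> suffices. Cauchy estimates that are uniform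
  over the unit ball of \<open>Hv\<close> serve twice. They give equicontinuity, which reduces
  compact-open neighbourhoods to finitely many points, and they make the evaluation map
  differentiable in norm, so that composing any bounded operator on the predual with it gives a
  holomorphic function. The latter represents functionals on the predual by functions and proves
  that linearization is onto.\<close>

lemma scaleC_0_left [simp]: "0 *\<^sub>C (x::'a::complex_vector) = 0"
  using scaleC_add_left[of 0 0 x] by simp

lemma scaleC_0_right [simp]: "a *\<^sub>C (0::'a::complex_vector) = 0"
  using scaleC_add_right[of a 0 "0::'a"] by simp

lemma scaleC_minus_left: "(- a) *\<^sub>C (x::'a::complex_vector) = - (a *\<^sub>C x)"
  using scaleC_add_left[of a "-a" x] by (simp add: eq_neg_iff_add_eq_0 add.commute)

lemma scaleC_minus_right: "a *\<^sub>C (- x::'a::complex_vector) = - (a *\<^sub>C x)"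
  using scaleC_add_right[of a x "-x"] by (simp add: eq_neg_iff_add_eq_0 add.commute)

lemma scaleC_minus1 [simp]: "(- 1) *\<^sub>C (x::'a::complex_vector) = - x"
  by (simp add: scaleC_minus_left scaleC_one)

lemma scaleC_diff_right: "a *\<^sub>C (x - y::'a::complex_vector) = a *\<^sub>C x - a *\<^sub>C y"
  by (simp only: diff_conv_add_uminus scaleC_add_right scaleC_minus_right)

lemma scaleC_fun_apply [simp]: "(c *\<^sub>C f) x = c *\<^sub>C f x"
  by (simp add: scaleC_fun_def)

text \<open>The simplifier applies these rules to unapplied operations too and turns, say, \<open>\<phi> + \<psi>\<close> into an
  abstraction. They have to be removed where functionals are treated as vectors.\<close>

lemmas pointwise_simps = plus_fun_apply zero_fun_apply minus_apply uminus_apply scaleC_fun_apply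

instance cbanach \<subseteq> banach ..

lemma scaleC_complex_eq [simp]: "c *\<^sub>C (z::complex) = c * z"
  by (simp add: scaleC_complex_def)

lemma csubspace_0: "csubspace S \<Longrightarrow> 0 \<in> S"
  and csubspace_add: "csubspace S \<Longrightarrow> x \<in> S \<Longrightarrow> y \<in> S \<Longrightarrow> x + y \<in> S"
  and csubspace_scale: "csubspace S \<Longrightarrow> x \<in> S \<Longrightarrow> c *\<^sub>C x \<in> S"
  by (auto simp: csubspace_def)

lemma csubspace_uminus: "csubspace S \<Longrightarrow> x \<in> S \<Longrightarrow> - x \<in> S"
  using csubspace_scale[of S x "-1"] by simp

lemma csubspace_diff: "csubspace S \<Longrightarrow> x \<in> S \<Longrightarrow> y \<in> S \<Longrightarrow> x - y \<in> S"
  using csubspace_add[of S x "-y"] csubspace_uminus by force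

lemma csubspace_UNIV: "csubspace UNIV"
  by (simp add: csubspace_def)

definition clinear_on :: "'a::complex_vector set \<Rightarrow> ('a \<Rightarrow> 'b::complex_vector) \<Rightarrow> bool"
  where "clinear_on S T \<longleftrightarrow>
    (\<forall>x\<in>S. \<forall>y\<in>S. T (x + y) = T x + T y) \<and> (\<forall>c. \<forall>x\<in>S. T (c *\<^sub>C x) = c *\<^sub>C T x)"

lemma clinear_on_add: "clinear_on S T \<Longrightarrow> x \<in> S \<Longrightarrow> y \<in> S \<Longrightarrow> T (x + y) = T x + T y"
  and clinear_on_scale: "clinear_on S T \<Longrightarrow> x \<in> S \<Longrightarrow> T (c *\<^sub>C x) = c *\<^sub>C T x"
  by (auto simp: clinear_on_def)

lemma clinear_on_minus: "clinear_on S T \<Longrightarrow> x \<in> S \<Longrightarrow> T (- x) = - T x"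
  using clinear_on_scale[of S T x "-1"] by simp

lemma clinear_on_diff:
  "csubspace S \<Longrightarrow> clinear_on S T \<Longrightarrow> x \<in> S \<Longrightarrow> y \<in> S \<Longrightarrow> T (x - y) = T x - T y"
  using clinear_on_add[of S T x "-y"] clinear_on_minus[of S T y] csubspace_uminus by force

lemma clinear_on_0: "csubspace S \<Longrightarrow> clinear_on S T \<Longrightarrow> T 0 = 0"
  using clinear_on_scale[of S T 0 0] csubspace_0 by force

lemma bounded_ops_iff:
  "T \<in> bounded_ops S N \<longleftrightarrow>
    clinear_on S T \<and> (\<exists>C. \<forall>x\<in>S. norm (T x) \<le> C * N x) \<and> (\<forall>x. x \<notin> S \<longrightarrow> T x = 0)"
  by (auto simp: bounded_ops_def clinear_on_def)

subsection \<open>The Mazur--Orlicz form of the Hahn--Banach theorem\<close>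

definition sublinear_on :: "'a::complex_vector set \<Rightarrow> ('a \<Rightarrow> real) \<Rightarrow> bool"
  where "sublinear_on S q \<longleftrightarrow>
    (\<forall>x\<in>S. \<forall>y\<in>S. q (x + y) \<le> q x + q y) \<and>
    (\<forall>x\<in>S. \<forall>t\<ge>0. q (complex_of_real t *\<^sub>C x) = t * q x)"

lemma sublinear_on_0: "csubspace S \<Longrightarrow> sublinear_on S q \<Longrightarrow> q 0 = 0"
  unfolding sublinear_on_def csubspace_def
  by (metis mult_zero_left of_real_0 order_refl scaleC_0_left)

lemma sublinear_on_ge: 
  assumes "csubspace S" "sublinear_on S q" "x \<in> S"
  shows "- q (- x) \<le> q x"
proof -
  have "q (x + - x) \<le> q x + q (- x)"
    using assms csubspace_uminus unfolding sublinear_on_def by blast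
  then show ?thesis using sublinear_on_0[OF assms(1,2)] by simp
qed

lemma sublinear_onI:
  assumes S: "csubspace S" and q0: "q 0 = 0"
    and add: "\<And>x y. x \<in> S \<Longrightarrow> y \<in> S \<Longrightarrow> q (x + y) \<le> q x + q y"
    and scale: "\<And>x t. x \<in> S \<Longrightarrow> t > 0 \<Longrightarrow> q (complex_of_real t *\<^sub>C x) \<le> t * q x"
  shows "sublinear_on S q"
proof -
  have "q (complex_of_real t *\<^sub>C x) = t * q x" if x: "x \<in> S" and t: "t \<ge> 0" for x t
  proof (cases "t = 0")
    case False
    then have t: "t > 0" using t by simp
    have "q x = q (complex_of_real (1/t) *\<^sub>C complex_of_real t *\<^sub>C x)"
      using t by (simp add: scaleC_scaleC scaleC_one flip: of_real_mult)
    also have "\<dots> \<le> (1/t) * q (complex_of_real t *\<^sub>C x)"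
      using t x csubspace_scale[OF S] by (intro scale) auto
    finally have "t * q x \<le> q (complex_of_real t *\<^sub>C x)"
      using t by (simp add: field_simps)
    with scale[OF x t] show ?thesis by simp
  qed (simp add: q0)
  then show ?thesis using add by (auto simp: sublinear_on_def)
qed

text \<open>A pair \<open>(y, r)\<close> stands for the constraint \<open>r \<le> L y\<close> on the
  functional sought. Cones of such pairs express prescribed values on a ray or a subspace as well as
  one-sided separation conditions.\<close>

definition real_cone :: "('a::complex_vector \<times> real) set \<Rightarrow> bool"
  where "real_cone C \<longleftrightarrow> (0, 0) \<in> C \<and>
    (\<forall>y r z s. (y, r) \<in> C \<longrightarrow> (z, s) \<in> C \<longrightarrow> (y + z, r + s) \<in> C) \<and>
    (\<forall>y r t. (y, r) \<in> C \<longrightarrow> t > 0 \<longrightarrow> (complex_of_real t *\<^sub>C y, t * r) \<in> C)"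

text \<open>\<open>q'\<close> is the infimum of \<open>q (x + y) - r\<close> over the constraints. A
  linear \<open>L\<close> below \<open>q'\<close> satisfies \<open>L (- y) \<le> - r\<close>, so the
  lower constraints have become part of an upper bound.\<close>

lemma sublinear_reduction:
  assumes S: "csubspace S" and q: "sublinear_on S q" and C: "real_cone C"
    and dom: "\<And>y r. (y, r) \<in> C \<Longrightarrow> y \<in> S \<and> r \<le> q y"
  shows "\<exists>q'. sublinear_on S q' \<and> (\<forall>x\<in>S. q' x \<le> q x) \<and> (\<forall>x. x \<notin> S \<longrightarrow> q' x = 0) \<and>
    (\<forall>y r. (y, r) \<in> C \<longrightarrow> q' (- y) \<le> - r)"
proof -
  define V where "V x = (\<lambda>(y, r). q (x + y) - r) ` C" for x
  define q' where "q' x = (if x \<in> S then Inf (V x) else 0)" for x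
  \<comment> \<open>Subadditivity for \<open>y = (x + y) + (- x)\<close> together with
    \<open>r \<le> q y\<close> bounds the infimum below independently of the constraint.\<close>
  have lower: "- q (- x) \<le> w" if x: "x \<in> S" and w: "w \<in> V x" for x w
  proof -
    obtain y r where yr: "(y, r) \<in> C" "w = q (x + y) - r" using w by (auto simp: V_def)
    have "q ((x + y) + (- x)) \<le> q (x + y) + q (- x)"
      using q x dom[OF yr(1)] csubspace_add[OF S] csubspace_uminus[OF S]
      unfolding sublinear_on_def by blast
    then show ?thesis using dom[OF yr(1)] yr(2) by simp
  qed
  have bdd: "bdd_below (V x)" if "x \<in> S" for x
    using lower[OF that] by (rule bdd_belowI)
  have ne: "V x \<noteq> {}" for x using C by (auto simp: V_def real_cone_def)
  have up: "q' x \<le> q (x + y) - r" if "x \<in> S" "(y, r) \<in> C" for x y r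
    unfolding q'_def using that by (auto simp: V_def intro!: cInf_lower bdd[unfolded V_def])
  have ex: "\<exists>y r. (y, r) \<in> C \<and> q (x + y) - r < q' x + e" if "x \<in> S" "e > 0" for x e
  proof -
    have "Inf (V x) < q' x + e" using that by (simp add: q'_def)
    then show ?thesis using cInf_lessD[OF ne] by (fastforce simp: V_def)
  qed
  have le: "q' x \<le> q x" if "x \<in> S" for x
    using up[OF that, of 0 0] C by (simp add: real_cone_def)
  have "sublinear_on S q'"
  proof (rule sublinear_onI[OF S])
    have "- q (- 0) \<le> Inf (V 0)"
      using lower[OF csubspace_0[OF S]] by (intro cInf_greatest ne) auto
    then show "q' 0 = 0"
      using le[of 0] sublinear_on_0[OF S q] csubspace_0[OF S] by (simp add: q'_def)
  next
    fix x y assume xy: "x \<in> S" "y \<in> S"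
    show "q' (x + y) \<le> q' x + q' y"
    proof (rule field_le_epsilon)
      fix e :: real assume "e > 0"
      obtain y1 r1 where 1: "(y1, r1) \<in> C" "q (x + y1) - r1 < q' x + e / 2"
        using ex[OF xy(1), of "e/2"] \<open>e > 0\<close> by auto
      obtain y2 r2 where 2: "(y2, r2) \<in> C" "q (y + y2) - r2 < q' y + e / 2"
        using ex[OF xy(2), of "e/2"] \<open>e > 0\<close> by auto
      have "q' (x + y) \<le> q ((x + y) + (y1 + y2)) - (r1 + r2)"
        using xy 1 2 C by (intro up csubspace_add[OF S]) (auto simp: real_cone_def)
      also have "(x + y) + (y1 + y2) = (x + y1) + (y + y2)" by (simp add: algebra_simps)
      also have "q \<dots> \<le> q (x + y1) + q (y + y2)"
        using q xy dom[OF 1(1)] dom[OF 2(1)] csubspace_add[OF S]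
        unfolding sublinear_on_def by blast
      finally show "q' (x + y) \<le> q' x + q' y + e" using 1 2 by simp
    qed
  next
    fix x and t :: real assume x: "x \<in> S" and t: "t > 0"
    show "q' (complex_of_real t *\<^sub>C x) \<le> t * q' x"
    proof (rule field_le_epsilon)
      fix e :: real assume "e > 0"
      obtain y r where 1: "(y, r) \<in> C" "q (x + y) - r < q' x + e / t"
        using ex[OF x, of "e/t"] \<open>e > 0\<close> t by auto
      have "q' (complex_of_real t *\<^sub>C x)
          \<le> q (complex_of_real t *\<^sub>C x + complex_of_real t *\<^sub>C y) - t * r"
        using x 1 C t by (intro up csubspace_scale[OF S]) (auto simp: real_cone_def)
      also have "\<dots> = t * (q (x + y) - r)"
        using q x dom[OF 1(1)] csubspace_add[OF S] t
        by (simp add: sublinear_on_def right_diff_distrib flip: scaleC_add_right)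
      also have "\<dots> \<le> t * (q' x + e / t)" using 1 t by (intro mult_left_mono) auto
      also have "\<dots> = t * q' x + e" using t by (simp add: field_simps)
      finally show "q' (complex_of_real t *\<^sub>C x) \<le> t * q' x + e" .
    qed
  qed
  moreover have "q' (- y) \<le> - r" if "(y, r) \<in> C" for y r
    using up[of "-y" y r] that dom[OF that] csubspace_uminus[OF S] sublinear_on_0[OF S q] by simp
  ultimately show ?thesis using le by (intro exI[of _ q']) (auto simp: q'_def)
qed

text \<open>Zorn's lemma: the pointwise infimum of a chain is again sublinear, and it is finite
  because every member \<open>c\<close> satisfies
  \<open>- q (- x) \<le> - c (- x) \<le> c x\<close>. Fixing the values outside \<open>S\<close>
  allows the pointwise order on whole functions.\<close>

lemma minimal_sublinear:
  assumes S: "csubspace S" and q: "sublinear_on S q" and q_out: "\<And>x. x \<notin> S \<Longrightarrow> q x = 0"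
  shows "\<exists>m. sublinear_on S m \<and> (\<forall>x\<in>S. m x \<le> q x) \<and>
    (\<forall>m'. sublinear_on S m' \<longrightarrow> (\<forall>x\<in>S. m' x \<le> m x) \<longrightarrow> (\<forall>x\<in>S. m' x = m x))"
proof -
  define A where "A = {m. sublinear_on S m \<and> (\<forall>x\<in>S. m x \<le> q x) \<and> (\<forall>x. x \<notin> S \<longrightarrow> m x = 0)}"
  \<comment> \<open>The order is reversed, so that a maximal element in the sense of Zorn is a
    minimal functional.\<close>
  define P where "P a b = (\<forall>x. b x \<le> a x)" for a b :: "'a \<Rightarrow> real"
  have po: "partial_order_on A (relation_of P A)"
    by (rule partial_order_on_relation_ofI) (auto simp: P_def fun_eq_iff intro: order_trans antisym)
  have zorn: "\<exists>m\<in>A. \<forall>a\<in>A. P m a \<longrightarrow> a = m"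
  proof (rule predicate_Zorn[OF po])
    fix C assume C: "C \<in> Chains (relation_of P A)"
    have CA: "c \<in> A" if "c \<in> C" for c
      using C that unfolding Chains_def relation_of_def by auto
    have chain: "P a b \<or> P b a" if "a \<in> C" "b \<in> C" for a b
      using C that unfolding Chains_def relation_of_def by auto
    show "\<exists>u\<in>A. \<forall>a\<in>C. P a u"
    proof (cases "C = {}")
      case True
      have "q \<in> A" using q q_out by (auto simp: A_def)
      then show ?thesis using True by auto
    next
      case False
      define u where "u x = (INF c\<in>C. c x)" for x
      have lb: "- q (- x) \<le> c x" if "x \<in> S" "c \<in> C" for x c
        using sublinear_on_ge[OF S, of c x] CA[OF that(2)] that csubspace_uminus[OF S that(1)]
        by (fastforce simp: A_def)
      have bdd: "bdd_below ((\<lambda>c. c x) ` C)" if "x \<in> S" for x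
        using lb[OF that] by (intro bdd_belowI[of _ "- q (- x)"]) auto
      have ule: "u x \<le> c x" if "x \<in> S" "c \<in> C" for x c
        unfolding u_def using that by (intro cINF_lower bdd)
      have uout: "u x = 0" if "x \<notin> S" for x
      proof -
        have "(\<lambda>c. c x) ` C = {0}" using False CA that by (auto simp: A_def image_iff)
        then show ?thesis unfolding u_def by simp
      qed
      have ex: "\<exists>c\<in>C. c x < u x + e" if "x \<in> S" "e > 0" for x e
      proof -
        have "(INF c\<in>C. c x) < u x + e" using that by (simp add: u_def)
        then show ?thesis using cINF_less_iff[OF False bdd[OF that(1)]] by blast
      qed
      have "sublinear_on S u"
      proof (rule sublinear_onI[OF S])
        have "(\<lambda>c. c 0) ` C = {0}"
          using False CA sublinear_on_0[OF S] by (force simp: A_def image_iff)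
        then show "u 0 = 0" unfolding u_def by simp
      next
        fix x y assume xy: "x \<in> S" "y \<in> S"
        show "u (x + y) \<le> u x + u y"
        proof (rule field_le_epsilon)
          fix e :: real assume "e > 0"
          obtain a where a: "a \<in> C" "a x < u x + e / 2" using ex[OF xy(1), of "e/2"] \<open>e > 0\<close> by auto
          obtain b where b: "b \<in> C" "b y < u y + e / 2" using ex[OF xy(2), of "e/2"] \<open>e > 0\<close> by auto
          \<comment> \<open>One of two members of a chain lies below the other everywhere, so a
            single \<open>c\<close> serves both at \<open>x\<close> and at \<open>y\<close>.\<close>
          obtain c where c: "c \<in> C" "c x \<le> a x" "c y \<le> b y"
            using chain[OF a(1) b(1)] a(1) b(1) by (auto simp: P_def)
          have "u (x + y) \<le> c (x + y)" using xy c csubspace_add[OF S] by (intro ule) auto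
          also have "\<dots> \<le> c x + c y" using CA[OF c(1)] xy by (auto simp: A_def sublinear_on_def)
          finally show "u (x + y) \<le> u x + u y + e" using a b c by simp
        qed
      next
        fix x and t :: real assume x: "x \<in> S" and t: "t > 0"
        show "u (complex_of_real t *\<^sub>C x) \<le> t * u x"
        proof (rule field_le_epsilon)
          fix e :: real assume "e > 0"
          obtain a where a: "a \<in> C" "a x < u x + e / t" using ex[OF x, of "e/t"] \<open>e > 0\<close> t by auto
          have "u (complex_of_real t *\<^sub>C x) \<le> a (complex_of_real t *\<^sub>C x)"
            using x a csubspace_scale[OF S] by (intro ule) auto
          also have "\<dots> = t * a x" using CA[OF a(1)] x t by (auto simp: A_def sublinear_on_def)
          also have "\<dots> \<le> t * (u x + e / t)" using a t by (intro mult_left_mono) auto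
          also have "\<dots> = t * u x + e" using t by (simp add: field_simps)
          finally show "u (complex_of_real t *\<^sub>C x) \<le> t * u x + e" .
        qed
      qed
      moreover have "u x \<le> q x" if "x \<in> S" for x
      proof -
        obtain c where "c \<in> C" using False by auto
        then show ?thesis using ule[OF that] CA that by (fastforce simp: A_def)
      qed
      ultimately have "u \<in> A" using uout by (auto simp: A_def)
      moreover have "P a u" if "a \<in> C" for a
        unfolding P_def using ule[OF _ that] uout CA[OF that] by (auto simp: A_def) (metis order_refl)
      ultimately show ?thesis by blast
    qed
  qed
  obtain m where m: "m \<in> A" and min: "\<And>a. a \<in> A \<Longrightarrow> P m a \<Longrightarrow> a = m" using zorn by blast
  show ?thesis
  proof (intro exI[of _ m] conjI allI impI ballI)
    fix m' x assume m': "sublinear_on S m'" and le: "\<forall>x\<in>S. m' x \<le> m x" and x: "x \<in> S"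
    define a where "a z = (if z \<in> S then m' z else 0)" for z
    have "sublinear_on S a"
      using m' csubspace_add[OF S] csubspace_scale[OF S] by (auto simp: sublinear_on_def a_def)
    moreover have "a z \<le> m z" for z using le m by (auto simp: a_def A_def)
    moreover have "a z \<le> q z" if "z \<in> S" for z
      using \<open>a z \<le> m z\<close> m that by (force simp: A_def)
    ultimately have "a = m" by (intro min) (auto simp: A_def P_def a_def)
    then have "a x = m x" by simp
    then show "m' x = m x" using x by (simp add: a_def)
  qed (use m in \<open>auto simp: A_def\<close>)
qed

text \<open>Minimality forces linearity. The reduction applied to a minimal \<open>m\<close> and the
  ray through \<open>(y, m y)\<close> yields a functional below \<open>m\<close>, hence
  \<open>m\<close> itself, and its constraint then reads \<open>m (- y) \<le> - m y\<close>. An odd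
  sublinear functional is linear.\<close>

lemma mazur_orlicz:
  assumes S: "csubspace S" and q: "sublinear_on S q" and C: "real_cone C"
    and dom: "\<And>y r. (y, r) \<in> C \<Longrightarrow> y \<in> S \<and> r \<le> q y"
  obtains L where "\<And>x y. x \<in> S \<Longrightarrow> y \<in> S \<Longrightarrow> L (x + y) = L x + (L y :: real)"
    "\<And>x t. x \<in> S \<Longrightarrow> L (complex_of_real t *\<^sub>C x) = t * L x"
    "\<And>x. x \<in> S \<Longrightarrow> L x \<le> q x" "\<And>y r. (y, r) \<in> C \<Longrightarrow> r \<le> L y"
proof -
  obtain q' where q': "sublinear_on S q'" "\<And>x. x \<in> S \<Longrightarrow> q' x \<le> q x"
    "\<And>x. x \<notin> S \<Longrightarrow> q' x = 0" "\<And>y r. (y, r) \<in> C \<Longrightarrow> q' (- y) \<le> - r"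
    using sublinear_reduction[OF S q C dom] by blast
  obtain m where m: "sublinear_on S m" "\<And>x. x \<in> S \<Longrightarrow> m x \<le> q' x"
    and min: "\<And>m' x. sublinear_on S m' \<Longrightarrow> (\<And>x. x \<in> S \<Longrightarrow> m' x \<le> m x) \<Longrightarrow> x \<in> S \<Longrightarrow> m' x = m x"
    using minimal_sublinear[OF S q'(1) q'(3)] by blast
  have neg: "m (- y) = - m y" if y: "y \<in> S" for y
  proof -
    define D where "D = {(complex_of_real t *\<^sub>C y, t * m y) | t. t \<ge> 0}"
    have D: "real_cone D"
      unfolding real_cone_def
    proof (intro conjI allI impI)
      show "(0, 0) \<in> D" unfolding D_def by (auto intro!: exI[of _ 0])
    next
      fix a r b s assume "(a, r) \<in> D" "(b, s) \<in> D"
      then obtain t t' where "a = complex_of_real t *\<^sub>C y" "r = t * m y" "t \<ge> 0"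
        "b = complex_of_real t' *\<^sub>C y" "s = t' * m y" "t' \<ge> 0" by (auto simp: D_def)
      then show "(a + b, r + s) \<in> D"
        unfolding D_def by (auto intro!: exI[of _ "t + t'"] simp: scaleC_add_left distrib_right)
    next
      fix a r and t :: real assume "(a, r) \<in> D" "t > 0"
      then obtain t' where "a = complex_of_real t' *\<^sub>C y" "r = t' * m y" "t' \<ge> 0" by (auto simp: D_def)
      then show "(complex_of_real t *\<^sub>C a, t * r) \<in> D"
        unfolding D_def using \<open>t > 0\<close> by (auto intro!: exI[of _ "t * t'"] simp: scaleC_scaleC)
    qed
    have domD: "z \<in> S \<and> r \<le> m z" if "(z, r) \<in> D" for z r
      using that m(1) y csubspace_scale[OF S] by (auto simp: D_def sublinear_on_def)
    have "\<exists>m'. sublinear_on S m' \<and> (\<forall>x\<in>S. m' x \<le> m x) \<and> (\<forall>x. x \<notin> S \<longrightarrow> m' x = 0) \<and>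
        (\<forall>y r. (y, r) \<in> D \<longrightarrow> m' (- y) \<le> - r)"
      by (rule sublinear_reduction[OF S m(1) D domD])
    then obtain m' where m': "sublinear_on S m'" "\<And>x. x \<in> S \<Longrightarrow> m' x \<le> m x"
      "\<And>y r. (y, r) \<in> D \<Longrightarrow> m' (- y) \<le> - r"
      by blast
    have "(y, m y) \<in> D" unfolding D_def by (auto intro!: exI[of _ 1] simp: scaleC_one)
    then have "m' (- y) \<le> - m y" by (rule m'(3))
    then have "m (- y) \<le> - m y" using min[OF m'(1,2)] csubspace_uminus[OF S y] by metis
    then show ?thesis using sublinear_on_ge[OF S m(1) y] by linarith
  qed
  show thesis
  proof (rule that[of m])
    fix x y assume xy: "x \<in> S" "y \<in> S"
    have "m ((x + y) + - y) \<le> m (x + y) + m (- y)" "m (x + y) \<le> m x + m y"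
      using m(1) xy csubspace_add[OF S] csubspace_uminus[OF S] unfolding sublinear_on_def by blast+
    then show "m (x + y) = m x + m y" using neg[OF xy(2)] by simp
  next
    fix x and t :: real assume x: "x \<in> S"
    show "m (complex_of_real t *\<^sub>C x) = t * m x"
    proof (cases "t \<ge> 0")
      case False
      have "m (complex_of_real t *\<^sub>C x) = - m (- (complex_of_real t *\<^sub>C x))"
        using neg[OF csubspace_scale[OF S x]] by simp
      also have "- (complex_of_real t *\<^sub>C x) = complex_of_real (- t) *\<^sub>C x"
        by (simp add: scaleC_minus_left)
      also have "m \<dots> = - t * m x" using m(1) x False by (simp add: sublinear_on_def del: of_real_minus)
      finally show ?thesis by simp
    qed (use m(1) x in \<open>auto simp: sublinear_on_def\<close>)
  next
    fix x assume "x \<in> S" then show "m x \<le> q x" using m(2) q'(2) order_trans by blast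
  next
    fix y r assume yr: "(y, r) \<in> C"
    have "m (- y) \<le> - r" using m(2) q'(4)[OF yr] dom[OF yr] csubspace_uminus[OF S] order_trans by blast
    then show "r \<le> m y" using neg dom[OF yr] by simp
  qed
qed

definition cseminorm_on :: "'a::complex_vector set \<Rightarrow> ('a \<Rightarrow> real) \<Rightarrow> bool"
  where "cseminorm_on S N \<longleftrightarrow>
    (\<forall>x\<in>S. \<forall>y\<in>S. N (x + y) \<le> N x + N y) \<and> (\<forall>c. \<forall>x\<in>S. N (c *\<^sub>C x) = cmod c * N x)"

text \<open>\<open>L\<close> is the real part of the complex functional
  \<open>L x - \<i> L (\<i> x)\<close>. Multiplying \<open>x\<close> by a phase that makes the value
  of this functional real and nonnegative carries the bound \<open>L \<le> N\<close> over to the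
  modulus.\<close>

theorem complex_mazur_orlicz:
  assumes S: "csubspace S" and N: "cseminorm_on S N" and C: "real_cone C"
    and dom: "\<And>y r. (y, r) \<in> C \<Longrightarrow> y \<in> S \<and> r \<le> N y"
  obtains F where "F \<in> bounded_ops S N" "\<And>x. x \<in> S \<Longrightarrow> cmod (F x) \<le> N x"
    "\<And>y r. (y, r) \<in> C \<Longrightarrow> r \<le> Re (F y)"
proof -
  have "sublinear_on S N" using N by (auto simp: cseminorm_on_def sublinear_on_def)
  then obtain L where L: "\<And>x y. x \<in> S \<Longrightarrow> y \<in> S \<Longrightarrow> L (x + y) = L x + (L y :: real)"
    "\<And>x t. x \<in> S \<Longrightarrow> L (complex_of_real t *\<^sub>C x) = t * L x"
    "\<And>x. x \<in> S \<Longrightarrow> L x \<le> N x" "\<And>y r. (y, r) \<in> C \<Longrightarrow> r \<le> L y"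
    by (rule mazur_orlicz[OF S _ C dom]) (assumption, (rule that; blast))
  define F where "F x = (if x \<in> S then Complex (L x) (- L (\<i> *\<^sub>C x)) else 0)" for x
  have add: "F (x + y) = F x + F y" if "x \<in> S" "y \<in> S" for x y
    using that csubspace_add[OF S that] csubspace_scale[OF S] L(1)
    by (simp add: F_def complex_eq_iff scaleC_add_right)
  have realscale: "F (complex_of_real t *\<^sub>C x) = complex_of_real t * F x" if "x \<in> S" for x t
  proof -
    have "\<i> *\<^sub>C complex_of_real t *\<^sub>C x = complex_of_real t *\<^sub>C \<i> *\<^sub>C x"
      by (simp add: scaleC_scaleC mult.commute)
    then show ?thesis using that csubspace_scale[OF S] L(2) by (simp add: F_def complex_eq_iff)
  qed
  have iscale: "F (\<i> *\<^sub>C x) = \<i> * F x" if "x \<in> S" for x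
  proof -
    have "\<i> *\<^sub>C \<i> *\<^sub>C x = complex_of_real (-1) *\<^sub>C x" by (simp add: scaleC_scaleC)
    then have "L (\<i> *\<^sub>C \<i> *\<^sub>C x) = - L x" using L(2)[OF that, of "-1"] by simp
    then show ?thesis using that csubspace_scale[OF S] by (simp add: F_def complex_eq_iff)
  qed
  have scale: "F (c *\<^sub>C x) = c * F x" if x: "x \<in> S" for c x
  proof -
    have c: "c = complex_of_real (Re c) + complex_of_real (Im c) * \<i>"
      by (simp add: complex_eq_iff)
    have "c *\<^sub>C x = complex_of_real (Re c) *\<^sub>C x + complex_of_real (Im c) *\<^sub>C \<i> *\<^sub>C x"
      by (subst c) (simp only: scaleC_add_left scaleC_scaleC)
    then have "F (c *\<^sub>C x) = complex_of_real (Re c) * F x + complex_of_real (Im c) * (\<i> * F x)"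
      using x csubspace_scale[OF S] by (simp add: add realscale iscale)
    then show ?thesis by (subst c) (simp add: algebra_simps)
  qed
  have le: "cmod (F x) \<le> N x" if x: "x \<in> S" for x
  proof -
    obtain c where c: "cmod c = 1" "c * F x = complex_of_real (cmod (F x))"
    proof (cases "F x = 0")
      case False
      show ?thesis using False
        by (intro that[of "cnj (F x) / cmod (F x)"])
          (auto simp: norm_divide power2_eq_square complex_norm_square[symmetric] mult.commute[of "cnj _"] divide_simps)
    qed (auto intro: that[of 1])
    have "cmod (F x) = Re (F (c *\<^sub>C x))" using scale[OF x] c by simp
    also have "\<dots> = L (c *\<^sub>C x)" using csubspace_scale[OF S x] by (simp add: F_def)
    also have "\<dots> \<le> N (c *\<^sub>C x)" using csubspace_scale[OF S x] by (rule L(3))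
    also have "\<dots> = N x" using N c x by (simp add: cseminorm_on_def)
    finally show ?thesis .
  qed
  show thesis
  proof (rule that[of F])
    show "F \<in> bounded_ops S N"
      unfolding bounded_ops_def using add scale le by (auto simp: F_def intro!: exI[of _ 1])
  next
    fix y r assume "(y, r) \<in> C" then show "r \<le> Re (F y)" using L(4) dom by (auto simp: F_def)
  qed (rule le)
qed

subsection \<open>Normed spaces on carriers and their operators\<close>

lemma cnormed_space_onD:
  assumes "cnormed_space_on S N"
  shows "csubspace S" "cseminorm_on S N"
    "x \<in> S \<Longrightarrow> 0 \<le> N x" "x \<in> S \<Longrightarrow> N x = 0 \<longleftrightarrow> x = 0"
    "x \<in> S \<Longrightarrow> y \<in> S \<Longrightarrow> N (x + y) \<le> N x + N y" "x \<in> S \<Longrightarrow> N (c *\<^sub>C x) = cmod c * N x"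
  using assms by (auto simp: cnormed_space_on_def cseminorm_on_def)

lemma cnormed_space_on_0: "cnormed_space_on S N \<Longrightarrow> N 0 = 0"
  using cnormed_space_onD(1,4) csubspace_0 by blast

lemma cnormed_space_on_minus: "cnormed_space_on S N \<Longrightarrow> x \<in> S \<Longrightarrow> N (- x) = N x"
  using cnormed_space_onD(6)[of S N x "-1"] by simp

lemma cnormed_space_on_diff:
  "cnormed_space_on S N \<Longrightarrow> x \<in> S \<Longrightarrow> y \<in> S \<Longrightarrow> N (x - y) \<le> N x + N y"
  using cnormed_space_onD(5)[of S N x "-y"] cnormed_space_on_minus csubspace_uminus cnormed_space_onD(1)
  by fastforce

lemma cnormed_space_on_subset:
  "cnormed_space_on S N \<Longrightarrow> csubspace T \<Longrightarrow> T \<subseteq> S \<Longrightarrow> cnormed_space_on T N"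
  unfolding cnormed_space_on_def by (meson subsetD)

lemma cnormed_space_on_UNIV_norm:
  "cnormed_space_on (UNIV :: 'a::complex_normed_vector set) norm"
  by (simp add: cnormed_space_on_def csubspace_UNIV norm_triangle_ineq norm_scaleC)

text \<open>The reverse inequality is the assumed one for the factor \<open>1 / c\<close> at the
  point \<open>c x\<close>.\<close>

lemma absolutely_homogeneousI:
  fixes N :: "'a::complex_vector \<Rightarrow> real"
  assumes S: "\<And>c x. x \<in> S \<Longrightarrow> c *\<^sub>C x \<in> S" and N0: "N 0 = 0"
    and le: "\<And>c x. x \<in> S \<Longrightarrow> N (c *\<^sub>C x) \<le> cmod c * N x" and x: "x \<in> S"
  shows "N (c *\<^sub>C x) = cmod c * N x"
proof (cases "c = 0")
  case False
  have "N ((1/c) *\<^sub>C c *\<^sub>C x) \<le> cmod (1/c) * N (c *\<^sub>C x)" by (rule le[OF S[OF x]])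
  then have "cmod c * N x \<le> N (c *\<^sub>C x)"
    using False by (simp add: scaleC_scaleC scaleC_one norm_divide field_simps)
  with le[OF x, of c] show ?thesis by simp
qed (simp add: N0)

context
  fixes S :: "'a::complex_vector set" and N
  assumes SN: "cnormed_space_on S N"
begin

lemma zero_in_unit_ball: "0 \<in> unit_ball S N"
  using cnormed_space_on_0[OF SN] csubspace_0[OF cnormed_space_onD(1)[OF SN]]
  by (simp add: unit_ball_def)

lemma op_norm_leI:
  assumes "\<And>x. x \<in> S \<Longrightarrow> N x \<le> 1 \<Longrightarrow> norm (T x) \<le> c"
  shows "op_norm S N T \<le> c"
  unfolding op_norm_def using zero_in_unit_ball assms
  by (intro cSUP_least) (auto simp: unit_ball_def)

lemma bdd_above_unit_ball:
  fixes T :: "'a \<Rightarrow> 'b::complex_normed_vector"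
  assumes "T \<in> bounded_ops S N"
  shows "bdd_above ((\<lambda>x. norm (T x)) ` unit_ball S N)"
proof -
  obtain C where C: "\<And>x. x \<in> S \<Longrightarrow> norm (T x) \<le> C * N x"
    using assms by (auto simp: bounded_ops_iff)
  have "norm (T x) \<le> \<bar>C\<bar>" if "x \<in> unit_ball S N" for x
  proof -
    have x: "x \<in> S" "0 \<le> N x" "N x \<le> 1" using that cnormed_space_onD(3)[OF SN] by (auto simp: unit_ball_def)
    have "C * N x \<le> \<bar>C\<bar> * 1" using x by (intro mult_mono) auto
    then show ?thesis using C[OF x(1)] by linarith
  qed
  then show ?thesis by (intro bdd_aboveI2)
qed

lemma op_norm_nonneg:
  fixes T :: "'a \<Rightarrow> 'b::complex_normed_vector"
  assumes "T \<in> bounded_ops S N"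
  shows "0 \<le> op_norm S N T"
  unfolding op_norm_def
  by (rule order_trans[OF norm_ge_zero[of "T 0"] cSUP_upper[OF zero_in_unit_ball bdd_above_unit_ball[OF assms]]])

lemma op_norm_bound:
  fixes T :: "'a \<Rightarrow> 'b::complex_normed_vector"
  assumes T: "T \<in> bounded_ops S N" and x: "x \<in> S"
  shows "norm (T x) \<le> op_norm S N T * N x"
proof (cases "x = 0")
  case True
  have "T 0 = 0" using T clinear_on_0[OF cnormed_space_onD(1)[OF SN]] by (auto simp: bounded_ops_iff)
  then show ?thesis using True cnormed_space_on_0[OF SN] by simp
next
  case False
  then have Nx: "N x > 0" using cnormed_space_onD(3,4)[OF SN x] by linarith
  define c where "c = complex_of_real (1 / N x)"
  have "c *\<^sub>C x \<in> unit_ball S N"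
    using Nx x csubspace_scale[OF cnormed_space_onD(1)[OF SN]] cnormed_space_onD(6)[OF SN x, of c]
    by (simp add: unit_ball_def c_def norm_divide)
  then have "norm (T (c *\<^sub>C x)) \<le> op_norm S N T"
    unfolding op_norm_def by (intro cSUP_upper bdd_above_unit_ball[OF T])
  moreover have "T (c *\<^sub>C x) = c *\<^sub>C T x" using T x by (auto simp: bounded_ops_def)
  ultimately show ?thesis using Nx by (simp add: norm_scaleC c_def norm_divide field_simps)
qed

lemma cnormed_space_bounded_ops:
  "cnormed_space_on (bounded_ops S N :: ('a \<Rightarrow> 'b::complex_normed_vector) set) (op_norm S N)"
proof -
  let ?B = "bounded_ops S N :: ('a \<Rightarrow> 'b) set"
  note sub = cnormed_space_onD(1)[OF SN]
  have zero: "0 \<in> ?B" by (auto simp: bounded_ops_def intro!: exI[of _ 0])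
  have add: "T + R \<in> ?B" if "T \<in> ?B" "R \<in> ?B" for T R
  proof -
    obtain C D where "\<And>x. x \<in> S \<Longrightarrow> norm (T x) \<le> C * N x" "\<And>x. x \<in> S \<Longrightarrow> norm (R x) \<le> D * N x"
      using \<open>T \<in> ?B\<close> \<open>R \<in> ?B\<close> by (force simp: bounded_ops_def)
    then have "norm (T x + R x) \<le> (C + D) * N x" if "x \<in> S" for x
      using that by (simp add: distrib_right) (meson add_mono norm_triangle_le)
    then show ?thesis using that
      by (auto simp: bounded_ops_def scaleC_add_right)
  qed
  have scale: "c *\<^sub>C T \<in> ?B" if "T \<in> ?B" for c T
  proof -
    obtain C where C: "\<And>x. x \<in> S \<Longrightarrow> norm (T x) \<le> C * N x"
      using \<open>T \<in> ?B\<close> by (force simp: bounded_ops_def)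
    have "norm (c *\<^sub>C T x) \<le> (cmod c * C) * N x" if "x \<in> S" for x
      using C[OF that] by (simp add: norm_scaleC mult.assoc mult_left_mono)
    then have "\<exists>C. \<forall>x\<in>S. norm (c *\<^sub>C T x) \<le> C * N x" by blast
    then show ?thesis using that
      by (auto simp: bounded_ops_def scaleC_add_right scaleC_scaleC mult.commute)
  qed
  have subB: "csubspace ?B" using zero add scale by (simp add: csubspace_def)
  have zero_iff: "op_norm S N T = 0 \<longleftrightarrow> T = 0" if T: "T \<in> ?B" for T
  proof
    assume "op_norm S N T = 0"
    then have "T x = 0" for x using op_norm_bound[OF T, of x] T by (cases "x \<in> S") (auto simp: bounded_ops_def)
    then show "T = 0" by (simp add: fun_eq_iff)
  next
    assume "T = 0"
    then have "op_norm S N T \<le> 0" by (intro op_norm_leI) auto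
    then show "op_norm S N T = 0" using op_norm_nonneg[OF T] by simp
  qed
  have tri: "op_norm S N (T + R) \<le> op_norm S N T + op_norm S N R" if "T \<in> ?B" "R \<in> ?B" for T R
  proof (rule op_norm_leI)
    fix x assume x: "x \<in> S" "N x \<le> 1"
    have "norm ((T + R) x) \<le> norm (T x) + norm (R x)" by (simp add: norm_triangle_ineq)
    also have "\<dots> \<le> op_norm S N T * N x + op_norm S N R * N x"
      using that x by (intro add_mono op_norm_bound)
    also have "\<dots> \<le> op_norm S N T * 1 + op_norm S N R * 1"
      using that x by (intro add_mono mult_left_mono op_norm_nonneg)
    finally show "norm ((T + R) x) \<le> op_norm S N T + op_norm S N R" by simp
  qed
  have hom_le: "op_norm S N (c *\<^sub>C T) \<le> cmod c * op_norm S N T" if "T \<in> ?B" for c T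
  proof (rule op_norm_leI)
    fix x assume x: "x \<in> S" "N x \<le> 1"
    have "norm (T x) \<le> op_norm S N T * N x" using that x by (intro op_norm_bound)
    also have "\<dots> \<le> op_norm S N T * 1" using that x by (intro mult_left_mono op_norm_nonneg)
    finally show "norm ((c *\<^sub>C T) x) \<le> cmod c * op_norm S N T"
      by (simp add: norm_scaleC mult_left_mono)
  qed
  have hom: "op_norm S N (c *\<^sub>C T) = cmod c * op_norm S N T" if T: "T \<in> ?B" for c T
    by (rule absolutely_homogeneousI[where S = ?B]) (use scale zero_iff[OF zero] hom_le T in \<open>auto simp del: pointwise_simps\<close>)
  show ?thesis unfolding cnormed_space_on_def
    using subB zero_iff tri hom op_norm_nonneg by blast
qed

end

subsection \<open>The dual of a complex normed space\<close>

lemma real_cone_ray: "real_cone {(complex_of_real t *\<^sub>C x, t * r) | t. t \<ge> 0}"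
  unfolding real_cone_def
proof (intro conjI allI impI, goal_cases)
  case 1
  then show ?case by (auto intro!: exI[of _ 0])
next
  case (2 a r' b s)
  then obtain t t' where "a = complex_of_real t *\<^sub>C x" "r' = t * r" "t \<ge> 0"
    "b = complex_of_real t' *\<^sub>C x" "s = t' * r" "t' \<ge> 0" by auto
  then show ?case
    by (auto intro!: exI[of _ "t + t'"] simp: scaleC_add_left distrib_right)
next
  case (3 a r' t)
  then obtain t' where "a = complex_of_real t' *\<^sub>C x" "r' = t' * r" "t' \<ge> 0" by auto
  then show ?case using 3 by (auto intro!: exI[of _ "t * t'"] simp: scaleC_scaleC)
qed

lemma dual_ball_iff:
  "\<phi> \<in> dual_ball \<longleftrightarrow> clinear_on UNIV \<phi> \<and> (\<forall>x. cmod (\<phi> x) \<le> norm x)"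
  for \<phi> :: "'a::complex_normed_vector \<Rightarrow> complex"
proof
  assume "\<phi> \<in> dual_ball"
  then have \<phi>: "\<phi> \<in> bounded_ops UNIV norm" "op_norm UNIV norm \<phi> \<le> 1"
    by (auto simp: dual_ball_def unit_ball_def dual_def)
  have "cmod (\<phi> x) \<le> norm x" for x
    using op_norm_bound[OF cnormed_space_on_UNIV_norm \<phi>(1), of x] \<phi>(2)
      mult_right_mono[OF \<phi>(2), of "norm x"] by auto
  then show "clinear_on UNIV \<phi> \<and> (\<forall>x. cmod (\<phi> x) \<le> norm x)"
    using \<phi> by (auto simp: bounded_ops_iff)
next
  assume *: "clinear_on UNIV \<phi> \<and> (\<forall>x. cmod (\<phi> x) \<le> norm x)"
  then have "\<phi> \<in> bounded_ops UNIV norm" by (auto simp: bounded_ops_iff intro: exI[of _ 1])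
  moreover have "op_norm UNIV norm \<phi> \<le> 1"
    using * by (intro op_norm_leI[OF cnormed_space_on_UNIV_norm]) (auto intro: order_trans)
  ultimately show "\<phi> \<in> dual_ball" by (auto simp: dual_ball_def unit_ball_def dual_def)
qed

lemma dual_ball_bound: "\<phi> \<in> dual_ball \<Longrightarrow> cmod (\<phi> x) \<le> norm x"
  and dual_ball_clinear: "\<phi> \<in> dual_ball \<Longrightarrow> clinear_on UNIV \<phi>"
  by (auto simp: dual_ball_iff)

lemma zero_in_dual_ball: "(\<lambda>_. 0) \<in> dual_ball"
  by (simp add: dual_ball_iff clinear_on_def)

lemma clinear_on_bounded_linear:
  fixes T :: "'a::complex_normed_vector \<Rightarrow> 'b::complex_normed_vector"
  assumes "clinear_on UNIV T" "\<And>x. norm (T x) \<le> C * norm x"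
  shows "bounded_linear T"
proof (rule bounded_linear_intro[of _ C])
  show "T (x + y) = T x + T y" for x y using assms(1) by (simp add: clinear_on_def)
  show "T (r *\<^sub>R x) = r *\<^sub>R T x" for r x
    using assms(1) by (simp add: clinear_on_def scaleR_scaleC)
  show "norm (T x) \<le> norm x * C" for x using assms(2)[of x] by (simp add: mult.commute)
qed

lemma dual_ball_bounded_linear: "\<phi> \<in> dual_ball \<Longrightarrow> bounded_linear \<phi>"
  by (rule clinear_on_bounded_linear[of _ 1]) (auto simp: dual_ball_iff)

text \<open>The ray constraint yields \<open>norm x \<le> Re (F x)\<close>; together with
  \<open>cmod (F x) \<le> norm x\<close> this leaves no room for an imaginary part.\<close>

lemma dual_ball_norming:
  fixes x :: "'a::complex_normed_vector"
  obtains \<phi> where "\<phi> \<in> dual_ball" "\<phi> x = complex_of_real (norm x)"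
proof -
  let ?C = "{(complex_of_real t *\<^sub>C x, t * norm x) | t. t \<ge> 0}"
  show thesis
  proof (rule complex_mazur_orlicz[OF csubspace_UNIV
        cnormed_space_onD(2)[OF cnormed_space_on_UNIV_norm] real_cone_ray[of x "norm x"]])
    show "y \<in> UNIV \<and> r \<le> norm y" if "(y, r) \<in> ?C" for y r
      using that by (auto simp: norm_scaleC)
  next
    fix F :: "'a \<Rightarrow> complex"
    assume F: "F \<in> bounded_ops UNIV norm" "\<And>x. x \<in> UNIV \<Longrightarrow> cmod (F x) \<le> norm x"
      "\<And>y r. (y, r) \<in> ?C \<Longrightarrow> r \<le> Re (F y)"
    have "(x, norm x) \<in> ?C" by (auto intro!: exI[of _ 1] simp: scaleC_one)
    then have "norm x \<le> Re (F x)" by (rule F(3))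
    then have "Re (F x) = norm x" "cmod (F x) = norm x"
      using F(2)[of x] complex_Re_le_cmod[of "F x"] by auto
    moreover from this have "Im (F x) = 0" using cmod_power2[of "F x"] by simp
    ultimately have "F x = complex_of_real (norm x)" by (simp add: complex_eq_iff)
    moreover have "F \<in> dual_ball" using F by (auto simp: dual_ball_iff bounded_ops_iff)
    ultimately show thesis by (rule that[rotated])
  qed
qed

lemma norm_le_dual_ball:
  assumes "\<And>\<phi>. \<phi> \<in> dual_ball \<Longrightarrow> cmod (\<phi> x) \<le> c"
  shows "norm x \<le> c"
proof -
  obtain \<phi> where "\<phi> \<in> dual_ball" "\<phi> x = complex_of_real (norm x)" by (rule dual_ball_norming)
  then show ?thesis using assms[of \<phi>] by simp
qed

lemma dual_ball_separates:
  assumes "\<And>\<phi>. \<phi> \<in> dual_ball \<Longrightarrow> \<phi> x = \<phi> y"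
  shows "x = y"
proof -
  have "norm (x - y) \<le> 0"
    by (rule norm_le_dual_ball)
      (use assms clinear_on_diff[OF csubspace_UNIV dual_ball_clinear] in fastforce)
  then show ?thesis by simp
qed

lemma dual_eq_scaled_dual_ball:
  assumes "\<phi> \<in> dual UNIV norm"
  obtains c \<psi> where "c > 0" "\<psi> \<in> dual_ball" "\<phi> = (\<lambda>x. complex_of_real c * \<psi> x)"
proof -
  obtain C where C: "\<And>x. cmod (\<phi> x) \<le> C * norm x" and lin: "clinear_on UNIV \<phi>"
    using assms by (auto simp: dual_def bounded_ops_iff)
  define c where "c = \<bar>C\<bar> + 1"
  have "cmod (\<phi> x) \<le> c * norm x" for x
    by (rule order_trans[OF C mult_right_mono]) (auto simp: c_def)
  moreover have "c > 0" by (simp add: c_def add_pos_nonneg)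
  ultimately have "(\<lambda>x. \<phi> x / complex_of_real c) \<in> dual_ball"
    using lin
    by (auto simp: dual_ball_iff clinear_on_def norm_divide add_divide_distrib pos_divide_le_eq mult.commute)
  then show thesis
    by (rule that[OF \<open>c > 0\<close>]) (use \<open>c > 0\<close> in \<open>auto simp: fun_eq_iff\<close>)
qed

text \<open>The uniform boundedness principle for evaluations on the dual, which is complete even
  when \<open>'a\<close> is not. It makes the supremum norm of a weakly null sequence meaningful, as
  the weak case at \<open>p = \<infinity>\<close> requires.\<close>

lemma weakly_null_bounded:
  fixes x :: "nat \<Rightarrow> 'a::complex_normed_vector"
  assumes "\<And>\<phi>. \<phi> \<in> dual_ball \<Longrightarrow> (\<lambda>n. \<phi> (x n)) \<longlonglongrightarrow> 0"
  shows "\<exists>C. \<forall>n. norm (x n) \<le> C"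
proof -
  \<comment> \<open>Baire's theorem is applied to the real dual: these closed sets cover it, since
    every functional is bounded along the sequence.\<close>
  define E where "E k = {T :: 'a \<Rightarrow>\<^sub>L real. \<forall>n. \<bar>blinfun_apply T (x n)\<bar> \<le> real k}" for k :: nat
  have clE: "closed (E k)" for k
  proof -
    have "E k = (\<Inter>n. {T. \<bar>blinfun_apply T (x n)\<bar> \<le> real k})" by (auto simp: E_def)
    also have "closed \<dots>" by (intro closed_INT ballI closed_Collect_le continuous_intros)
    finally show ?thesis .
  qed
  have conv: "(\<lambda>n. blinfun_apply T (x n)) \<longlonglongrightarrow> 0" for T :: "'a \<Rightarrow>\<^sub>L real"
  proof -
    \<comment> \<open>The complex functional whose real part is \<open>T\<close>; the hypothesis
      speaks of complex functionals.\<close>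
    define \<phi> where "\<phi> y = Complex (T y) (- T (\<i> *\<^sub>C y))" for y
    have T_of_real: "T (complex_of_real r *\<^sub>C y) = r * T y" for r y
      using blinfun.scaleR_right[of T r y] by (simp add: scaleR_scaleC)
    have lin: "clinear_on UNIV \<phi>"
      unfolding clinear_on_def
    proof (intro conjI ballI allI)
      show "\<phi> (y + z) = \<phi> y + \<phi> z" for y z
        by (simp add: \<phi>_def complex_eq_iff scaleC_add_right blinfun.add_right)
    next
      fix c y
      have 1: "T (c *\<^sub>C y) = Re c * T y + Im c * T (\<i> *\<^sub>C y)" for c y
      proof -
        have "c *\<^sub>C y = complex_of_real (Re c) *\<^sub>C y + complex_of_real (Im c) *\<^sub>C \<i> *\<^sub>C y"
          by (subst complex_eq[of c]) (simp add: scaleC_add_left scaleC_scaleC mult.commute)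
        then show ?thesis by (simp add: blinfun.add_right T_of_real)
      qed
      show "\<phi> (c *\<^sub>C y) = c *\<^sub>C \<phi> y"
        using 1[of c y] 1[of "\<i> * c" y] by (simp add: \<phi>_def complex_eq_iff scaleC_scaleC)
    qed
    have "cmod (\<phi> y) \<le> (2 * norm T) * norm y" for y
    proof -
      have "cmod (\<phi> y) \<le> \<bar>T y\<bar> + \<bar>T (\<i> *\<^sub>C y)\<bar>" using cmod_le[of "\<phi> y"] by (simp add: \<phi>_def)
      also have "\<dots> \<le> norm T * norm y + norm T * norm (\<i> *\<^sub>C y)"
        by (intro add_mono) (metis norm_blinfun real_norm_def)+
      finally show ?thesis by (simp add: norm_scaleC algebra_simps)
    qed
    with lin have "\<phi> \<in> dual UNIV norm" unfolding dual_def bounded_ops_iff by blast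
    then obtain c \<psi> where "\<psi> \<in> dual_ball" and \<phi>: "\<phi> = (\<lambda>x. complex_of_real c * \<psi> x)"
      by (rule dual_eq_scaled_dual_ball)
    then have "(\<lambda>n. complex_of_real c * \<psi> (x n)) \<longlonglongrightarrow> complex_of_real c * 0"
      by (intro tendsto_mult_left assms)
    then have "(\<lambda>n. \<phi> (x n)) \<longlonglongrightarrow> 0" by (simp add: \<phi>)
    from tendsto_Re[OF this] show ?thesis by (simp add: \<phi>_def)
  qed
  have cover: "\<Union> (range E) = UNIV"
  proof -
    have "\<exists>k. T \<in> E k" for T
    proof -
      obtain K where K: "\<And>n. norm (blinfun_apply T (x n)) \<le> K"
        using convergent_imp_bounded[OF conv[of T]] by (auto simp: bounded_iff)
      obtain k :: nat where "K \<le> real k" using real_arch_simple by blast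
      then show ?thesis using K by (auto simp: E_def intro!: exI[of _ k] intro: order_trans)
    qed
    then show ?thesis by auto
  qed
  have "\<exists>k. interior (E k) \<noteq> {}"
  proof (rule ccontr)
    assume "\<not> ?thesis"
    then have "euclidean interior_of \<Union> (range E) = {}"
      using clE by (intro Baire_category_alt) (auto simp: completely_metrizable_space_euclidean)
    then show False by (simp add: cover)
  qed
  then obtain k T0 where "T0 \<in> interior (E k)" by blast
  then obtain r where r: "r > 0" "cball T0 r \<subseteq> E k" using mem_interior_cball by blast
  have "norm (x n) \<le> 2 * real k / r" for n
  proof -
    obtain \<phi> where \<phi>: "\<phi> \<in> dual_ball" "\<phi> (x n) = complex_of_real (norm (x n))"
      by (rule dual_ball_norming)
    define R where "R = Blinfun (\<lambda>y. Re (\<phi> y))"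
    have "bounded_linear (\<lambda>y. Re (\<phi> y))"
      by (rule bounded_linear_compose[OF bounded_linear_Re dual_ball_bounded_linear[OF \<phi>(1)]])
    then have R: "R y = Re (\<phi> y)" for y by (simp add: R_def bounded_linear_Blinfun_apply)
    have "norm R \<le> 1"
      by (rule norm_blinfun_bound)
        (use dual_ball_bound[OF \<phi>(1)] abs_Re_le_cmod order_trans in \<open>auto simp: R\<close>, blast)
    \<comment> \<open>The centre \<open>T0\<close> and the point \<open>T0 + r R\<close> both obey
      the bound \<open>k\<close> along the sequence, and their difference takes the value
      \<open>r * norm (x n)\<close> at \<open>x n\<close>.\<close>
    then have "T0 + r *\<^sub>R R \<in> cball T0 r" using r(1) by (simp add: dist_norm mult_left_le)
    moreover have "T0 \<in> cball T0 r" using r(1) by simp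
    ultimately have "T0 + r *\<^sub>R R \<in> E k" "T0 \<in> E k" using r(2) by blast+
    then have "\<bar>T0 (x n) + r * R (x n)\<bar> \<le> real k" "\<bar>T0 (x n)\<bar> \<le> real k"
      by (simp_all add: E_def blinfun.add_left blinfun.scaleR_left)
    then have "r * norm (x n) \<le> 2 * real k" using R[of "x n"] \<phi>(2) by simp
    then show ?thesis using r(1) by (simp add: field_simps)
  qed
  then show ?thesis by blast
qed

subsection \<open>Weighted holomorphic functions\<close>

lemma weight_on_pos: "weight_on U v \<Longrightarrow> x \<in> U \<Longrightarrow> 0 < v x"
  by (simp add: weight_on_def)

lemma holo_on_add: "holo_on U f \<Longrightarrow> holo_on U g \<Longrightarrow> holo_on U (f + g)"
  unfolding holo_on_def
proof (intro ballI)
  fix x assume *: "\<forall>x\<in>U. \<exists>f'. (f has_derivative f') (at x) \<and> (\<forall>c h. f' (c *\<^sub>C h) = c *\<^sub>C f' h)"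
    "\<forall>x\<in>U. \<exists>f'. (g has_derivative f') (at x) \<and> (\<forall>c h. f' (c *\<^sub>C h) = c *\<^sub>C f' h)" "x \<in> U"
  then obtain f' g' where "(f has_derivative f') (at x)" "\<forall>c h. f' (c *\<^sub>C h) = c *\<^sub>C f' h"
    "(g has_derivative g') (at x)" "\<forall>c h. g' (c *\<^sub>C h) = c *\<^sub>C g' h" by metis
  then show "\<exists>d. (f + g has_derivative d) (at x) \<and> (\<forall>c h. d (c *\<^sub>C h) = c *\<^sub>C d h)"
    by (intro exI[of _ "\<lambda>h. f' h + g' h"])
      (auto simp: plus_fun_def scaleC_add_right intro!: has_derivative_add)
qed

lemma bounded_linear_scaleC: "bounded_linear (\<lambda>y::'a::complex_normed_vector. c *\<^sub>C y)"
  by (rule clinear_on_bounded_linear[of _ "cmod c"])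
    (auto simp: clinear_on_def scaleC_add_right scaleC_scaleC mult.commute norm_scaleC)

lemma holo_on_bounded_linear_comp:
  assumes f: "holo_on U f" and L: "clinear_on UNIV L" "bounded_linear L"
  shows "holo_on U (\<lambda>x. L (f x))"
  unfolding holo_on_def
proof (intro ballI)
  fix x assume "x \<in> U"
  then obtain f' where "(f has_derivative f') (at x)" "\<forall>c h. f' (c *\<^sub>C h) = c *\<^sub>C f' h"
    using f by (auto simp: holo_on_def)
  then show "\<exists>d. ((\<lambda>x. L (f x)) has_derivative d) (at x) \<and> (\<forall>c h. d (c *\<^sub>C h) = c *\<^sub>C d h)"
    using bounded_linear.has_derivative[OF L(2)] clinear_on_scale[OF L(1)]
    by (intro exI[of _ "\<lambda>h. L (f' h)"]) simp
qed

lemma holo_on_scaleC: "holo_on U f \<Longrightarrow> holo_on U (c *\<^sub>C f)"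
  unfolding scaleC_fun_def
  by (rule holo_on_bounded_linear_comp)
    (auto simp: clinear_on_def scaleC_add_right scaleC_scaleC mult.commute bounded_linear_scaleC)

lemma holo_on_0: "holo_on U 0"
  unfolding holo_on_def zero_fun_def by (auto intro!: exI[of _ "\<lambda>_. 0"])

lemma Hv_norm_bound:
  assumes "f \<in> Hv U v" "x \<in> U"
  shows "v x * norm (f x) \<le> Hv_norm U v f"
  unfolding Hv_norm_def using assms by (intro cSup_upper) (auto simp: Hv_def)

lemma Hv_norm_nonneg: "f \<in> Hv U v \<Longrightarrow> 0 \<le> Hv_norm U v f"
  unfolding Hv_norm_def by (intro cSup_upper) (auto simp: Hv_def)

lemma Hv_norm_leI:
  assumes "0 \<le> c" "\<And>x. x \<in> U \<Longrightarrow> v x * norm (f x) \<le> c"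
  shows "Hv_norm U v f \<le> c"
  unfolding Hv_norm_def using assms by (intro cSup_least) auto

lemma Hv_memI:
  assumes "holo_on U f" "\<And>x. x \<in> U \<Longrightarrow> v x * norm (f x) \<le> c" "\<And>x. x \<notin> U \<Longrightarrow> f x = 0"
  shows "f \<in> Hv U v"
  using assms by (auto simp: Hv_def intro!: bdd_aboveI2)

lemma Hv_outside: "f \<in> Hv U v \<Longrightarrow> x \<notin> U \<Longrightarrow> f x = 0"
  by (simp add: Hv_def)

lemma cnormed_space_Hv:
  assumes v: "weight_on U v"
  shows "cnormed_space_on (Hv U v :: ('e::complex_normed_vector \<Rightarrow> 'f::complex_normed_vector) set) (Hv_norm U v)"
proof -
  let ?H = "Hv U v :: ('e \<Rightarrow> 'f) set"
  note pos = weight_on_pos[OF v]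
  have zero: "0 \<in> ?H" by (rule Hv_memI[of _ _ _ 0]) (auto simp: holo_on_0)
  have add_bd: "v x * norm ((f + g) x) \<le> Hv_norm U v f + Hv_norm U v g"
    if "f \<in> ?H" "g \<in> ?H" "x \<in> U" for f g x
  proof -
    have "v x * norm (f x + g x) \<le> v x * (norm (f x) + norm (g x))"
      using pos[OF that(3)] by (intro mult_left_mono norm_triangle_ineq) auto
    then show ?thesis
      using Hv_norm_bound[OF that(1,3)] Hv_norm_bound[OF that(2,3)] by (simp add: distrib_left)
  qed
  have sc_bd: "v x * norm ((c *\<^sub>C f) x) \<le> cmod c * Hv_norm U v f" if "f \<in> ?H" "x \<in> U" for c f x
    using mult_left_mono[OF Hv_norm_bound[OF that], of "cmod c"] by (simp add: norm_scaleC algebra_simps)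
  have add: "f + g \<in> ?H" if "f \<in> ?H" "g \<in> ?H" for f g
    by (rule Hv_memI[where f = "f + g", OF _ add_bd[OF that]]) (use that holo_on_add[of U f g] in \<open>auto simp: Hv_def\<close>)
  have sc: "c *\<^sub>C f \<in> ?H" if "f \<in> ?H" for c f
    by (rule Hv_memI[where f = "c *\<^sub>C f", OF _ sc_bd[OF that]]) (use that holo_on_scaleC[of U f c] in \<open>auto simp: Hv_def\<close>)
  have zero_iff: "Hv_norm U v f = 0 \<longleftrightarrow> f = 0" if f: "f \<in> ?H" for f
  proof
    assume 0: "Hv_norm U v f = 0"
    have "f x = 0" for x
    proof (cases "x \<in> U")
      case True
      then show ?thesis using Hv_norm_bound[OF f True] pos[OF True] 0 by (simp add: mult_le_0_iff)
    qed (use Hv_outside[OF f] in auto)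
    then show "f = 0" by (simp add: fun_eq_iff)
  next
    assume "f = 0"
    then have "Hv_norm U v f \<le> 0" by (intro Hv_norm_leI) auto
    then show "Hv_norm U v f = 0" using Hv_norm_nonneg[OF f] by simp
  qed
  have tri: "Hv_norm U v (f + g) \<le> Hv_norm U v f + Hv_norm U v g" if "f \<in> ?H" "g \<in> ?H" for f g
    using that by (intro Hv_norm_leI add_bd add_nonneg_nonneg Hv_norm_nonneg)
  have hom_le: "Hv_norm U v (c *\<^sub>C f) \<le> cmod c * Hv_norm U v f" if "f \<in> ?H" for c f
    using that by (intro Hv_norm_leI sc_bd mult_nonneg_nonneg Hv_norm_nonneg) auto
  have hom: "Hv_norm U v (c *\<^sub>C f) = cmod c * Hv_norm U v f" if f: "f \<in> ?H" for c f
    by (rule absolutely_homogeneousI[where S = ?H]) (use sc zero_iff[OF zero] hom_le f in \<open>auto simp del: pointwise_simps\<close>)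
  show ?thesis
    unfolding cnormed_space_on_def csubspace_def
    by (intro conjI ballI allI zero add sc zero_iff tri hom Hv_norm_nonneg)
qed

subsection \<open>Cauchy estimates on complex lines\<close>

text \<open>Cauchy's inequality on the circle of radius \<open>R / 2\<close>, inside the open disc,
  bounds the n-th Taylor coefficient by \<open>M (2 / R) ^ n\<close>. As \<open>R \<ge> 4\<close>,
  the ratio is at most 1/2, so the terms from \<open>n = 2\<close> on add up to at most twice the
  first of these bounds, which gives the constant 8.\<close>

lemma cauchy_taylor_bound:
  assumes hol: "u holomorphic_on ball 0 R" and R: "R \<ge> 4"
    and bd: "\<And>z. z \<in> ball 0 R \<Longrightarrow> cmod (u z) \<le> M"
  shows "cmod (deriv u 0) \<le> 2 * M / R" "cmod (u 1 - u 0 - deriv u 0) \<le> 8 * M / R\<^sup>2"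
proof -
  define \<rho> where "\<rho> = R / 2"
  have \<rho>: "\<rho> \<ge> 2" "\<rho> > 0" using R by (auto simp: \<rho>_def)
  have M: "M \<ge> 0" using order_trans[OF norm_ge_zero bd[of 0]] R by auto
  have c: "cmod ((deriv ^^ n) u 0 / fact n) \<le> M * (1 / \<rho>) ^ n" for n
  proof -
    have "norm ((deriv ^^ n) u 0) \<le> fact n * M / \<rho> ^ n"
    proof (rule Cauchy_inequality)
      show "u holomorphic_on ball 0 \<rho>" by (rule holomorphic_on_subset[OF hol]) (use R in \<open>auto simp: \<rho>_def\<close>)
      show "continuous_on (cball 0 \<rho>) u"
        by (rule continuous_on_subset[OF holomorphic_on_imp_continuous_on[OF hol]])
          (use R in \<open>auto simp: \<rho>_def\<close>)
      show "norm (u x) \<le> M" if "norm (0 - x) = \<rho>" for x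
        using that R by (intro bd) (auto simp: \<rho>_def)
    qed (use \<rho> in auto)
    then show ?thesis by (simp add: norm_divide field_simps)
  qed
  show "cmod (deriv u 0) \<le> 2 * M / R" using c[of 1] R by (simp add: \<rho>_def field_simps)
  have s: "(\<lambda>n. (deriv ^^ n) u 0 / fact n) sums u 1"
    using holomorphic_power_series[OF hol, of 1] R by simp
  from sums_split_initial_segment[OF this, of 2]
  have s2: "(\<lambda>n. (deriv ^^ (n + 2)) u 0 / fact (n + 2)) sums (u 1 - u 0 - deriv u 0)"
    by (simp add: numeral_2_eq_2 algebra_simps)
  have geo: "(\<lambda>n. M * (1 / \<rho>)\<^sup>2 * (1 / \<rho>) ^ n) sums (M * (1 / \<rho>)\<^sup>2 * (1 / (1 - 1 / \<rho>)))"
    by (intro sums_mult geometric_sums) (use \<rho> in auto)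
  have "cmod (u 1 - u 0 - deriv u 0) \<le> M * (1 / \<rho>)\<^sup>2 * (1 / (1 - 1 / \<rho>))"
    unfolding sums_unique[OF s2] sums_unique[OF geo]
  proof (rule norm_suminf_le[OF _ sums_summable[OF geo]])
    fix n show "cmod ((deriv ^^ (n + 2)) u 0 / fact (n + 2)) \<le> M * (1 / \<rho>)\<^sup>2 * (1 / \<rho>) ^ n"
      using c[of "n+2"] by (simp only: power_add mult_ac)
  qed
  also have "\<dots> \<le> M * (1 / \<rho>)\<^sup>2 * 2"
  proof (rule mult_left_mono)
    show "1 / (1 - 1 / \<rho>) \<le> 2" using \<rho> by (simp add: field_simps)
  qed (use M in auto)
  also have "\<dots> = 8 * M / R\<^sup>2" by (simp add: \<rho>_def power2_eq_square)
  finally show "cmod (u 1 - u 0 - deriv u 0) \<le> 8 * M / R\<^sup>2" .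
qed

lemma holo_on_frechet_derivative:
  assumes "holo_on U g" "x \<in> U"
  shows "(g has_derivative frechet_derivative g (at x)) (at x)"
    "frechet_derivative g (at x) (c *\<^sub>C h) = c *\<^sub>C frechet_derivative g (at x) h"
proof -
  obtain f' where f': "(g has_derivative f') (at x)" "\<forall>c h. f' (c *\<^sub>C h) = c *\<^sub>C f' h"
    using assms by (auto simp: holo_on_def)
  have "f' = frechet_derivative g (at x)" by (rule frechet_derivative_at[OF f'(1)])
  then show "(g has_derivative frechet_derivative g (at x)) (at x)"
    "frechet_derivative g (at x) (c *\<^sub>C h) = c *\<^sub>C frechet_derivative g (at x) h"
    using f' by auto
qed

text \<open>Complex homogeneity turns the Frechet derivative, restricted to a complex line, into
  multiplication by a complex number, so that one-variable theory applies.\<close>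

lemma holo_on_line:
  assumes g: "holo_on U g" and x: "x + z *\<^sub>C h \<in> U"
  shows "((\<lambda>z. g (x + z *\<^sub>C h)) has_field_derivative frechet_derivative g (at (x + z *\<^sub>C h)) h) (at z)"
proof -
  have bl: "bounded_linear (\<lambda>z. z *\<^sub>C h)"
    by (rule clinear_on_bounded_linear[of _ "norm h"])
      (auto simp: clinear_on_def scaleC_add_left scaleC_scaleC norm_scaleC)
  have "((\<lambda>z. x + z *\<^sub>C h) has_derivative (\<lambda>w. w *\<^sub>C h)) (at z)"
    using has_derivative_add[OF has_derivative_const[of x "at z"] bounded_linear.has_derivative[OF bl has_derivative_ident]]
    by simp
  from has_derivative_compose[OF this holo_on_frechet_derivative(1)[OF g x]]
  have "((\<lambda>z. g (x + z *\<^sub>C h)) has_derivative (\<lambda>w. frechet_derivative g (at (x + z *\<^sub>C h)) (w *\<^sub>C h))) (at z)" .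
  moreover have "(\<lambda>w. frechet_derivative g (at (x + z *\<^sub>C h)) (w *\<^sub>C h))
      = (*) (frechet_derivative g (at (x + z *\<^sub>C h)) h)"
    by (simp add: fun_eq_iff holo_on_frechet_derivative(2)[OF g x])
  ultimately show ?thesis
    unfolding has_field_derivative_def by simp
qed

text \<open>The constants are uniform in \<open>g\<close>, which is what the later arguments rest
  on. Near \<open>x\<close> the weight is at least \<open>v x / 2\<close>, so \<open>g\<close> is
  bounded there by \<open>2 / v x\<close> times its norm; Cauchy's estimates on the lines
  \<open>z \<mapsto> x + z h\<close> do the rest.\<close>

lemma Hv_taylor:
  fixes U :: "'e::complex_normed_vector set"
  assumes U: "open U" and v: "weight_on U v" and x: "x \<in> U"
  obtains r C where "r > 0" "C \<ge> 0" "ball x r \<subseteq> U"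
    "\<And>g :: 'e \<Rightarrow> complex. \<And>h. g \<in> Hv U v \<Longrightarrow>
       cmod (frechet_derivative g (at x) h) \<le> C * Hv_norm U v g * norm h"
    "\<And>g :: 'e \<Rightarrow> complex. \<And>h. g \<in> Hv U v \<Longrightarrow> norm h < r \<Longrightarrow>
       cmod (g (x + h) - g x - frechet_derivative g (at x) h) \<le> C * Hv_norm U v g * (norm h)\<^sup>2"
proof -
  obtain r1 where r1: "r1 > 0" "ball x r1 \<subseteq> U" using U x open_contains_ball by blast
  have "continuous (at x) v" using v U x by (simp add: weight_on_def continuous_on_eq_continuous_at)
  then obtain r2 where r2: "r2 > 0" "\<And>y. dist y x < r2 \<Longrightarrow> dist (v y) (v x) < v x / 2"
    unfolding continuous_at_eps_delta using weight_on_pos[OF v x] by (meson half_gt_zero)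
  define s where "s = min r1 r2"
  have s: "s > 0" using r1 r2 by (simp add: s_def)
  define a where "a = 2 / v x"
  have a: "a > 0" using weight_on_pos[OF v x] by (simp add: a_def)
  have bd: "cmod (g y) \<le> a * Hv_norm U v g" if g: "g \<in> Hv U v" and y: "y \<in> ball x s" for g :: "'e \<Rightarrow> complex" and y
  proof -
    have yU: "y \<in> U" using y r1 by (auto simp: s_def)
    have "v x / 2 \<le> v y" using r2(2)[of y] y by (auto simp: s_def dist_commute dist_real_def abs_if split: if_splits)
    then have "v x / 2 * cmod (g y) \<le> v y * cmod (g y)" by (intro mult_right_mono) auto
    also have "\<dots> \<le> Hv_norm U v g" by (rule Hv_norm_bound[OF g yU])
    finally show ?thesis using weight_on_pos[OF v x] by (simp add: a_def field_simps)
  qed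
  define C where "C = max (2 * a / s) (8 * a / s\<^sup>2)"
  have est: "cmod (frechet_derivative g (at x) h) \<le> 2 * a / s * Hv_norm U v g * norm h \<and>
     cmod (g (x + h) - g x - frechet_derivative g (at x) h) \<le> 8 * a / s\<^sup>2 * Hv_norm U v g * (norm h)\<^sup>2"
    if g: "g \<in> Hv U v" and h: "norm h \<le> s / 4" "h \<noteq> 0" for g :: "'e \<Rightarrow> complex" and h
  proof -
    \<comment> \<open>For \<open>cmod z < R\<close> the point \<open>x + z h\<close> stays in the
      ball of radius \<open>s\<close>. The condition \<open>R \<ge> 4\<close> is the origin of the
      radius \<open>s / 4\<close>.\<close>
    define R where "R = s / norm h"
    have R: "R \<ge> 4" using h by (simp add: R_def field_simps)
    have inb: "x + z *\<^sub>C h \<in> ball x s" if "z \<in> ball 0 R" for z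
      using that h by (simp add: R_def norm_scaleC dist_norm field_simps)
    have inU: "x + z *\<^sub>C h \<in> U" if "z \<in> ball 0 R" for z
      using inb[OF that] r1 by (auto simp: s_def)
    define u where "u z = g (x + z *\<^sub>C h)" for z
    have der: "(u has_field_derivative frechet_derivative g (at (x + z *\<^sub>C h)) h) (at z)"
      if "z \<in> ball 0 R" for z
      unfolding u_def using g inU[OF that] by (intro holo_on_line) (auto simp: Hv_def)
    have hol: "u holomorphic_on ball 0 R"
      unfolding holomorphic_on_def
      using der field_differentiable_def field_differentiable_at_within by blast
    have d0: "deriv u 0 = frechet_derivative g (at x) h"
      using DERIV_imp_deriv[OF der[of 0]] R by simp
    have "cmod (u z) \<le> a * Hv_norm U v g" if "z \<in> ball 0 R" for z
      unfolding u_def by (rule bd[OF g inb[OF that]])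
    note cb = cauchy_taylor_bound[OF hol R this]
    have "u 1 = g (x + h)" "u 0 = g x" by (simp_all add: u_def scaleC_one)
    then show ?thesis
      using cb s h unfolding d0 by (simp add: R_def field_simps power2_eq_square)
  qed
  have lin: "frechet_derivative g (at x) (c *\<^sub>C h) = c * frechet_derivative g (at x) h"
    if "g \<in> Hv U v" for g :: "'e \<Rightarrow> complex" and c h
    using that holo_on_frechet_derivative(2)[OF _ x, of g] by (auto simp: Hv_def)
  show thesis
  proof (rule that[of "s / 4" C])
    show "s / 4 > 0" "ball x (s / 4) \<subseteq> U" using s r1 by (auto simp: s_def)
    show "C \<ge> 0" using a s by (simp add: C_def le_max_iff_disj)
  next
    fix g :: "'e \<Rightarrow> complex" and h assume g: "g \<in> Hv U v"
    show "cmod (frechet_derivative g (at x) h) \<le> C * Hv_norm U v g * norm h"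
    proof (cases "h = 0")
      case True
      then show ?thesis using lin[OF g, of 0 h] by simp
    next
      case False
      \<comment> \<open>Here \<open>h\<close> is arbitrary: it is rescaled to length
        \<open>s / 4\<close>, and homogeneity of the derivative cancels the factor
        \<open>t\<close>.\<close>
      define t where "t = s / 4 / norm h"
      have t: "t > 0" using s False by (simp add: t_def)
      have "norm (complex_of_real t *\<^sub>C h) = t * norm h" using t by (simp add: norm_scaleC)
      then have "norm (complex_of_real t *\<^sub>C h) \<le> s / 4" using False by (simp add: t_def)
      moreover have "complex_of_real t *\<^sub>C h \<noteq> 0"
        using t False norm_scaleC[of "complex_of_real t" h] by (metis mult_eq_0_iff norm_eq_zero norm_of_real of_real_eq_0_iff order_less_irrefl)
      ultimately have "t * cmod (frechet_derivative g (at x) h) \<le> 2 * a / s * Hv_norm U v g * (t * norm h)"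
        using est[OF g, of "complex_of_real t *\<^sub>C h"] t by (simp add: lin[OF g] norm_mult norm_scaleC)
      then have "t * cmod (frechet_derivative g (at x) h) \<le> t * (2 * a / s * Hv_norm U v g * norm h)"
        by (simp only: mult_ac)
      then have "cmod (frechet_derivative g (at x) h) \<le> 2 * a / s * Hv_norm U v g * norm h"
        using t by (simp only: mult_le_cancel_left_pos)
      also have "\<dots> \<le> C * Hv_norm U v g * norm h"
        by (intro mult_right_mono) (auto simp: C_def Hv_norm_nonneg[OF g])
      finally show ?thesis .
    qed
  next
    fix g :: "'e \<Rightarrow> complex" and h :: 'e assume g: "g \<in> Hv U v" and h: "norm h < s / 4"
    show "cmod (g (x + h) - g x - frechet_derivative g (at x) h) \<le> C * Hv_norm U v g * (norm h)\<^sup>2"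
    proof (cases "h = 0")
      case True
      then show ?thesis using lin[OF g, of 0 h] by simp
    next
      case False
      have "cmod (g (x + h) - g x - frechet_derivative g (at x) h) \<le> 8 * a / s\<^sup>2 * Hv_norm U v g * (norm h)\<^sup>2"
        using est[OF g] h False by auto
      also have "\<dots> \<le> C * Hv_norm U v g * (norm h)\<^sup>2"
        by (intro mult_right_mono) (auto simp: C_def Hv_norm_nonneg[OF g])
      finally show ?thesis .
    qed
  qed
qed

subsection \<open>The predual and the evaluation map\<close>

lemma continuous_map_complex:
  fixes f :: "'a \<Rightarrow> complex"
  shows "continuous_map X euclidean f \<longleftrightarrow>
    (\<forall>x\<in>topspace X. \<forall>e>0. \<exists>W. openin X W \<and> x \<in> W \<and> (\<forall>y\<in>W. dist (f x) (f y) < e))"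
  using Met_TC.continuous_map_to_metric[of X f] by simp

lemma Gv_bounded_ops: "\<phi> \<in> Gv U v \<Longrightarrow> \<phi> \<in> bounded_ops (Hv U v) (Hv_norm U v)"
  by (simp add: Gv_def dual_def)

locale weighted_open_set =
  fixes U :: "'e::complex_normed_vector set" and v :: "'e \<Rightarrow> real"
  assumes open_U: "open U" and weight_v: "weight_on U v"
begin

abbreviation "H \<equiv> (Hv U v :: ('e \<Rightarrow> complex) set)"
abbreviation "NH \<equiv> (Hv_norm U v :: ('e \<Rightarrow> complex) \<Rightarrow> real)"
abbreviation "G \<equiv> Gv U v"
abbreviation "NG \<equiv> Gv_norm U v"
abbreviation "\<delta> \<equiv> \<Delta>v U v"
abbreviation "X\<^sub>0 \<equiv> subtopology (compact_open U) (unit_ball H NH)"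

lemmas normed_H = cnormed_space_Hv[OF weight_v, where 'f = complex]
lemmas sub_H = cnormed_space_onD(1)[OF normed_H]
lemmas v_pos = weight_on_pos[OF weight_v]
lemmas normed_dual = cnormed_space_bounded_ops[OF normed_H, where 'b = complex]
lemmas sub_dual = cnormed_space_onD(1)[OF normed_dual]

lemma csubspace_G: "csubspace G"
  unfolding csubspace_def
proof (intro conjI ballI allI)
  show "0 \<in> G"
    using csubspace_0[OF sub_dual] by (auto simp: Gv_def dual_def zero_fun_def)
next
  fix \<phi> \<psi> assume *: "\<phi> \<in> G" "\<psi> \<in> G"
  then have "continuous_map X\<^sub>0 euclidean (\<lambda>g. \<phi> g + \<psi> g)"
    by (intro continuous_map_add) (auto simp: Gv_def)
  then show "\<phi> + \<psi> \<in> G"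
    using * csubspace_add[OF sub_dual, of \<phi> \<psi>] by (simp add: Gv_def dual_def plus_fun_def)
next
  fix c \<phi> assume *: "\<phi> \<in> G"
  have "continuous_map X\<^sub>0 euclidean ((\<lambda>z. c * z) \<circ> \<phi>)"
    using * by (intro continuous_map_compose[of _ euclidean])
      (auto simp: Gv_def intro!: continuous_intros)
  then show "c *\<^sub>C \<phi> \<in> G"
    using * csubspace_scale[OF sub_dual, of \<phi> c]
    by (simp add: Gv_def dual_def scaleC_fun_def o_def)
qed

lemma normed_G: "cnormed_space_on G NG"
  unfolding Gv_norm_def
  by (rule cnormed_space_on_subset[OF normed_dual csubspace_G]) (auto simp: Gv_bounded_ops)

lemma NG_bound: "\<phi> \<in> bounded_ops H NH \<Longrightarrow> g \<in> H \<Longrightarrow> cmod (\<phi> g) \<le> NG \<phi> * NH g"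
  unfolding Gv_norm_def by (rule op_norm_bound[OF normed_H])

lemma NG_leI: "(\<And>g. g \<in> H \<Longrightarrow> NH g \<le> 1 \<Longrightarrow> cmod (\<phi> g) \<le> c) \<Longrightarrow> NG \<phi> \<le> c"
  unfolding Gv_norm_def by (rule op_norm_leI[OF normed_H])

text \<open>Norm convergence of functionals is uniform convergence on the unit ball of
  \<open>H\<close>, and uniform limits of continuous functions are continuous.\<close>

lemma G_closed:
  assumes \<phi>: "\<phi> \<in> bounded_ops H NH" and approx: "\<And>e. e > 0 \<Longrightarrow> \<exists>\<psi>\<in>G. NG (\<phi> - \<psi>) \<le> e"
  shows "\<phi> \<in> G"
proof -
  have "continuous_map X\<^sub>0 euclidean \<phi>"
    unfolding continuous_map_complex
  proof (intro ballI allI impI)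
    fix g0 and e :: real assume g0: "g0 \<in> topspace X\<^sub>0" and e: "e > 0"
    obtain \<psi> where \<psi>: "\<psi> \<in> G" "NG (\<phi> - \<psi>) \<le> e / 4" using approx[of "e / 4"] e by auto
    have close: "cmod (\<phi> g - \<psi> g) \<le> e / 4" if "g \<in> topspace X\<^sub>0" for g
    proof -
      have g: "g \<in> H" "NH g \<le> 1" using that by (auto simp: unit_ball_def)
      have "cmod ((\<phi> - \<psi>) g) \<le> NG (\<phi> - \<psi>) * NH g"
        using csubspace_diff[OF sub_dual \<phi> Gv_bounded_ops[OF \<psi>(1)]] g by (intro NG_bound)
      also have "\<dots> \<le> e / 4 * 1" using \<psi> g e Hv_norm_nonneg[OF g(1)] by (intro mult_mono) auto
      finally show ?thesis by simp
    qed
    have "continuous_map X\<^sub>0 euclidean \<psi>" using \<psi> by (simp add: Gv_def)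
    moreover have "e / 4 > 0" using e by simp
    ultimately have "\<exists>W. openin X\<^sub>0 W \<and> g0 \<in> W \<and> (\<forall>y\<in>W. dist (\<psi> g0) (\<psi> y) < e / 4)"
      using g0 unfolding continuous_map_complex by blast
    then obtain W where W: "openin X\<^sub>0 W" "g0 \<in> W" "\<And>y. y \<in> W \<Longrightarrow> dist (\<psi> g0) (\<psi> y) < e / 4"
      by blast
    have "dist (\<phi> g0) (\<phi> y) < e" if "y \<in> W" for y
    proof -
      have "y \<in> topspace X\<^sub>0" using openin_subset[OF W(1)] that by auto
      have "dist (\<phi> g0) (\<phi> y) \<le> dist (\<phi> g0) (\<psi> g0) + dist (\<psi> g0) (\<psi> y) + dist (\<psi> y) (\<phi> y)"
        using dist_triangle[of "\<phi> g0" "\<phi> y" "\<psi> g0"] dist_triangle[of "\<psi> g0" "\<phi> y" "\<psi> y"]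
        by linarith
      also have "\<dots> < e"
        using close[OF g0] close[OF \<open>y \<in> topspace X\<^sub>0\<close>] W(3)[OF that] e
        by (simp add: dist_norm norm_minus_commute)
      finally show ?thesis .
    qed
    then show "\<exists>W. openin X\<^sub>0 W \<and> g0 \<in> W \<and> (\<forall>y\<in>W. dist (\<phi> g0) (\<phi> y) < e)"
      using W by blast
  qed
  then show ?thesis using \<phi> by (simp add: Gv_def dual_def)
qed

lemma \<delta>_apply [simp]: "g \<in> H \<Longrightarrow> \<delta> x g = g x"
  by (simp add: \<Delta>v_def)

lemma \<delta>_bounded_ops: "x \<in> U \<Longrightarrow> \<delta> x \<in> bounded_ops H NH"
  unfolding bounded_ops_def
proof (intro CollectI conjI ballI allI impI exI[of _ "1 / v x"])
  assume x: "x \<in> U"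
  fix g assume "g \<in> H"
  then show "norm (\<delta> x g) \<le> 1 / v x * NH g"
    using Hv_norm_bound[of g U v x] x v_pos[OF x] by (simp add: field_simps)
qed (auto simp: \<Delta>v_def csubspace_add[OF sub_H] csubspace_scale[OF sub_H])

lemma \<delta>_in_G: 
  assumes x: "x \<in> U"
  shows "\<delta> x \<in> G"
proof -
  have "continuous_map X\<^sub>0 euclidean (\<delta> x)"
    unfolding continuous_map_complex
  proof (intro ballI allI impI)
    fix g0 and e :: real assume g0: "g0 \<in> topspace X\<^sub>0" and e: "e > 0"
    \<comment> \<open>A single point is compact, so this is a subbasic neighbourhood of
      \<open>g0\<close>.\<close>
    let ?W = "{g. g ` {x} \<subseteq> ball (g0 x) e}"
    have "openin (compact_open U) ?W"
      unfolding compact_open_def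
      by (rule topology_generated_by_Basis) (use x in \<open>auto intro!: exI[of _ "{x}"] exI[of _ "ball (g0 x) e"]\<close>)
    then have "openin X\<^sub>0 (unit_ball H NH \<inter> ?W)" by (rule openin_subtopology_Int2)
    moreover have "g0 \<in> unit_ball H NH \<inter> ?W" using g0 e by auto
    ultimately show "\<exists>W. openin X\<^sub>0 W \<and> g0 \<in> W \<and> (\<forall>y\<in>W. dist (\<delta> x g0) (\<delta> x y) < e)"
      using g0 by (intro exI[of _ "unit_ball H NH \<inter> ?W"]) (auto simp: unit_ball_def)
  qed
  then show ?thesis using \<delta>_bounded_ops[OF x] by (simp add: Gv_def dual_def)
qed

lemma NG_\<delta>: "x \<in> U \<Longrightarrow> v x * NG (\<delta> x) \<le> 1"
proof -
  assume x: "x \<in> U"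
  have "NG (\<delta> x) \<le> 1 / v x"
  proof (rule NG_leI)
    fix g assume "g \<in> H" "NH g \<le> 1"
    then show "cmod (\<delta> x g) \<le> 1 / v x"
      using Hv_norm_bound[of g U v x] x v_pos[OF x] by (simp add: field_simps)
  qed
  then show ?thesis using v_pos[OF x] by (simp add: field_simps)
qed

section \<open>Differentiability of the evaluation map in norm\<close>

definition \<delta>' :: "'e \<Rightarrow> 'e \<Rightarrow> ('e \<Rightarrow> complex) \<Rightarrow> complex"
  where "\<delta>' x h = (\<lambda>g. if g \<in> H then frechet_derivative g (at x) h else 0)"

lemma \<delta>'_linear:
  assumes x: "x \<in> U"
  shows "\<delta>' x (h + k) = \<delta>' x h + \<delta>' x k" "\<delta>' x (c *\<^sub>C h) = c *\<^sub>C \<delta>' x h"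
proof -
  have "bounded_linear (frechet_derivative g (at x))" if "g \<in> H" for g
    using holo_on_frechet_derivative(1)[of U g x] that x by (auto simp: Hv_def has_derivative_def)
  then show "\<delta>' x (h + k) = \<delta>' x h + \<delta>' x k"
    by (auto simp: \<delta>'_def fun_eq_iff dest: linear_add[OF bounded_linear.linear])
  show "\<delta>' x (c *\<^sub>C h) = c *\<^sub>C \<delta>' x h"
    using holo_on_frechet_derivative(2)[of U _ x] x by (auto simp: \<delta>'_def fun_eq_iff Hv_def)
qed

lemma \<delta>'_bounded_ops:
  assumes x: "x \<in> U"
  shows "\<delta>' x h \<in> bounded_ops H NH"
proof -
  have der: "(g has_derivative frechet_derivative g (at x)) (at x)" if "g \<in> H" for g
    using holo_on_frechet_derivative(1)[of U g x] that x by (simp add: Hv_def)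
  have "frechet_derivative (f + g) (at x) = (\<lambda>h. frechet_derivative f (at x) h + frechet_derivative g (at x) h)"
    if "f \<in> H" "g \<in> H" for f g
    unfolding plus_fun_def by (rule frechet_derivative_at[symmetric], rule has_derivative_add[OF der[OF that(1)] der[OF that(2)]])
  moreover have "frechet_derivative (c *\<^sub>C g) (at x) = (\<lambda>h. c * frechet_derivative g (at x) h)"
    if "g \<in> H" for c g
    unfolding scaleC_fun_def scaleC_complex_eq
    by (rule frechet_derivative_at[symmetric], rule has_derivative_mult_right[OF der[OF that]])
  moreover obtain C where "\<And>g. g \<in> H \<Longrightarrow> cmod (frechet_derivative g (at x) h) \<le> C * Hv_norm U v g * norm h"
    using Hv_taylor[OF open_U weight_v x] by metis
  then have "\<exists>C. \<forall>g\<in>H. cmod (\<delta>' x h g) \<le> C * NH g"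
    by (intro exI[of _ "C * norm h"]) (auto simp: \<delta>'_def mult_ac)
  ultimately show ?thesis
    unfolding bounded_ops_def
    by (auto simp: \<delta>'_def csubspace_add[OF sub_H] csubspace_scale[OF sub_H])
qed

text \<open>Taylor estimates that are uniform over the unit ball of \<open>H\<close> are estimates
  in the dual norm. Hence \<open>\<delta>\<close> is differentiable as a vector-valued map, with
  derivative \<open>\<delta>' x\<close> and a quadratic remainder.\<close>

lemma \<delta>_taylor:
  assumes x: "x \<in> U"
  obtains r C where "r > 0" "C \<ge> 0" "ball x r \<subseteq> U" "\<And>h. NG (\<delta>' x h) \<le> C * norm h"
    "\<And>h. norm h < r \<Longrightarrow> NG (\<delta> (x + h) - \<delta> x - \<delta>' x h) \<le> C * (norm h)\<^sup>2"
proof (rule Hv_taylor[OF open_U weight_v x])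
  fix r C :: real
  assume r: "r > 0" and C: "C \<ge> 0" and sub: "ball x r \<subseteq> U"
    and est: "\<And>g :: 'e \<Rightarrow> complex. \<And>h. g \<in> Hv U v \<Longrightarrow>
       cmod (frechet_derivative g (at x) h) \<le> C * Hv_norm U v g * norm h"
    "\<And>g :: 'e \<Rightarrow> complex. \<And>h. g \<in> Hv U v \<Longrightarrow> norm h < r \<Longrightarrow>
       cmod (g (x + h) - g x - frechet_derivative g (at x) h) \<le> C * Hv_norm U v g * (norm h)\<^sup>2"
  have CN: "C * NH g * t \<le> C * t" if "NH g \<le> 1" "t \<ge> 0" for g t
    using that C by (intro mult_right_mono) (auto simp: mult_left_le)
  show thesis
  proof (rule that[OF r C sub])
    show "NG (\<delta>' x h) \<le> C * norm h" for h
    proof (rule NG_leI)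
      fix g assume g: "g \<in> H" "NH g \<le> 1"
      show "cmod (\<delta>' x h g) \<le> C * norm h"
        using order_trans[OF est(1)[OF g(1)] CN[OF g(2) norm_ge_zero]] g by (simp add: \<delta>'_def)
    qed
    show "NG (\<delta> (x + h) - \<delta> x - \<delta>' x h) \<le> C * (norm h)\<^sup>2" if "norm h < r" for h
    proof (rule NG_leI)
      fix g assume g: "g \<in> H" "NH g \<le> 1"
      show "cmod ((\<delta> (x + h) - \<delta> x - \<delta>' x h) g) \<le> C * (norm h)\<^sup>2"
        using order_trans[OF est(2)[OF g(1) that] CN[OF g(2) zero_le_power2]] g by (simp add: \<delta>'_def)
    qed
  qed
qed

text \<open>The derivative is a norm limit of difference quotients of evaluations, which lie in the
  closed space \<open>G\<close>.\<close>

lemma \<delta>'_in_G: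
  assumes x: "x \<in> U"
  shows "\<delta>' x h \<in> G"
proof (rule G_closed[OF \<delta>'_bounded_ops[OF x]])
  fix e :: real assume e: "e > 0"
  obtain r C where rC: "r > 0" "C \<ge> 0" "ball x r \<subseteq> U"
    "\<And>h. norm h < r \<Longrightarrow> NG (\<delta> (x + h) - \<delta> x - \<delta>' x h) \<le> C * (norm h)\<^sup>2"
    using \<delta>_taylor[OF x] by metis
  \<comment> \<open>The first bound keeps \<open>x + t h\<close> in \<open>U\<close>; the second
    makes the error \<open>t C (norm h)^2\<close> of the difference quotient at most
    \<open>e\<close>. Adding 1 avoids zero denominators.\<close>
  define t where "t = min (r / (2 * (norm h + 1))) (e / (C * (norm h)\<^sup>2 + 1))"
  have hp: "norm h + 1 > 0" "C * (norm h)\<^sup>2 + 1 > 0" using rC by (auto simp: add_nonneg_pos)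
  have t: "t > 0" using rC e hp by (simp add: t_def)
  have "t * norm h \<le> r / (2 * (norm h + 1)) * (norm h + 1)"
    using t hp rC by (intro mult_mono) (auto simp: t_def)
  also have "\<dots> = r / 2" using hp by (simp add: divide_simps)
  also have "\<dots> < r" using rC by simp
  finally have th: "norm (complex_of_real t *\<^sub>C h) < r" using t by (simp add: norm_scaleC)
  let ?h = "complex_of_real t *\<^sub>C h"
  have xh: "x + ?h \<in> U" using th rC(3) by (auto simp: dist_norm subset_iff)
  let ?\<psi> = "complex_of_real (1 / t) *\<^sub>C (\<delta> (x + ?h) - \<delta> x)"
  let ?d = "\<delta> (x + ?h) - \<delta> x - \<delta>' x ?h"
  have "\<delta>' x h - ?\<psi> = complex_of_real (- 1 / t) *\<^sub>C ?d"
    using t by (simp add: \<delta>'_linear[OF x] scaleC_diff_right scaleC_scaleC scaleC_one scaleC_minus_left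
        flip: of_real_mult)
  moreover have "?d \<in> bounded_ops H NH"
    by (intro csubspace_diff[OF sub_dual] \<delta>_bounded_ops \<delta>'_bounded_ops x xh)
  ultimately have "NG (\<delta>' x h - ?\<psi>) = cmod (complex_of_real (- 1 / t)) * NG ?d"
    using cnormed_space_onD(6)[OF normed_dual] by (simp only: Gv_norm_def)
  also have "\<dots> = 1 / t * NG ?d" using t by (simp add: norm_divide)
  also have "\<dots> \<le> 1 / t * (C * (norm ?h)\<^sup>2)" using t rC(4)[OF th] by (intro mult_left_mono) auto
  also have "\<dots> = t * (C * (norm h)\<^sup>2)" using t by (simp add: norm_scaleC power2_eq_square)
  also have "\<dots> \<le> e / (C * (norm h)\<^sup>2 + 1) * (C * (norm h)\<^sup>2 + 1)"
    using t rC e hp by (intro mult_mono) (auto simp: t_def)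
  also have "\<dots> = e" using hp by simp
  finally have "NG (\<delta>' x h - ?\<psi>) \<le> e" .
  moreover have "?\<psi> \<in> G"
    by (intro csubspace_scale[OF csubspace_G] csubspace_diff[OF csubspace_G] \<delta>_in_G x xh)
  ultimately show "\<exists>\<psi>\<in>G. NG (\<delta>' x h - \<psi>) \<le> e" by blast
qed

text \<open>The quadratic remainder of \<open>\<delta>\<close> shows that
  \<open>T \<circ> \<delta>' x\<close> is the derivative. For scalar \<open>T\<close> this
  represents functionals on \<open>G\<close> by functions in \<open>H\<close>; for vector-valued
  \<open>T\<close> it supplies the function that \<open>T\<close> linearizes.\<close>

lemma operator_comp_\<delta>_in_Hv:
  fixes T :: "(('e \<Rightarrow> complex) \<Rightarrow> complex) \<Rightarrow> 'f::complex_normed_vector"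
  assumes T: "T \<in> bounded_ops G NG"
  shows "(\<lambda>x. if x \<in> U then T (\<delta> x) else 0) \<in> Hv U v"
proof (rule Hv_memI[where c = "op_norm G NG T"])
  define K where "K = op_norm G NG T"
  have K: "K \<ge> 0" unfolding K_def by (rule op_norm_nonneg[OF normed_G T])
  have bd: "norm (T \<phi>) \<le> K * NG \<phi>" if "\<phi> \<in> G" for \<phi>
    unfolding K_def by (rule op_norm_bound[OF normed_G T that])
  have lin: "clinear_on G T" using T by (simp add: bounded_ops_iff)
  show "v x * norm (if x \<in> U then T (\<delta> x) else 0) \<le> op_norm G NG T" if x: "x \<in> U" for x
  proof -
    have "v x * norm (T (\<delta> x)) \<le> v x * (K * NG (\<delta> x))"
      using v_pos[OF x] by (intro mult_left_mono bd \<delta>_in_G x) auto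
    also have "\<dots> = K * (v x * NG (\<delta> x))" by simp
    also have "\<dots> \<le> K * 1" using K NG_\<delta>[OF x] by (intro mult_left_mono)
    finally show ?thesis using x by (simp add: K_def)
  qed
  show "holo_on U (\<lambda>x. if x \<in> U then T (\<delta> x) else 0)"
    unfolding holo_on_def
  proof (intro ballI)
    fix x assume x: "x \<in> U"
    obtain r C where rC: "r > 0" "C \<ge> 0" "ball x r \<subseteq> U" "\<And>h. NG (\<delta>' x h) \<le> C * norm h"
      "\<And>h. norm h < r \<Longrightarrow> NG (\<delta> (x + h) - \<delta> x - \<delta>' x h) \<le> C * (norm h)\<^sup>2"
      using \<delta>_taylor[OF x] by metis
    have blin: "clinear_on UNIV (\<lambda>h. T (\<delta>' x h))"
      using clinear_on_add[OF lin] clinear_on_scale[OF lin]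
      by (auto simp: clinear_on_def \<delta>'_linear[OF x] \<delta>'_in_G[OF x])
    have "norm (T (\<delta>' x h)) \<le> (K * C) * norm h" for h
      using order_trans[OF bd[OF \<delta>'_in_G[OF x]] mult_left_mono[OF rC(4) K]] by (simp add: mult.assoc)
    then have "bounded_linear (\<lambda>h. T (\<delta>' x h))" by (rule clinear_on_bounded_linear[OF blin])
    moreover have "\<exists>d>0. \<forall>y. norm (y - x) < d \<longrightarrow>
        norm ((if y \<in> U then T (\<delta> y) else 0) - (if x \<in> U then T (\<delta> x) else 0) - T (\<delta>' x (y - x)))
        \<le> e * norm (y - x)" if e: "e > 0" for e
    proof (intro exI conjI allI impI)
      \<comment> \<open>The remainder is at most \<open>K C (norm h)^2\<close>, so its quotient by
        \<open>norm h\<close> is at most \<open>e\<close> within this radius.\<close>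
      let ?d = "min r (e / (K * C + 1))"
      have KC: "K * C + 1 > 0" using K rC by (auto simp: add_nonneg_pos)
      show "?d > 0" using rC e KC by simp
      fix y assume y: "norm (y - x) < ?d"
      have yU: "y \<in> U" using y rC(3) by (auto simp: subset_iff dist_norm norm_minus_commute)
      let ?h = "y - x"
      have eq: "T (\<delta> y) - T (\<delta> x) - T (\<delta>' x ?h) = T (\<delta> y - \<delta> x - \<delta>' x ?h)"
        by (simp add: clinear_on_diff[OF csubspace_G lin] csubspace_diff[OF csubspace_G] \<delta>_in_G \<delta>'_in_G x yU)
      have "norm (T (\<delta> y) - T (\<delta> x) - T (\<delta>' x ?h)) \<le> K * NG (\<delta> y - \<delta> x - \<delta>' x ?h)"
        unfolding eq by (intro bd csubspace_diff[OF csubspace_G] \<delta>_in_G \<delta>'_in_G x yU)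
      also have "\<dots> \<le> K * (C * (norm ?h)\<^sup>2)"
        using rC(5)[of ?h] y K by (intro mult_left_mono) auto
      also have "\<dots> = (K * C * norm ?h) * norm ?h" by (simp add: power2_eq_square)
      also have "\<dots> \<le> e * norm ?h"
      proof (rule mult_right_mono)
        have "K * C * norm ?h \<le> (K * C + 1) * norm ?h" by (intro mult_right_mono) auto
        also have "\<dots> \<le> e" using y KC by (simp add: pos_less_divide_eq mult.commute)
        finally show "K * C * norm ?h \<le> e" .
      qed simp
      finally show "norm ((if y \<in> U then T (\<delta> y) else 0) - (if x \<in> U then T (\<delta> x) else 0) - T (\<delta>' x ?h))
        \<le> e * norm ?h" using x yU by simp
    qed
    ultimately have "((\<lambda>x. if x \<in> U then T (\<delta> x) else 0) has_derivative (\<lambda>h. T (\<delta>' x h))) (at x)"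
      unfolding has_derivative_at_alt by blast
    moreover have "\<forall>c h. T (\<delta>' x (c *\<^sub>C h)) = c *\<^sub>C T (\<delta>' x h)"
      using blin by (simp add: clinear_on_def)
    ultimately show "\<exists>f'. ((\<lambda>x. if x \<in> U then T (\<delta> x) else 0) has_derivative f') (at x)
        \<and> (\<forall>c h. f' (c *\<^sub>C h) = c *\<^sub>C f' h)" by (intro exI[of _ "\<lambda>h. T (\<delta>' x h)"]) simp
  qed
qed auto

end

subsection \<open>Finite combinations of atoms\<close>

text \<open>\<open>atom_comb U v m \<psi>\<close>: the functional \<open>\<psi>\<close> is a combination of atoms \<open>v x \<delta>\<^sub>x\<close> whose coefficients have
  total modulus exactly \<open>m\<close>.\<close>

inductive atom_comb :: "'e::complex_normed_vector set \<Rightarrow> ('e \<Rightarrow> real) \<Rightarrow> real \<Rightarrow> (('e \<Rightarrow> complex) \<Rightarrow> complex) \<Rightarrow> bool"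
  for U v where
  zero: "atom_comb U v 0 0"
| step: "atom_comb U v m \<psi> \<Longrightarrow> x \<in> U \<Longrightarrow>
    atom_comb U v (m + cmod c) (\<psi> + (c * complex_of_real (v x)) *\<^sub>C \<Delta>v U v x)"

lemma atom_comb_add:
  assumes "atom_comb U v m \<psi>" "atom_comb U v n \<theta>"
  shows "atom_comb U v (m + n) (\<psi> + \<theta>)"
  using assms(2,1)
proof induction
  case (step n \<theta> x c)
  then show ?case using atom_comb.step[OF step.IH[OF step.prems] step.hyps(2), of c]
    by (simp add: add.assoc del: pointwise_simps)
qed (simp del: pointwise_simps)

lemma atom_comb_scale:
  assumes "atom_comb U v m \<psi>"
  shows "atom_comb U v (cmod a * m) (a *\<^sub>C \<psi>)"
  using assms
proof induction
  case zero
  then show ?case using atom_comb.zero by (simp del: pointwise_simps)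
next
  case (step m \<psi> x c)
  then show ?case using atom_comb.step[OF step.IH step.hyps(2), of "a * c"]
    by (simp add: distrib_left norm_mult scaleC_add_right scaleC_scaleC mult.assoc del: pointwise_simps)
qed

lemma atom_comb_atom:
  assumes "x \<in> U"
  shows "atom_comb U v (cmod c) ((c * complex_of_real (v x)) *\<^sub>C \<Delta>v U v x)"
  using atom_comb.step[OF atom_comb.zero assms, of v c] by (simp del: pointwise_simps)

context weighted_open_set
begin

lemma atom_comb_G:
  assumes "atom_comb U v m \<psi>"
  shows "\<psi> \<in> G \<and> 0 \<le> m"
  using assms
  by induction (auto intro!: csubspace_0 csubspace_add csubspace_scale csubspace_G \<delta>_in_G
      simp del: pointwise_simps)

lemma atom_comb_bound:
  fixes T :: "(('e \<Rightarrow> complex) \<Rightarrow> complex) \<Rightarrow> 'f::complex_normed_vector"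
  assumes "atom_comb U v m \<psi>" and lin: "clinear_on G T"
    and bd: "\<And>x. x \<in> U \<Longrightarrow> v x * norm (T (\<delta> x)) \<le> K"
  shows "norm (T \<psi>) \<le> K * m"
  using assms(1)
proof induction
  case zero
  then show ?case using clinear_on_0[OF csubspace_G lin] by (simp del: pointwise_simps)
next
  case (step m \<psi> x c)
  note G = atom_comb_G[OF step.hyps(1)] \<delta>_in_G[OF step.hyps(2)]
  have "norm (T ((c * complex_of_real (v x)) *\<^sub>C \<delta> x)) = cmod c * (v x * norm (T (\<delta> x)))"
    using v_pos[OF step.hyps(2)] G by (simp add: clinear_on_scale[OF lin] norm_scaleC norm_mult del: pointwise_simps)
  also have "\<dots> \<le> cmod c * K" by (intro mult_left_mono bd step.hyps) auto
  finally have 1: "norm (T ((c * complex_of_real (v x)) *\<^sub>C \<delta> x)) \<le> cmod c * K" .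
  have "norm (T (\<psi> + (c * complex_of_real (v x)) *\<^sub>C \<delta> x))
      \<le> norm (T \<psi>) + norm (T ((c * complex_of_real (v x)) *\<^sub>C \<delta> x))"
    using G csubspace_scale[OF csubspace_G] by (simp add: clinear_on_add[OF lin] norm_triangle_ineq del: pointwise_simps)
  also have "\<dots> \<le> K * m + cmod c * K" by (intro add_mono step.IH 1)
  finally show ?case by (simp add: distrib_left mult.commute del: pointwise_simps)
qed

section \<open>Density of the finite combinations, without control of the mass\<close>

lemma annihilator_span:
  assumes "finite X" "X \<subseteq> U" "\<phi> \<in> bounded_ops H NH"
    and "\<And>g. g \<in> H \<Longrightarrow> (\<forall>x\<in>X. g x = 0) \<Longrightarrow> \<phi> g = 0"
  shows "\<exists>m. atom_comb U v m \<phi>"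
  using assms
proof (induction X arbitrary: \<phi>)
  case empty
  then have "\<phi> = 0" by (auto simp: fun_eq_iff bounded_ops_iff)
  then show ?case using atom_comb.zero by blast
next
  case (insert x X)
  show ?case
  proof (cases "\<exists>g0\<in>H. (\<forall>y\<in>X. g0 y = 0) \<and> g0 x \<noteq> 0")
    case True
    then obtain g0 where g0: "g0 \<in> H" "\<forall>y\<in>X. g0 y = 0" "g0 x \<noteq> 0" by blast
    have x: "x \<in> U" using insert.prems by simp
    \<comment> \<open>With this choice \<open>\<phi> - c \<delta> x\<close> kills \<open>g0\<close>.
      Every function vanishing on \<open>X\<close> is a multiple of \<open>g0\<close> plus a
      function that also vanishes at \<open>x\<close>, so the induction hypothesis applies to the
      difference.\<close>
    define c where "c = \<phi> g0 / g0 x"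
    have lin: "clinear_on H \<phi>" using insert.prems(2) by (simp add: bounded_ops_iff)
    have "\<phi> - c *\<^sub>C \<delta> x \<in> bounded_ops H NH"
      by (intro csubspace_diff[OF sub_dual] csubspace_scale[OF sub_dual] insert.prems(2) \<delta>_bounded_ops x)
    moreover have "(\<phi> - c *\<^sub>C \<delta> x) g = 0" if g: "g \<in> H" "\<forall>y\<in>X. g y = 0" for g
    proof -
      let ?g = "g - (g x / g0 x) *\<^sub>C g0"
      have mem: "(g x / g0 x) *\<^sub>C g0 \<in> H" "?g \<in> H"
        using csubspace_diff[OF sub_H] csubspace_scale[OF sub_H] g g0 by auto
      have "\<phi> ?g = 0"
        by (rule insert.prems(3)[OF mem(2)]) (use g g0 in auto)
      then have "\<phi> g = g x / g0 x * \<phi> g0"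
        using g mem g0 by (simp add: clinear_on_diff[OF sub_H lin] clinear_on_scale[OF lin])
      then show ?thesis using g by (simp add: c_def)
    qed
    ultimately have "\<exists>m. atom_comb U v m (\<phi> - c *\<^sub>C \<delta> x)"
      using insert.prems(1) by (intro insert.IH) blast+
    then obtain m where m: "atom_comb U v m (\<phi> - c *\<^sub>C \<delta> x)" by blast
    have "(c / complex_of_real (v x)) * complex_of_real (v x) = c" using v_pos[OF x] by simp
    then show ?thesis using atom_comb.step[OF m x, of "c / complex_of_real (v x)"]
      by (auto simp del: pointwise_simps)
  next
    case False
    then have "\<And>g. g \<in> H \<Longrightarrow> \<forall>y\<in>X. g y = 0 \<Longrightarrow> \<phi> g = 0"
      using insert.prems(3) by auto
    then show ?thesis using insert.IH insert.prems(1,2) by auto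
  qed
qed

text \<open>The unit ball of \<open>H\<close> is equicontinuous by the uniform Taylor estimates, so
  on it smallness at the centres of a finite cover implies smallness on the whole compact set.
  General open sets are reached by induction over the generated topology.\<close>

lemma compact_open_zero_nbhd:
  assumes "openin (compact_open U) W" "(\<lambda>_. 0) \<in> W"
  shows "\<exists>X r. finite X \<and> X \<subseteq> U \<and> r > 0 \<and>
    (\<forall>g\<in>H. NH g \<le> 1 \<longrightarrow> (\<forall>x\<in>X. cmod (g x) \<le> r) \<longrightarrow> g \<in> W)"
proof -
  have "generate_topology_on {{f. f ` K \<subseteq> V} | (K :: 'e set) (V :: complex set). compact K \<and> K \<subseteq> U \<and> open V} W"
    using assms(1) unfolding compact_open_def by (rule openin_topology_generated_by)
  then show ?thesis using assms(2)
  proof induction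
    case (Int A B)
    obtain X r where A: "finite X" "X \<subseteq> U" "r > 0"
      "\<forall>g\<in>H. NH g \<le> 1 \<longrightarrow> (\<forall>x\<in>X. cmod (g x) \<le> r) \<longrightarrow> g \<in> A" using Int by blast
    obtain Y s where B: "finite Y" "Y \<subseteq> U" "s > 0"
      "\<forall>g\<in>H. NH g \<le> 1 \<longrightarrow> (\<forall>x\<in>Y. cmod (g x) \<le> s) \<longrightarrow> g \<in> B" using Int by blast
    show ?case
      by (rule exI[of _ "X \<union> Y"], rule exI[of _ "min r s"]) (use A B in auto)
  next
    case (UN \<K>)
    then obtain A where A: "A \<in> \<K>" "(\<lambda>_. 0) \<in> A" by blast
    then show ?case using UN.IH[OF A] by blast
  next
    case (Basis W)
    then obtain K V where W: "W = {f. f ` K \<subseteq> V}" "compact K" "K \<subseteq> U" "open V" by blast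
    show ?case
    proof (cases "K = {}")
      case True
      then show ?thesis using W by (intro exI[of _ "{}"] exI[of _ 1]) auto
    next
      case False
      then have "0 \<in> V" using W Basis.prems by auto
      then obtain e where e: "e > 0" "ball 0 e \<subseteq> V" using W open_contains_ball by blast
      have "\<exists>\<rho>>0. \<forall>g\<in>H. NH g \<le> 1 \<longrightarrow> (\<forall>y\<in>ball x \<rho>. cmod (g y - g x) \<le> e / 4)" if x: "x \<in> K" for x
      proof -
        have xU: "x \<in> U" using x W by auto
        obtain r C where rC: "r > 0" "C \<ge> 0"
          "\<And>g :: 'e \<Rightarrow> complex. \<And>h. g \<in> Hv U v \<Longrightarrow>
             cmod (frechet_derivative g (at x) h) \<le> C * Hv_norm U v g * norm h"
          "\<And>g :: 'e \<Rightarrow> complex. \<And>h. g \<in> Hv U v \<Longrightarrow> norm h < r \<Longrightarrow>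
             cmod (g (x + h) - g x - frechet_derivative g (at x) h) \<le> C * Hv_norm U v g * (norm h)\<^sup>2"
          using Hv_taylor[OF open_U weight_v xU] by metis
        \<comment> \<open>The bound 1 gives \<open>(norm h)^2 \<le> norm h\<close>; the last bound
          makes the linear part and the remainder at most \<open>e / 8\<close> each.\<close>
        define \<rho> where "\<rho> = min 1 (min r (e / (8 * (C + 1))))"
        have \<rho>: "\<rho> > 0" using rC e by (simp add: \<rho>_def)
        have "cmod (g y - g x) \<le> e / 4" if g: "g \<in> H" "NH g \<le> 1" and y: "y \<in> ball x \<rho>" for g y
        proof -
          define h where "h = y - x"
          have h: "norm h < \<rho>" using y by (simp add: h_def dist_norm norm_minus_commute)
          have CN: "C * NH g \<le> C" using g rC by (simp add: mult_left_le)
          have h2: "(norm h)\<^sup>2 \<le> norm h" using h by (simp add: \<rho>_def power2_eq_square mult_left_le)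
          have "C * NH g * norm h \<le> C * norm h" using CN by (intro mult_right_mono) auto
          moreover have "C * NH g * (norm h)\<^sup>2 \<le> C * norm h"
            using CN h2 rC by (intro mult_mono) auto
          moreover have "C * norm h \<le> e / 8"
          proof -
            have "C * norm h \<le> (C + 1) * (e / (8 * (C + 1)))"
              using h rC by (intro mult_mono) (auto simp: \<rho>_def)
            also have "\<dots> = e / 8" using rC by (simp add: divide_simps)
            finally show ?thesis .
          qed
          ultimately have 1: "cmod (frechet_derivative g (at x) h) \<le> e / 8"
            "cmod (g (x + h) - g x - frechet_derivative g (at x) h) \<le> e / 8"
            using rC(3)[OF g(1), of h] rC(4)[OF g(1), of h] h by (auto simp: \<rho>_def)
          have "g y - g x = (g (x + h) - g x - frechet_derivative g (at x) h) + frechet_derivative g (at x) h"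
            by (simp add: h_def)
          then show ?thesis using norm_triangle_le[OF add_mono[OF 1(2,1)]] by simp
        qed
        then show ?thesis using \<rho> by blast
      qed
      then obtain \<rho> where \<rho>: "\<And>x. x \<in> K \<Longrightarrow> \<rho> x > 0"
        "\<And>x g y. x \<in> K \<Longrightarrow> g \<in> H \<Longrightarrow> NH g \<le> 1 \<Longrightarrow> y \<in> ball x (\<rho> x) \<Longrightarrow> cmod (g y - g x) \<le> e / 4"
        by metis
      have "K \<subseteq> (\<Union>x\<in>K. ball x (\<rho> x))" using \<rho>(1) by force
      then obtain X where X: "X \<subseteq> K" "finite X" "K \<subseteq> (\<Union>x\<in>X. ball x (\<rho> x))"
        using compactE_image[OF W(2), of K "\<lambda>x. ball x (\<rho> x)"] by auto
      have "g \<in> W" if g: "g \<in> H" "NH g \<le> 1" and small: "\<forall>x\<in>X. cmod (g x) \<le> e / 4" for g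
      proof -
        have "g y \<in> ball 0 e" if "y \<in> K" for y
        proof -
          obtain x where x: "x \<in> X" "y \<in> ball x (\<rho> x)" using subsetD[OF X(3) \<open>y \<in> K\<close>] by blast
          have "cmod (g y - g x) \<le> e / 4" using \<rho>(2)[OF _ g x(2)] X x by auto
          moreover have "cmod (g x) \<le> e / 4" using small x by auto
          ultimately show ?thesis using norm_triangle_sub[of "g y" "g x"] e by simp
        qed
        then show ?thesis using e W by auto
      qed
      then show ?thesis using X W e by (intro exI[of _ X] exI[of _ "e / 4"]) auto
    qed
  qed auto
qed

text \<open>Continuity on the ball makes \<open>\<phi>\<close> small on the functions vanishing on a
  finite set \<open>X\<close>. A Hahn-Banach extension \<open>\<theta>\<close> of this restriction
  is equally small, and \<open>\<phi> - \<theta>\<close> annihilates those functions, so it is a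
  finite combination.\<close>

lemma atom_comb_dense:
  assumes \<phi>: "\<phi> \<in> G" and e: "e > 0"
  shows "\<exists>m \<psi>. atom_comb U v m \<psi> \<and> NG (\<phi> - \<psi>) \<le> e"
proof -
  note \<phi>b = Gv_bounded_ops[OF \<phi>]
  have lin: "clinear_on H \<phi>" using \<phi>b by (simp add: bounded_ops_iff)
  have "topspace (compact_open U :: ('e \<Rightarrow> complex) topology) = UNIV"
    unfolding compact_open_def topology_generated_by_topspace
    by (auto intro!: exI[of _ UNIV] exI[of _ "{}"])
  then have z: "(\<lambda>_. 0) \<in> topspace X\<^sub>0"
    using zero_in_unit_ball[OF normed_H] by (simp add: zero_fun_def)
  have "continuous_map X\<^sub>0 euclidean \<phi>" using \<phi> by (simp add: Gv_def)
  then have "\<exists>W. openin X\<^sub>0 W \<and> (\<lambda>_. 0) \<in> W \<and> (\<forall>g\<in>W. dist (\<phi> (\<lambda>_. 0)) (\<phi> g) < e)"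
    using z e unfolding continuous_map_complex by blast
  then obtain W where W: "openin X\<^sub>0 W" "(\<lambda>_. 0) \<in> W" "\<And>g. g \<in> W \<Longrightarrow> dist (\<phi> (\<lambda>_. 0)) (\<phi> g) < e"
    by blast
  have \<phi>0: "\<phi> (\<lambda>_. 0) = 0" using clinear_on_0[OF sub_H lin] by (simp add: zero_fun_def)
  obtain W' where W': "openin (compact_open U) W'" "W = W' \<inter> unit_ball H NH"
    using W(1) by (auto simp: openin_subtopology)
  obtain X r where X: "finite X" "X \<subseteq> U" "r > 0"
    "\<forall>g\<in>H. NH g \<le> 1 \<longrightarrow> (\<forall>x\<in>X. cmod (g x) \<le> r) \<longrightarrow> g \<in> W'"
    using compact_open_zero_nbhd[OF W'(1)] W(2) W'(2) by blast
  define M where "M = {g \<in> H. \<forall>x\<in>X. g x = 0}"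
  have M_sub: "csubspace M"
    unfolding csubspace_def M_def
    using csubspace_0[OF sub_H] csubspace_add[OF sub_H] csubspace_scale[OF sub_H] by auto
  have small: "cmod (\<phi> g) \<le> e" if "g \<in> M" "NH g \<le> 1" for g
  proof -
    have "g \<in> W" using that X by (auto simp: M_def W'(2) unit_ball_def)
    from W(3)[OF this] show ?thesis by (simp add: \<phi>0)
  qed
  have smallN: "cmod (\<phi> g) \<le> e * NH g" if g: "g \<in> M" for g
  proof (cases "g = 0")
    case True
    then show ?thesis using clinear_on_0[OF sub_H lin] cnormed_space_on_0[OF normed_H] by simp
  next
    case False
    have gH: "g \<in> H" using g by (simp add: M_def)
    have N: "NH g > 0" using False cnormed_space_onD(3,4)[OF normed_H gH] by linarith
    let ?c = "complex_of_real (1 / NH g)"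
    have "cmod (\<phi> (?c *\<^sub>C g)) \<le> e"
      using N by (intro small csubspace_scale[OF M_sub g])
        (simp add: cnormed_space_onD(6)[OF normed_H gH] norm_divide)
    then show ?thesis using N gH by (simp add: clinear_on_scale[OF lin] norm_divide field_simps)
  qed
  \<comment> \<open>As \<open>M\<close> is a subspace, the constraints at \<open>g\<close> and at
    \<open>- g\<close> together prescribe the real part exactly.\<close>
  define C where "C = {(g, Re (\<phi> g)) | g. g \<in> M}"
  have cone: "real_cone C"
    unfolding real_cone_def
  proof (intro conjI allI impI)
    show "(0, 0) \<in> C"
      using csubspace_0[OF M_sub] clinear_on_0[OF sub_H lin] by (auto simp: C_def intro!: exI[of _ 0])
  next
    fix f r g s assume "(f, r) \<in> C" "(g, s) \<in> C"
    then show "(f + g, r + s) \<in> C"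
      using csubspace_add[OF M_sub] clinear_on_add[OF lin] by (auto simp: C_def M_def)
  next
    fix f r and t :: real assume "(f, r) \<in> C" "t > 0"
    then show "(complex_of_real t *\<^sub>C f, t * r) \<in> C"
      using csubspace_scale[OF M_sub] clinear_on_scale[OF lin] by (auto simp: C_def M_def)
  qed
  have semi: "cseminorm_on H (\<lambda>g. e * NH g)"
    using cnormed_space_onD(5,6)[OF normed_H] e
    by (auto simp: cseminorm_on_def distrib_left[symmetric])
  have domC: "g \<in> H \<and> r \<le> e * NH g" if "(g, r) \<in> C" for g r
    using that smallN[of g] complex_Re_le_cmod[of "\<phi> g"] by (auto simp: C_def M_def)
  show ?thesis
  proof (rule complex_mazur_orlicz[OF sub_H semi cone domC])
    fix \<theta> assume \<theta>: "\<theta> \<in> bounded_ops H (\<lambda>g. e * NH g)" "\<And>g. g \<in> H \<Longrightarrow> cmod (\<theta> g) \<le> e * NH g"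
      "\<And>g r. (g, r) \<in> C \<Longrightarrow> r \<le> Re (\<theta> g)"
    have lin\<theta>: "clinear_on H \<theta>" using \<theta>(1) by (simp add: bounded_ops_iff)
    have \<theta>b: "\<theta> \<in> bounded_ops H NH" using \<theta>(1,2) by (auto simp: bounded_ops_iff)
    have Re_le: "Re (\<phi> g) \<le> Re (\<theta> g)" if "g \<in> M" for g
      using that by (intro \<theta>(3)) (auto simp: C_def)
    have Re_eq: "Re (\<phi> g) = Re (\<theta> g)" if "g \<in> M" for g
      using Re_le[OF that] Re_le[OF csubspace_uminus[OF M_sub that]] that
      by (simp add: M_def clinear_on_minus[OF lin] clinear_on_minus[OF lin\<theta>])
    have "\<phi> g = \<theta> g" if "g \<in> M" for g
      using Re_eq[OF that] Re_eq[OF csubspace_scale[OF M_sub that, of \<i>]] that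
      by (simp add: M_def complex_eq_iff clinear_on_scale[OF lin] clinear_on_scale[OF lin\<theta>])
    then have "\<exists>m. atom_comb U v m (\<phi> - \<theta>)"
      by (intro annihilator_span[OF X(1,2)] csubspace_diff[OF sub_dual] \<phi>b \<theta>b) (auto simp: M_def)
    then obtain m where "atom_comb U v m (\<phi> - \<theta>)" by blast
    moreover have "NG (\<phi> - (\<phi> - \<theta>)) \<le> e"
    proof (rule NG_leI)
      fix g assume g: "g \<in> H" "NH g \<le> 1"
      have "cmod (\<theta> g) \<le> e * 1" using \<theta>(2)[OF g(1)] g(2) e by (auto intro: order_trans mult_left_mono)
      then show "cmod ((\<phi> - (\<phi> - \<theta>)) g) \<le> e" by simp
    qed
    ultimately show ?thesis by blast
  qed
qed

section \<open>Approximation with the sharp mass and decomposition into series\<close>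

lemma operator_eq_on_atom_comb:
  fixes T :: "(('e \<Rightarrow> complex) \<Rightarrow> complex) \<Rightarrow> complex"
  assumes "atom_comb U v m \<psi>" and lin: "clinear_on G T" and g: "g \<in> H"
    and eq: "\<And>x. x \<in> U \<Longrightarrow> T (\<delta> x) = g x"
  shows "T \<psi> = \<psi> g"
  using assms(1)
proof induction
  case zero
  then show ?case using clinear_on_0[OF csubspace_G lin] by (simp add: zero_fun_def)
next
  case (step m \<psi> x c)
  note G = atom_comb_G[OF step.hyps(1)] \<delta>_in_G[OF step.hyps(2)]
  have "T (\<psi> + (c * complex_of_real (v x)) *\<^sub>C \<delta> x) = T \<psi> + c * complex_of_real (v x) * T (\<delta> x)"
    using G csubspace_scale[OF csubspace_G]
    by (simp add: clinear_on_add[OF lin] clinear_on_scale[OF lin] del: pointwise_simps)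
  moreover have "(\<psi> + (c * complex_of_real (v x)) *\<^sub>C \<delta> x) g = \<psi> g + c * complex_of_real (v x) * g x"
    using g by simp
  ultimately show ?case using step.IH eq[OF step.hyps(2)] by presburger
qed

text \<open>Separation: otherwise there is a functional \<open>T\<close> with
  \<open>r \<le> Re (T \<phi>)\<close> whose real part is at most the mass on every finite
  combination. Then \<open>g = T \<circ> \<delta>\<close> lies in the unit ball of \<open>H\<close>
  and \<open>T \<phi> = \<phi> g\<close>, which forces \<open>r \<le> NG \<phi>\<close>.\<close>

lemma atom_comb_approx:
  assumes \<phi>: "\<phi> \<in> G" and r: "NG \<phi> < r" and e: "e > 0"
  shows "\<exists>m \<psi>. atom_comb U v m \<psi> \<and> m \<le> r \<and> NG (\<phi> - \<psi>) \<le> e"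
proof (rule ccontr)
  assume contra: "\<not> ?thesis"
  have r0: "r > 0" using r cnormed_space_onD(3)[OF normed_G \<phi>] by linarith
  \<comment> \<open>With this slope the penalty \<open>k * NG (\<phi> - \<psi>)\<close> reaches
    \<open>r\<close> as soon as the distance reaches \<open>e\<close>, so \<open>sep\<close> holds
    for small and for large mass alike.\<close>
  define k where "k = r / e"
  have k: "k > 0" using r0 e by (simp add: k_def)
  have sep: "r \<le> m + k * NG (\<phi> - \<psi>)" if "atom_comb U v m \<psi>" for m \<psi>
  proof (cases "m \<le> r")
    case True
    then have "e \<le> NG (\<phi> - \<psi>)" using contra that by force
    then have "k * e \<le> k * NG (\<phi> - \<psi>)" using k by simp
    then show ?thesis using atom_comb_G[OF that] e by (simp add: k_def)
  next
    case False
    have "0 \<le> NG (\<phi> - \<psi>)"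
      using cnormed_space_onD(3)[OF normed_G csubspace_diff[OF csubspace_G \<phi>]] atom_comb_G[OF that] by blast
    then have "0 \<le> k * NG (\<phi> - \<psi>)" using k by simp
    then show ?thesis using False by linarith
  qed
  \<comment> \<open>The cone generated by the requirements \<open>r \<le> Re (T \<phi>)\<close> and
    \<open>Re (T \<psi>) \<le> m\<close>; its domination by \<open>k * NG\<close> is
    \<open>sep\<close> after division by \<open>t\<close>.\<close>
  define C where "C = {(complex_of_real t *\<^sub>C \<phi> - \<psi>, t * r - m) | t m \<psi>. t \<ge> 0 \<and> atom_comb U v m \<psi>}"
  have CI: "(complex_of_real t *\<^sub>C \<phi> - \<psi>, t * r - m) \<in> C" if "t \<ge> 0" "atom_comb U v m \<psi>" for t m \<psi>
    using that unfolding C_def by blast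
  have CE: "\<exists>t m \<psi>. y = complex_of_real t *\<^sub>C \<phi> - \<psi> \<and> s = t * r - m \<and> t \<ge> 0 \<and> atom_comb U v m \<psi>"
    if "(y, s) \<in> C" for y s using that unfolding C_def by blast
  have cone: "real_cone C"
    unfolding real_cone_def
  proof (intro conjI allI impI)
    show "(0, 0) \<in> C" using CI[OF _ atom_comb.zero, of 0] by (simp del: pointwise_simps)
  next
    fix y s z w assume "(y, s) \<in> C" "(z, w) \<in> C"
    then obtain t m \<psi> t' m' \<psi>' where
      1: "y = complex_of_real t *\<^sub>C \<phi> - \<psi>" "s = t * r - m" "t \<ge> 0" "atom_comb U v m \<psi>" and
      2: "z = complex_of_real t' *\<^sub>C \<phi> - \<psi>'" "w = t' * r - m'" "t' \<ge> 0" "atom_comb U v m' \<psi>'"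
      using CE by metis
    have "y + z = complex_of_real (t + t') *\<^sub>C \<phi> - (\<psi> + \<psi>')"
      unfolding 1(1) 2(1) of_real_add scaleC_add_left by (simp add: algebra_simps del: pointwise_simps)
    moreover have "s + w = (t + t') * r - (m + m')" by (simp add: 1 2 algebra_simps)
    ultimately show "(y + z, s + w) \<in> C"
      using CI[OF _ atom_comb_add[OF 1(4) 2(4)], of "t + t'"] 1(3) 2(3) by (simp del: pointwise_simps of_real_add)
  next
    fix y s and a :: real assume "(y, s) \<in> C" and a: "a > 0"
    then obtain t m \<psi> where
      1: "y = complex_of_real t *\<^sub>C \<phi> - \<psi>" "s = t * r - m" "t \<ge> 0" "atom_comb U v m \<psi>"
      using CE by metis
    have "complex_of_real a *\<^sub>C y = complex_of_real (a * t) *\<^sub>C \<phi> - complex_of_real a *\<^sub>C \<psi>"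
      by (simp add: 1 scaleC_diff_right scaleC_scaleC del: pointwise_simps)
    moreover have "a * s = (a * t) * r - cmod (complex_of_real a) * m" using a by (simp add: 1 algebra_simps)
    ultimately show "(complex_of_real a *\<^sub>C y, a * s) \<in> C"
      using CI[OF _ atom_comb_scale[OF 1(4), of "complex_of_real a"], of "a * t"] 1(3) a
      by (simp del: pointwise_simps of_real_mult)
  qed
  have semi: "cseminorm_on G (\<lambda>\<phi>. k * NG \<phi>)"
    using cnormed_space_onD(5,6)[OF normed_G] k
    by (auto simp: cseminorm_on_def distrib_left[symmetric])
  have domC: "y \<in> G \<and> s \<le> k * NG y" if yC: "(y, s) \<in> C" for y s
  proof -
    obtain t m \<psi> where
      1: "y = complex_of_real t *\<^sub>C \<phi> - \<psi>" "s = t * r - m" "t \<ge> 0" "atom_comb U v m \<psi>"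
      using CE[OF yC] by metis
    note \<psi> = atom_comb_G[OF 1(4)]
    have y: "y \<in> G" unfolding 1(1)
      using \<phi> \<psi> by (intro csubspace_diff[OF csubspace_G] csubspace_scale[OF csubspace_G]) auto
    show ?thesis
    proof (cases "t = 0")
      case True
      have "0 \<le> k * NG y" using k cnormed_space_onD(3)[OF normed_G y] by simp
      then show ?thesis using 1(2) \<psi> y True by simp
    next
      case False
      then have t: "t > 0" using 1 by simp
      let ?a = "complex_of_real (1 / t)"
      have "r \<le> cmod ?a * m + k * NG (\<phi> - ?a *\<^sub>C \<psi>)" by (rule sep[OF atom_comb_scale[OF 1(4)]])
      also have "\<phi> - ?a *\<^sub>C \<psi> = ?a *\<^sub>C y"
        using t by (simp add: 1 scaleC_diff_right scaleC_scaleC scaleC_one del: pointwise_simps flip: of_real_mult)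
      also have "NG (?a *\<^sub>C y) = 1 / t * NG y"
        using t by (simp add: cnormed_space_onD(6)[OF normed_G y] norm_divide del: pointwise_simps)
      finally have "r \<le> m / t + k * NG y / t" using t by (simp add: norm_divide)
      then have "r * t \<le> m + k * NG y" using t by (simp add: field_simps)
      then show ?thesis using y 1(2) by (simp add: mult.commute)
    qed
  qed
  show False
  proof (rule complex_mazur_orlicz[OF csubspace_G semi cone domC])
    fix T assume T: "T \<in> bounded_ops G (\<lambda>\<phi>. k * NG \<phi>)" "\<And>\<phi>. \<phi> \<in> G \<Longrightarrow> cmod (T \<phi>) \<le> k * NG \<phi>"
      "\<And>y s. (y, s) \<in> C \<Longrightarrow> s \<le> Re (T y)"
    have lin: "clinear_on G T" using T(1) by (simp add: bounded_ops_iff)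
    have Tb: "T \<in> bounded_ops G NG" using T(1,2) by (auto simp: bounded_ops_iff)
    have "r \<le> Re (T \<phi>)" using T(3)[OF CI[OF _ atom_comb.zero, of 1]] by (simp add: scaleC_one del: pointwise_simps)
    have comb_le: "Re (T \<psi>) \<le> m" if "atom_comb U v m \<psi>" for m \<psi>
      using T(3)[OF CI[OF _ that, of 0]] atom_comb_G[OF that]
      by (simp add: clinear_on_minus[OF lin] del: pointwise_simps)
    define g where "g x = (if x \<in> U then T (\<delta> x) else 0)" for x
    have gH: "g \<in> H" unfolding g_def by (rule operator_comp_\<delta>_in_Hv[OF Tb])
    have "NH g \<le> 1"
    proof (rule Hv_norm_leI)
      fix x assume x: "x \<in> U"
      \<comment> \<open>A phase that makes \<open>c * g x\<close> nonnegative turns the bound on the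
        real part into a bound on the modulus.\<close>
      obtain c where c: "cmod c = 1" "c * g x = complex_of_real (cmod (g x))"
      proof (cases "g x = 0")
        case False
        have "cnj (g x) / cmod (g x) * g x = complex_of_real (cmod (g x))"
          using False complex_norm_square[of "g x"] by (simp add: divide_simps power2_eq_square mult.commute)
        moreover have "cmod (cnj (g x) / cmod (g x)) = 1" using False by (simp add: norm_divide)
        ultimately show ?thesis by (rule that[rotated])
      qed (auto intro: that[of 1])
      have "T ((c * complex_of_real (v x)) *\<^sub>C \<delta> x) = complex_of_real (v x) * (c * g x)"
        using x by (simp add: clinear_on_scale[OF lin \<delta>_in_G[OF x]] g_def del: pointwise_simps)
      also have "\<dots> = complex_of_real (v x * cmod (g x))" by (simp add: c)
      finally show "v x * norm (g x) \<le> 1"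
        using comb_le[OF atom_comb_atom[where v = v, OF x, of c]] c by (simp del: pointwise_simps)
    qed simp
    \<comment> \<open>Both \<open>T\<close> and evaluation at \<open>g\<close> are continuous on
      \<open>G\<close> and agree on the finite combinations, which are dense.\<close>
    have "cmod (T \<phi> - \<phi> g) \<le> 0"
    proof (rule field_le_epsilon)
      fix \<eta> :: real assume \<eta>: "\<eta> > 0"
      obtain m \<psi> where \<psi>: "atom_comb U v m \<psi>" "NG (\<phi> - \<psi>) \<le> \<eta> / (k + 1)"
        using atom_comb_dense[OF \<phi>, of "\<eta> / (k + 1)"] \<eta> k by auto
      have eq: "T \<psi> = \<psi> g"
        by (rule operator_eq_on_atom_comb[OF \<psi>(1) lin gH]) (simp add: g_def)
      have \<psi>G: "\<psi> \<in> G" using atom_comb_G[OF \<psi>(1)] by simp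
      have dG: "\<phi> - \<psi> \<in> G" by (rule csubspace_diff[OF csubspace_G \<phi> \<psi>G])
      have "cmod ((\<phi> - \<psi>) g) \<le> NG (\<phi> - \<psi>) * NH g" by (rule NG_bound[OF Gv_bounded_ops[OF dG] gH])
      also have "\<dots> \<le> NG (\<phi> - \<psi>) * 1"
        using \<open>NH g \<le> 1\<close> cnormed_space_onD(3)[OF normed_G dG] by (intro mult_left_mono)
      finally have 1: "cmod ((\<phi> - \<psi>) g) \<le> NG (\<phi> - \<psi>)" by simp
      have split: "T \<phi> - \<phi> g = T (\<phi> - \<psi>) - (\<phi> - \<psi>) g"
        using clinear_on_diff[OF csubspace_G lin \<phi> \<psi>G] eq by simp
      have "cmod (T \<phi> - \<phi> g) \<le> k * NG (\<phi> - \<psi>) + NG (\<phi> - \<psi>)"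
        unfolding split
        by (rule order_trans[OF norm_triangle_ineq4 add_mono[OF T(2)[OF dG] 1]])
      also have "\<dots> = (k + 1) * NG (\<phi> - \<psi>)" by (simp add: distrib_right)
      also have "\<dots> \<le> (k + 1) * (\<eta> / (k + 1))" using k by (intro mult_left_mono \<psi>(2)) auto
      also have "\<dots> = \<eta>" using k by simp
      finally show "cmod (T \<phi> - \<phi> g) \<le> 0 + \<eta>" by simp
    qed
    then have "T \<phi> = \<phi> g" by simp
    moreover have "cmod (\<phi> g) \<le> NG \<phi> * 1"
      using NG_bound[OF Gv_bounded_ops[OF \<phi>] gH] \<open>NH g \<le> 1\<close> cnormed_space_onD(3)[OF normed_G \<phi>]
      by (meson mult_left_mono order_trans)
    ultimately show False using \<open>r \<le> Re (T \<phi>)\<close> r complex_Re_le_cmod[of "T \<phi>"] by simp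
  qed
qed

text \<open>Greedy approximation: each term approximates the residual left by its predecessors, with
  mass barely above the bound on that residual.\<close>

theorem atomic_decomposition:
  assumes \<phi>: "\<phi> \<in> G" and e: "e > 0"
  obtains m \<psi> where "\<And>n. atom_comb U v (m n) (\<psi> n)" "m 0 \<le> NG \<phi> + e" "\<And>n. m (Suc n) \<le> e / 4 ^ n"
    "(\<lambda>n. NG (\<phi> - (\<Sum>k<n. \<psi> k))) \<longlonglongrightarrow> 0"
proof -
  \<comment> \<open>\<open>b n\<close> bounds the n-th residual. Approximation needs a mass strictly
    above the norm, hence the slack \<open>e / 2 / 4 ^ n\<close>; at index \<open>Suc n\<close>
    bound and slack add up to at most \<open>e / 4 ^ n\<close>.\<close>
  define b where "b n = (if n = 0 then NG \<phi> else e / 4 ^ n)" for n :: nat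
  have step: "\<exists>p. atom_comb U v (fst p) (snd p) \<and> fst p \<le> b n + e / 2 / 4 ^ n \<and> NG (\<rho> - snd p) \<le> b (Suc n)"
    if "\<rho> \<in> G" "NG \<rho> \<le> b n" for \<rho> n
  proof -
    have "e / 2 / 4 ^ n > 0" using e by simp
    then have "NG \<rho> < b n + e / 2 / 4 ^ n" using that by linarith
    then show ?thesis using atom_comb_approx[OF that(1), of "b n + e / 2 / 4 ^ n" "b (Suc n)"] e
      by (auto simp: b_def)
  qed
  define pick where "pick n \<rho> = (SOME p. atom_comb U v (fst p) (snd p) \<and> fst p \<le> b n + e / 2 / 4 ^ n \<and>
    NG (\<rho> - snd p) \<le> b (Suc n))" for n \<rho>
  have pick: "atom_comb U v (fst (pick n \<rho>)) (snd (pick n \<rho>))" "fst (pick n \<rho>) \<le> b n + e / 2 / 4 ^ n"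
    "NG (\<rho> - snd (pick n \<rho>)) \<le> b (Suc n)" if "\<rho> \<in> G" "NG \<rho> \<le> b n" for n \<rho>
    using someI_ex[OF step[OF that]] unfolding pick_def by blast+
  define \<rho> where "\<rho> = rec_nat \<phi> (\<lambda>n \<rho>. \<rho> - snd (pick n \<rho>))"
  have \<rho>_Suc: "\<rho> (Suc n) = \<rho> n - snd (pick n (\<rho> n))" for n by (simp add: \<rho>_def)
  have \<rho>: "\<rho> n \<in> G \<and> NG (\<rho> n) \<le> b n" for n
  proof (induction n)
    case 0
    then show ?case using \<phi> by (simp add: \<rho>_def b_def)
  next
    case (Suc n)
    then show ?case
      using pick[of "\<rho> n" n] csubspace_diff[OF csubspace_G] atom_comb_G unfolding \<rho>_Suc by blast
  qed
  define \<psi> where "\<psi> n = snd (pick n (\<rho> n))" for n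
  define m where "m n = fst (pick n (\<rho> n))" for n
  have res: "\<phi> - (\<Sum>k<n. \<psi> k) = \<rho> n" for n
  proof (induction n)
    case (Suc n)
    have "\<phi> - (\<Sum>k<Suc n. \<psi> k) = (\<phi> - (\<Sum>k<n. \<psi> k)) - \<psi> n"
      by (simp add: algebra_simps del: pointwise_simps)
    also have "\<dots> = \<rho> (Suc n)" by (simp only: Suc \<rho>_Suc \<psi>_def[of n])
    finally show ?case .
  qed (simp add: \<rho>_def del: pointwise_simps)
  show thesis
  proof (rule that[of m \<psi>])
    show "atom_comb U v (m n) (\<psi> n)" for n unfolding m_def \<psi>_def using pick(1) \<rho> by blast
    have m: "m n \<le> b n + e / 2 / 4 ^ n" for n unfolding m_def using pick(2) \<rho> by blast
    show "m 0 \<le> NG \<phi> + e" using m[of 0] e by (simp add: b_def)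
    have "b (Suc n) + e / 2 / 4 ^ Suc n \<le> e / 4 ^ n" for n using e by (simp add: b_def field_simps)
    with m show "m (Suc n) \<le> e / 4 ^ n" for n by (rule order_trans)
    have "(\<lambda>n. e / 4 ^ Suc n) \<longlonglongrightarrow> 0"
      using LIMSEQ_Suc[OF tendsto_mult_right_zero[OF LIMSEQ_realpow_zero[of "1/4"], of e]]
      by (simp add: field_simps)
    then have lim: "(\<lambda>n. b (Suc n)) \<longlonglongrightarrow> 0" by (simp add: b_def)
    have "(\<lambda>n. NG (\<rho> (Suc n))) \<longlonglongrightarrow> 0"
      by (rule tendsto_sandwich[OF _ _ tendsto_const lim])
        (use \<rho> cnormed_space_onD(3)[OF normed_G] in \<open>auto intro!: always_eventually\<close>)
    then show "(\<lambda>n. NG (\<phi> - (\<Sum>k<n. \<psi> k))) \<longlonglongrightarrow> 0"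
      unfolding res by (rule LIMSEQ_imp_Suc)
  qed
qed

lemma operator_sums:
  fixes T :: "(('e \<Rightarrow> complex) \<Rightarrow> complex) \<Rightarrow> 'f::complex_normed_vector"
  assumes \<phi>: "\<phi> \<in> G" and \<psi>: "\<And>n. \<psi> n \<in> G" and lim: "(\<lambda>n. NG (\<phi> - (\<Sum>k<n. \<psi> k))) \<longlonglongrightarrow> 0"
    and T: "T \<in> bounded_ops G NG"
  shows "(\<lambda>n. T (\<psi> n)) sums T \<phi>"
proof -
  have lin: "clinear_on G T" using T by (simp add: bounded_ops_iff)
  have S: "(\<Sum>k<n. \<psi> k) \<in> G \<and> T (\<Sum>k<n. \<psi> k) = (\<Sum>k<n. T (\<psi> k))" for n
    by (induction n) (simp_all add: csubspace_0[OF csubspace_G] clinear_on_0[OF csubspace_G lin]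
        csubspace_add[OF csubspace_G] clinear_on_add[OF lin] \<psi> del: pointwise_simps)
  have "norm ((\<Sum>k<n. T (\<psi> k)) - T \<phi>) \<le> op_norm G NG T * NG (\<phi> - (\<Sum>k<n. \<psi> k))" for n
  proof -
    have "T (\<phi> - (\<Sum>k<n. \<psi> k)) = T \<phi> - (\<Sum>k<n. T (\<psi> k))"
      using S[of n] \<phi> by (simp add: clinear_on_diff[OF csubspace_G lin])
    then show ?thesis
      using op_norm_bound[OF normed_G T csubspace_diff[OF csubspace_G \<phi>], of "\<Sum>k<n. \<psi> k"] S[of n]
      by (simp add: norm_minus_commute)
  qed
  moreover have "(\<lambda>n. op_norm G NG T * NG (\<phi> - (\<Sum>k<n. \<psi> k))) \<longlonglongrightarrow> 0"
    using tendsto_mult_right_zero[OF lim] by simp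
  ultimately have "(\<lambda>n. (\<Sum>k<n. T (\<psi> k)) - T \<phi>) \<longlonglongrightarrow> 0"
    by (rule Lim_null_comparison[OF always_eventually[OF allI]])
  then show ?thesis unfolding sums_def by (rule LIM_zero_cancel)
qed

section \<open>Existence and uniqueness of the linearization\<close>

lemma operator_determined_by_\<delta>:
  fixes T R :: "(('e \<Rightarrow> complex) \<Rightarrow> complex) \<Rightarrow> 'f::complex_normed_vector"
  assumes T: "T \<in> bounded_ops G NG" and R: "R \<in> bounded_ops G NG"
    and eq: "\<And>x. x \<in> U \<Longrightarrow> T (\<delta> x) = R (\<delta> x)"
  shows "T = R"
proof
  fix \<phi>
  have sub: "csubspace (bounded_ops G NG :: ((('e \<Rightarrow> complex) \<Rightarrow> complex) \<Rightarrow> 'f) set)"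
    by (rule cnormed_space_onD(1)[OF cnormed_space_bounded_ops[OF normed_G]])
  have D: "T - R \<in> bounded_ops G NG" by (rule csubspace_diff[OF sub T R])
  then have lin: "clinear_on G (T - R)" by (simp add: bounded_ops_iff)
  show "T \<phi> = R \<phi>"
  proof (cases "\<phi> \<in> G")
    case True
    obtain m \<psi> where \<psi>: "\<And>n. atom_comb U v (m n) (\<psi> n)"
      "(\<lambda>n. NG (\<phi> - (\<Sum>k<n. \<psi> k))) \<longlonglongrightarrow> 0"
      using atomic_decomposition[OF True, of 1] by (metis zero_less_one)
    \<comment> \<open>The operator bound with constant 0, since the difference vanishes on all
      atoms.\<close>
    have "(T - R) (\<psi> n) = 0" for n
      using atom_comb_bound[OF \<psi>(1) lin, of 0] eq by simp
    then have "(\<lambda>n. 0) sums (T - R) \<phi>"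
      using operator_sums[OF True _ \<psi>(2) D] atom_comb_G[OF \<psi>(1)] by simp
    then have "(T - R) \<phi> = 0" using sums_unique2 sums_zero by blast
    then show ?thesis by simp
  qed (use T R in \<open>auto simp: bounded_ops_iff\<close>)
qed

lemma dual_ball_comp_Hv:
  fixes f :: "'e \<Rightarrow> 'f::complex_normed_vector"
  assumes f: "f \<in> Hv U v" and y: "y \<in> dual_ball"
  shows "(\<lambda>x. y (f x)) \<in> H" "NH (\<lambda>x. y (f x)) \<le> Hv_norm U v f"
proof -
  have bd: "v x * cmod (y (f x)) \<le> Hv_norm U v f" if "x \<in> U" for x
    using Hv_norm_bound[OF f that] mult_left_mono[OF dual_ball_bound[OF y, of "f x"]] v_pos[OF that]
    by (meson less_imp_le order_trans)
  show "(\<lambda>x. y (f x)) \<in> H"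
  proof (rule Hv_memI[OF _ bd])
    show "holo_on U (\<lambda>x. y (f x))"
      using f by (intro holo_on_bounded_linear_comp[OF _ dual_ball_clinear[OF y] dual_ball_bounded_linear[OF y]])
        (simp add: Hv_def)
    show "y (f x) = 0" if "x \<notin> U" for x
      using Hv_outside[OF f that] clinear_on_0[OF csubspace_UNIV dual_ball_clinear[OF y]] by simp
  qed
  show "NH (\<lambda>x. y (f x)) \<le> Hv_norm U v f" by (intro Hv_norm_leI bd Hv_norm_nonneg[OF f])
qed

text \<open>The value \<open>z\<close> at \<open>\<phi>\<close> is pinned down by
  \<open>y z = \<phi> (y \<circ> f)\<close> for all \<open>y\<close>. For finite combinations such a
  \<open>z\<close> exists with norm at most the mass times the norm of \<open>f\<close>; summable
  masses and completeness of the target extend this to all of \<open>G\<close>. Linearity and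
  boundedness are read off from the identity.\<close>

theorem linearization_exists:
  fixes f :: "'e \<Rightarrow> 'f::cbanach"
  assumes f: "f \<in> Hv U v"
  shows "\<exists>T. T \<in> bounded_ops G NG \<and> (\<forall>x\<in>U. T (\<delta> x) = f x)"
proof -
  let ?K = "Hv_norm U v f"
  have comb: "\<exists>z. norm z \<le> m * ?K \<and> (\<forall>y\<in>dual_ball. y z = \<psi> (\<lambda>x. y (f x)))"
    if "atom_comb U v m \<psi>" for m \<psi>
    using that
  proof induction
    case zero
    then show ?case
      using clinear_on_0[OF csubspace_UNIV dual_ball_clinear]
      by (intro exI[of _ 0]) (auto simp: zero_fun_def)
  next
    case (step m \<psi> x c)
    then obtain z where z: "norm z \<le> m * ?K" "\<forall>y\<in>dual_ball. y z = \<psi> (\<lambda>x. y (f x))" by blast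
    let ?z = "z + (c * complex_of_real (v x)) *\<^sub>C f x"
    have "norm ?z \<le> norm z + cmod c * (v x * norm (f x))"
      using norm_triangle_ineq[of z "(c * complex_of_real (v x)) *\<^sub>C f x"] v_pos[OF step.hyps(2)]
      by (simp add: norm_scaleC norm_mult mult.assoc)
    also have "\<dots> \<le> m * ?K + cmod c * ?K"
      by (intro add_mono z mult_left_mono Hv_norm_bound[OF f step.hyps(2)]) auto
    finally have "norm ?z \<le> (m + cmod c) * ?K" by (simp add: distrib_right)
    moreover have "y ?z = (\<psi> + (c * complex_of_real (v x)) *\<^sub>C \<delta> x) (\<lambda>x. y (f x))" if y: "y \<in> dual_ball" for y
      using z(2) y dual_ball_comp_Hv(1)[OF f y]
        clinear_on_add[OF dual_ball_clinear[OF y]] clinear_on_scale[OF dual_ball_clinear[OF y]] by simp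
    ultimately show ?case by blast
  qed
  have ex: "\<exists>z. \<forall>y\<in>dual_ball. y z = \<phi> (\<lambda>x. y (f x))" if \<phi>: "\<phi> \<in> G" for \<phi>
  proof -
    obtain m \<psi> where \<psi>: "\<And>n. atom_comb U v (m n) (\<psi> n)" "\<And>n. m (Suc n) \<le> 1 / 4 ^ n"
      "(\<lambda>n. NG (\<phi> - (\<Sum>k<n. \<psi> k))) \<longlonglongrightarrow> 0"
      using atomic_decomposition[OF \<phi>, of 1] by (metis zero_less_one)
    have "\<exists>z. \<forall>n. norm (z n) \<le> m n * ?K \<and> (\<forall>y\<in>dual_ball. y (z n) = \<psi> n (\<lambda>x. y (f x)))"
      by (intro choice allI comb \<psi>(1))
    then obtain z where z: "\<And>n. norm (z n) \<le> m n * ?K"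
      "\<And>n y. y \<in> dual_ball \<Longrightarrow> y (z n) = \<psi> n (\<lambda>x. y (f x))"
      by blast
    have "summable (\<lambda>n. norm (z (Suc n)))"
    proof (rule summable_comparison_test'[of "\<lambda>n. ?K * (1/4) ^ n"])
      show "summable (\<lambda>n. ?K * (1/4) ^ n)" by (intro summable_mult summable_geometric) auto
      show "norm (norm (z (Suc n))) \<le> ?K * (1/4) ^ n" for n
        using order_trans[OF z(1) mult_right_mono[OF \<psi>(2) Hv_norm_nonneg[OF f]]]
        by (simp add: power_divide)
    qed
    then have "summable z" using summable_norm_cancel[of "\<lambda>n. z (Suc n)"] summable_Suc_iff by blast
    then have sums: "z sums suminf z" by (rule summable_sums)
    have "y (suminf z) = \<phi> (\<lambda>x. y (f x))" if y: "y \<in> dual_ball" for y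
    proof -
      have "(\<lambda>n. y (z n)) sums y (suminf z)"
        by (rule bounded_linear.sums[OF dual_ball_bounded_linear[OF y] sums])
      then have 1: "(\<lambda>n. \<psi> n (\<lambda>x. y (f x))) sums y (suminf z)" by (simp add: z(2)[OF y])
      let ?g = "\<lambda>x. y (f x)"
      \<comment> \<open>Evaluation at \<open>y \<circ> f\<close> is itself a bounded operator on
        \<open>G\<close>, so the decomposition may be evaluated term by term.\<close>
      define E where "E \<theta> = (if \<theta> \<in> G then \<theta> ?g else 0)" for \<theta> :: "('e \<Rightarrow> complex) \<Rightarrow> complex"
      note g = dual_ball_comp_Hv(1)[OF f y]
      have "E \<in> bounded_ops G NG"
        unfolding bounded_ops_def
        using NG_bound[OF Gv_bounded_ops g] csubspace_add[OF csubspace_G] csubspace_scale[OF csubspace_G]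
        by (auto simp: E_def mult.commute intro!: exI[of _ "NH ?g"])
      from operator_sums[OF \<phi> _ \<psi>(3) this] atom_comb_G[OF \<psi>(1)]
      have "(\<lambda>n. \<psi> n ?g) sums \<phi> ?g" using \<phi> by (simp add: E_def)
      with 1 show ?thesis by (rule sums_unique2)
    qed
    then show ?thesis by blast
  qed
  \<comment> \<open>The choice is unambiguous, because the functionals in \<open>dual_ball\<close>
    separate points.\<close>
  define T where "T \<phi> = (if \<phi> \<in> G then SOME z. \<forall>y\<in>dual_ball. y z = \<phi> (\<lambda>x. y (f x)) else 0)" for \<phi>
  have T: "y (T \<phi>) = \<phi> (\<lambda>x. y (f x))" if "\<phi> \<in> G" "y \<in> dual_ball" for \<phi> y
    using someI_ex[OF ex[OF that(1)]] that by (simp add: T_def)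
  have "T \<in> bounded_ops G NG"
    unfolding bounded_ops_def
  proof (intro CollectI conjI ballI allI impI exI[of _ ?K])
    fix \<phi> \<theta> assume G: "\<phi> \<in> G" "\<theta> \<in> G"
    show "T (\<phi> + \<theta>) = T \<phi> + T \<theta>"
    proof (rule dual_ball_separates)
      fix y :: "'f \<Rightarrow> complex" assume y: "y \<in> dual_ball"
      have "y (T (\<phi> + \<theta>)) = (\<phi> + \<theta>) (\<lambda>x. y (f x))" by (rule T[OF csubspace_add[OF csubspace_G G] y])
      then show "y (T (\<phi> + \<theta>)) = y (T \<phi> + T \<theta>)"
        using T[OF G(1) y] T[OF G(2) y] clinear_on_add[OF dual_ball_clinear[OF y]] by simp
    qed
  next
    fix c \<phi> assume G: "\<phi> \<in> G"
    show "T (c *\<^sub>C \<phi>) = c *\<^sub>C T \<phi>"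
    proof (rule dual_ball_separates)
      fix y :: "'f \<Rightarrow> complex" assume y: "y \<in> dual_ball"
      have "y (T (c *\<^sub>C \<phi>)) = (c *\<^sub>C \<phi>) (\<lambda>x. y (f x))" by (rule T[OF csubspace_scale[OF csubspace_G G] y])
      then show "y (T (c *\<^sub>C \<phi>)) = y (c *\<^sub>C T \<phi>)"
        using T[OF G y] clinear_on_scale[OF dual_ball_clinear[OF y]] by simp
    qed
  next
    fix \<phi> assume G: "\<phi> \<in> G"
    show "norm (T \<phi>) \<le> ?K * NG \<phi>"
    proof (rule norm_le_dual_ball)
      fix y :: "'f \<Rightarrow> complex" assume y: "y \<in> dual_ball"
      have "cmod (y (T \<phi>)) \<le> NG \<phi> * NH (\<lambda>x. y (f x))"
        unfolding T[OF G y] by (rule NG_bound[OF Gv_bounded_ops[OF G] dual_ball_comp_Hv(1)[OF f y]])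
      also have "\<dots> \<le> NG \<phi> * ?K"
        by (intro mult_left_mono dual_ball_comp_Hv(2)[OF f y] cnormed_space_onD(3)[OF normed_G G])
      finally show "cmod (y (T \<phi>)) \<le> ?K * NG \<phi>" by (simp add: mult.commute)
    qed
  qed (simp add: T_def)
  moreover have "T (\<delta> x) = f x" if x: "x \<in> U" for x
    by (rule dual_ball_separates) (simp add: T[OF \<delta>_in_G[OF x]] dual_ball_comp_Hv(1)[OF f])
  ultimately show ?thesis by blast
qed

lemma linearization_spec:
  fixes f :: "'e \<Rightarrow> 'f::cbanach"
  assumes f: "f \<in> Hv U v"
  shows "linearization U v f \<in> bounded_ops G NG" "x \<in> U \<Longrightarrow> linearization U v f (\<delta> x) = f x"
proof -
  have "\<exists>!T. T \<in> bounded_ops G NG \<and> (\<forall>x\<in>U. T (\<delta> x) = f x)"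
  proof (rule ex_ex1I[OF linearization_exists[OF f]])
    fix T R
    assume "T \<in> bounded_ops G NG \<and> (\<forall>x\<in>U. T (\<delta> x) = f x)"
      "R \<in> bounded_ops G NG \<and> (\<forall>x\<in>U. R (\<delta> x) = f x)"
    then show "T = R" by (intro operator_determined_by_\<delta>) auto
  qed
  from theI'[OF this]
  show "linearization U v f \<in> bounded_ops G NG" "x \<in> U \<Longrightarrow> linearization U v f (\<delta> x) = f x"
    unfolding linearization_def by blast+
qed

lemma linearization_eqI:
  fixes f :: "'e \<Rightarrow> 'f::cbanach"
  assumes "f \<in> Hv U v" "T \<in> bounded_ops G NG" "\<And>x. x \<in> U \<Longrightarrow> T (\<delta> x) = f x"
  shows "linearization U v f = T"
  by (rule operator_determined_by_\<delta>) (use assms linearization_spec[OF assms(1)] in auto)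

end

subsection \<open>Finite sections of \<open>\<ell>\<^sub>q\<close> norms\<close>

text \<open>Finite sections spare carrying summability along and let \<open>\<infinity>\<close> fit
  the same scheme. The index type is arbitrary so that double sequences are covered.\<close>

definition lq_le :: "ennreal \<Rightarrow> real \<Rightarrow> ('i \<Rightarrow> real) \<Rightarrow> 'i set \<Rightarrow> bool"
  where "lq_le q r u F \<longleftrightarrow>
    (if q = \<infinity> then \<forall>n\<in>F. u n \<le> r
     else (\<Sum>n\<in>F. u n powr enn2real q) \<le> r powr enn2real q)"

abbreviation lq_le_from :: "ennreal \<Rightarrow> real \<Rightarrow> (nat \<Rightarrow> real) \<Rightarrow> nat \<Rightarrow> bool"
  where "lq_le_from q r u M \<equiv> \<forall>F. finite F \<longrightarrow> F \<subseteq> {M..} \<longrightarrow> lq_le q r u F"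

lemma enn2real_ge_1: "1 \<le> q \<Longrightarrow> q \<noteq> \<infinity> \<Longrightarrow> 1 \<le> enn2real q"
  by (cases q) (auto simp: top_ennreal.rep_eq simp flip: ennreal_1 infinity_ennreal_def)

lemma powr_superadditive:
  fixes a b q :: real
  assumes "0 \<le> a" "0 \<le> b" "1 \<le> q"
  shows "a powr q + b powr q \<le> (a + b) powr q"
proof -
  have *: "x powr q \<le> x * (a + b) powr (q - 1)" if "0 \<le> x" "x \<le> a + b" for x
  proof (cases "x = 0")
    case False
    then have "x powr q = x * x powr (q - 1)" using that by (simp add: powr_mult_base)
    also have "\<dots> \<le> x * (a + b) powr (q - 1)" using that assms by (intro mult_left_mono powr_mono2) auto
    finally show ?thesis .
  qed simp
  have "a powr q + b powr q \<le> (a + b) * (a + b) powr (q - 1)"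
    using *[of a] *[of b] assms by (simp add: distrib_right)
  also have "\<dots> = (a + b) powr q"
    using assms by (cases "a + b = 0") (auto simp: powr_mult_base)
  finally show ?thesis .
qed

text \<open>The missing weight \<open>1 - (a + b)\<close> belongs to the value 0. For
  \<open>s = a + b\<close> convexity is used with the weights \<open>a / s\<close> and
  \<open>b / s\<close>, and the factor left over satisfies \<open>s powr q \<le> s\<close>.\<close>

lemma powr_convex_combination:
  fixes u w a b q :: real
  assumes "0 \<le> u" "0 \<le> w" "0 \<le> a" "0 \<le> b" "a + b \<le> 1" "1 \<le> q"
  shows "(a * u + b * w) powr q \<le> a * u powr q + b * w powr q"
proof (cases "a + b = 0 \<or> u = 0 \<or> w = 0")
  case True
  have less1: "(c * x) powr q \<le> c * x powr q" if "0 \<le> c" "c \<le> 1" "0 \<le> x" for c x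
  proof -
    have "c powr q \<le> c"
      using powr_mono'[of 1 q c] that assms(6) by (cases "c = 0") auto
    then show ?thesis using that by (simp add: powr_mult mult_right_mono)
  qed
  show ?thesis
  proof (cases "a + b = 0")
    case True
    then have "a = 0" "b = 0" using assms by auto
    then show ?thesis by simp
  next
    case False
    then show ?thesis using True less1[of a u] less1[of b w] assms by auto
  qed
next
  case False
  then have pos: "a + b > 0" "u > 0" "w > 0" using assms by auto
  define s where "s = a + b"
  have s: "s > 0" "s \<le> 1" using pos assms by (auto simp: s_def)
  have "(a / s * u + b / s * w) powr q \<le> a / s * u powr q + b / s * w powr q"
  proof -
    have as: "a / s = 1 - b / s" using s by (simp add: s_def field_simps)
    show ?thesis
      using convex_onD[OF powr_convex[OF assms(6)], of "b / s" u w] pos s assms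
      unfolding as by (simp add: s_def)
  qed
  then have 1: "s * (a / s * u + b / s * w) powr q \<le> a * u powr q + b * w powr q"
    using s by (simp add: field_simps)
  have "a * u + b * w = s * (a / s * u + b / s * w)" using s by (simp add: field_simps)
  then have "(a * u + b * w) powr q = s powr q * (a / s * u + b / s * w) powr q"
    using s pos assms by (simp add: powr_mult)
  also have "\<dots> \<le> s * (a / s * u + b / s * w) powr q"
    using powr_mono'[of 1 q s] s assms(6) by (intro mult_right_mono) auto
  finally show ?thesis using 1 by linarith
qed

context
  fixes q :: ennreal
  assumes q1: "1 \<le> q"
begin

lemma lq_le_mono:
  assumes "lq_le q r u F" "0 \<le> r" "r \<le> r'" "\<And>n. n \<in> F \<Longrightarrow> 0 \<le> u' n \<and> u' n \<le> u n"
  shows "lq_le q r' u' F"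
proof (cases "q = \<infinity>")
  case False
  have "(\<Sum>n\<in>F. u' n powr enn2real q) \<le> (\<Sum>n\<in>F. u n powr enn2real q)"
    using assms by (intro sum_mono powr_mono2) auto
  also have "\<dots> \<le> r powr enn2real q" using assms(1) False by (simp add: lq_le_def)
  also have "\<dots> \<le> r' powr enn2real q" using assms by (intro powr_mono2) auto
  finally show ?thesis using False by (simp add: lq_le_def)
qed (use assms in \<open>force simp: lq_le_def\<close>)

lemma lq_le_scale:
  assumes "lq_le q r u F" "0 \<le> c" "0 \<le> r" "\<And>n. n \<in> F \<Longrightarrow> 0 \<le> u n"
  shows "lq_le q (c * r) (\<lambda>n. c * u n) F"
proof (cases "q = \<infinity>")
  case False
  have "(\<Sum>n\<in>F. (c * u n) powr enn2real q) = c powr enn2real q * (\<Sum>n\<in>F. u n powr enn2real q)"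
    using assms by (simp add: powr_mult sum_distrib_left)
  also have "\<dots> \<le> c powr enn2real q * r powr enn2real q"
    using assms(1) False by (intro mult_left_mono) (auto simp: lq_le_def)
  also have "\<dots> = (c * r) powr enn2real q" using assms by (simp add: powr_mult)
  finally show ?thesis using False by (simp add: lq_le_def)
qed (use assms in \<open>auto simp: lq_le_def mult_left_mono\<close>)

lemma lq_le_convex:
  assumes "lq_le q r u F" "lq_le q r w F" "0 \<le> a" "0 \<le> b" "a + b \<le> 1" "0 \<le> r"
    "\<And>n. n \<in> F \<Longrightarrow> 0 \<le> u n" "\<And>n. n \<in> F \<Longrightarrow> 0 \<le> w n"
  shows "lq_le q r (\<lambda>n. a * u n + b * w n) F"
proof (cases "q = \<infinity>")
  case True
  have "a * u n + b * w n \<le> r" if "n \<in> F" for n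
  proof -
    have "a * u n + b * w n \<le> a * r + b * r"
      using assms that True by (intro add_mono mult_left_mono) (auto simp: lq_le_def)
    also have "\<dots> = (a + b) * r" by (simp add: distrib_right)
    also have "\<dots> \<le> 1 * r" using assms by (intro mult_right_mono) auto
    finally show ?thesis by simp
  qed
  then show ?thesis using True by (simp add: lq_le_def)
next
  case False
  let ?Q = "enn2real q"
  have "(\<Sum>n\<in>F. (a * u n + b * w n) powr ?Q) \<le> (\<Sum>n\<in>F. a * u n powr ?Q + b * w n powr ?Q)"
    using assms enn2real_ge_1[OF q1 False] by (intro sum_mono powr_convex_combination) auto
  also have "\<dots> = a * (\<Sum>n\<in>F. u n powr ?Q) + b * (\<Sum>n\<in>F. w n powr ?Q)"
    by (simp add: sum.distrib sum_distrib_left)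
  also have "\<dots> \<le> a * r powr ?Q + b * r powr ?Q"
    using assms False by (intro add_mono mult_left_mono) (auto simp: lq_le_def)
  also have "\<dots> = (a + b) * r powr ?Q" by (simp add: distrib_right)
  also have "\<dots> \<le> 1 * r powr ?Q" using assms by (intro mult_right_mono) auto
  finally show ?thesis using False by (simp add: lq_le_def)
qed

lemma lq_le_split:
  assumes "lq_le q r u (F \<inter> A)" "lq_le q s u (F - A)" "finite F" "0 \<le> r" "0 \<le> s"
  shows "lq_le q (r + s) u F"
proof (cases "q = \<infinity>")
  case True
  have "u n \<le> r + s" if "n \<in> F" for n
  proof (cases "n \<in> A")
    case True
    then have "u n \<le> r" using assms(1) that \<open>q = \<infinity>\<close> by (simp add: lq_le_def)
    then show ?thesis using assms(5) by linarith
  next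
    case False
    then have "u n \<le> s" using assms(2) that \<open>q = \<infinity>\<close> by (simp add: lq_le_def)
    then show ?thesis using assms(4) by linarith
  qed
  then show ?thesis using True by (simp add: lq_le_def)
next
  case False
  let ?Q = "enn2real q"
  have "(\<Sum>n\<in>F. u n powr ?Q) = (\<Sum>n\<in>F \<inter> A. u n powr ?Q) + (\<Sum>n\<in>F - A. u n powr ?Q)"
    using assms(3) by (simp add: sum.Int_Diff)
  also have "\<dots> \<le> r powr ?Q + s powr ?Q" using assms False by (intro add_mono) (auto simp: lq_le_def)
  also have "\<dots> \<le> (r + s) powr ?Q" using assms enn2real_ge_1[OF q1 False] by (intro powr_superadditive)
  finally show ?thesis using False by (simp add: lq_le_def)
qed

text \<open>The contractive inclusion of \<open>l_1\<close> into \<open>l_q\<close>, adding one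
  index at a time.\<close>

lemma lq_le_of_sum:
  assumes "finite F" "\<And>n. n \<in> F \<Longrightarrow> 0 \<le> u n" "(\<Sum>n\<in>F. u n) \<le> r"
  shows "lq_le q r u F"
proof -
  have "lq_le q (\<Sum>n\<in>F. u n) u F"
    using assms(1,2)
  proof (induction F)
    case empty
    then show ?case by (simp add: lq_le_def)
  next
    case (insert n F)
    have "lq_le q (u n + (\<Sum>n\<in>F. u n)) u (insert n F)"
    proof (rule lq_le_split[where A = "{n}"])
      have "insert n F \<inter> {n} = {n}" "insert n F - {n} = F" using insert.hyps by auto
      then show "lq_le q (u n) u (insert n F \<inter> {n})" "lq_le q (\<Sum>n\<in>F. u n) u (insert n F - {n})"
        using insert by (auto simp: lq_le_def)
    qed (use insert in \<open>auto intro: sum_nonneg\<close>)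
    then show ?case using insert.hyps by simp
  qed
  then show ?thesis by (rule lq_le_mono) (use assms in \<open>auto intro: sum_nonneg\<close>)
qed

text \<open>Bounded sections give small tails for finite exponents only; at
  \<open>\<infinity>\<close> the null condition is extra information that has to be carried
  separately.\<close>

lemma lq_le_tail:
  fixes u :: "nat \<Rightarrow> real"
  assumes fin: "q \<noteq> \<infinity>" and bd: "\<And>F. finite F \<Longrightarrow> lq_le q r u F" and e: "e > 0"
  shows "\<exists>M. lq_le_from q e u M"
proof -
  let ?Q = "enn2real q"
  have "summable (\<lambda>n. u n powr ?Q)"
    by (rule summableI_nonneg_bounded[of _ "r powr ?Q"]) (use bd[of "{..<_}"] fin in \<open>auto simp: lq_le_def\<close>)
  moreover have "e powr ?Q > 0" using e by simp
  ultimately obtain M where M: "\<And>m n. m \<ge> M \<Longrightarrow> norm (\<Sum>k\<in>{m..<n}. u k powr ?Q) < e powr ?Q"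
    unfolding summable_Cauchy by blast
  have "lq_le q e u F" if F: "finite F" "F \<subseteq> {M..}" for F
  proof -
    obtain n where "F \<subseteq> {..<n}" using finite_nat_bounded[OF F(1)] by blast
    then have "F \<subseteq> {M..<n}" using F by auto
    then have "(\<Sum>k\<in>F. u k powr ?Q) \<le> (\<Sum>k\<in>{M..<n}. u k powr ?Q)" by (intro sum_mono2) auto
    also have "\<dots> \<le> e powr ?Q" using M[of M n] by simp
    finally show ?thesis using fin by (simp add: lq_le_def)
  qed
  then show ?thesis by blast
qed

text \<open>Taking \<open>l_q\<close> norms along rows and then across rows is the
  \<open>l_q\<close> norm over pairs.\<close>

lemma lq_le_rows:
  fixes u :: "nat \<Rightarrow> nat \<Rightarrow> real"
  assumes F: "finite F" and u: "\<And>k j. 0 \<le> u k j" and B: "\<And>k. 0 \<le> B k"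
    and rows: "\<And>k. lq_le q (B k) (u k) {j. (k, j) \<in> F}"
    and S: "lq_le q S B (fst ` F)"
  shows "lq_le q S (\<lambda>(k, j). u k j) F"
proof (cases "q = \<infinity>")
  case True
  then show ?thesis using rows S by (force simp: lq_le_def)
next
  case False
  let ?Q = "enn2real q"
  have fin: "finite {j. (k, j) \<in> F}" for k
    by (rule finite_subset[of _ "snd ` F"]) (use F in force)+
  have F_eq: "F = (SIGMA k:fst ` F. {j. (k, j) \<in> F})" by force
  have "(\<Sum>p\<in>F. (case p of (k, j) \<Rightarrow> u k j) powr ?Q)
      = (\<Sum>p\<in>(SIGMA k:fst ` F. {j. (k, j) \<in> F}). case p of (k, j) \<Rightarrow> u k j powr ?Q)"
    by (subst F_eq, rule sum.cong) auto
  also have "\<dots> = (\<Sum>k\<in>fst ` F. \<Sum>j\<in>{j. (k, j) \<in> F}. u k j powr ?Q)"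
    using F fin by (subst sum.Sigma) auto
  also have "\<dots> \<le> (\<Sum>k\<in>fst ` F. B k powr ?Q)"
    using rows False by (intro sum_mono) (auto simp: lq_le_def)
  also have "\<dots> \<le> S powr ?Q" using S False by (simp add: lq_le_def)
  finally show ?thesis using False by (simp add: lq_le_def)
qed

lemma lq_le_reindex:
  assumes "inj_on g F"
  shows "lq_le q r (\<lambda>n. u (g n)) F \<longleftrightarrow> lq_le q r u (g ` F)"
  using assms by (simp add: lq_le_def sum.reindex o_def)

end

subsection \<open>Uniform \<open>\<ell>\<^sub>q\<close> bounds and the direct sum of countably many sequences\<close>

definition homogeneous :: "('a::real_vector \<Rightarrow> real) set \<Rightarrow> bool"
  where "homogeneous \<Psi> \<longleftrightarrow> (\<forall>P\<in>\<Psi>. \<forall>x. 0 \<le> P x \<and> (\<forall>r. P (r *\<^sub>R x) = \<bar>r\<bar> * P x))"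

text \<open>The family \<open>{norm}\<close> gives the strong ball, the moduli of the functionals in
  \<open>dual_ball\<close> the weak one.\<close>

definition seq_ball :: "ennreal \<Rightarrow> ('a \<Rightarrow> real) set \<Rightarrow> real \<Rightarrow> (nat \<Rightarrow> 'a) \<Rightarrow> bool"
  where "seq_ball q \<Psi> r x \<longleftrightarrow> (\<forall>P\<in>\<Psi>. \<forall>F. finite F \<longrightarrow> lq_le q r (\<lambda>n. P (x n)) F)"

text \<open>\<open>M\<close> is chosen before \<open>P\<close>. Over the dual ball this uniformity
  is the tail condition of \<open>lpu\<close>; over a singleton it concerns one scalar
  sequence.\<close>

definition seq_tail :: "ennreal \<Rightarrow> ('a \<Rightarrow> real) set \<Rightarrow> (nat \<Rightarrow> 'a) \<Rightarrow> bool"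
  where "seq_tail q \<Psi> x \<longleftrightarrow>
    (\<forall>e>0. \<exists>M. \<forall>P\<in>\<Psi>. lq_le_from q e (\<lambda>n. P (x n)) M)"

definition direct_sum :: "(nat \<Rightarrow> real) \<Rightarrow> (nat \<Rightarrow> nat \<Rightarrow> 'a::real_vector) \<Rightarrow> nat \<Rightarrow> 'a"
  where "direct_sum s x n = (case prod_decode n of (k, j) \<Rightarrow> s k *\<^sub>R x k j)"

text \<open>Row bounds are demanded only on the part of a row that \<open>F\<close> meets, so that
  the tail estimate can insert smaller bounds than those of the full rows.\<close>

lemma direct_sum_rows:
  assumes q: "1 \<le> q" and P: "homogeneous \<Psi>" "P \<in> \<Psi>" and F: "finite F" and s: "\<And>k. 0 \<le> s k"
    and B: "\<And>k. 0 \<le> B k" and rows: "\<And>k. lq_le q (B k) (\<lambda>j. P (x k j)) {j. prod_encode (k, j) \<in> F}"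
    and S: "lq_le q S (\<lambda>k. s k * B k) (fst ` prod_decode ` F)"
  shows "lq_le q S (\<lambda>n. P (direct_sum s x n)) F"
proof -
  have P0: "0 \<le> P y" "P (r *\<^sub>R y) = \<bar>r\<bar> * P y" for r y
    using P by (simp_all add: homogeneous_def)
  let ?F = "prod_decode ` F"
  have mem: "(k, j) \<in> ?F \<longleftrightarrow> prod_encode (k, j) \<in> F" for k j
    by (metis image_eqI imageE prod_decode_inverse prod_encode_inverse)
  have "lq_le q S (\<lambda>(k, j). s k * P (x k j)) ?F"
  proof (rule lq_le_rows[OF q _ _ _ _ S])
    show "lq_le q (s k * B k) (\<lambda>j. s k * P (x k j)) {j. (k, j) \<in> ?F}" for k
      unfolding mem by (rule lq_le_scale[OF q rows s B P0(1)])
  qed (use F s B P0 in auto)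
  then have "lq_le q S (\<lambda>n. case prod_decode n of (k, j) \<Rightarrow> s k * P (x k j)) F"
    by (subst lq_le_reindex[OF q, where u = "\<lambda>(k, j). s k * P (x k j)"]) (auto simp: inj_prod_decode)
  moreover have "(\<lambda>n. case prod_decode n of (k, j) \<Rightarrow> s k * P (x k j)) = (\<lambda>n. P (direct_sum s x n))"
    using s by (auto simp: direct_sum_def P0 fun_eq_iff split: prod.split)
  ultimately show ?thesis by simp
qed

lemma direct_sum_ball:
  assumes q: "1 \<le> q" and hom: "homogeneous \<Psi>" and s: "\<And>k. 0 \<le> s k" and B: "\<And>k. 0 \<le> B k"
    and x: "\<And>k. seq_ball q \<Psi> (B k) (x k)"
    and S: "\<And>K. finite K \<Longrightarrow> lq_le q S (\<lambda>k. s k * B k) K"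
  shows "seq_ball q \<Psi> S (direct_sum s x)"
  unfolding seq_ball_def
proof (intro ballI allI impI)
  fix P and F :: "nat set" assume P: "P \<in> \<Psi>" and F: "finite F"
  show "lq_le q S (\<lambda>n. P (direct_sum s x n)) F"
  proof (rule direct_sum_rows[where B = B, OF q hom P F s B])
    fix k
    have "finite ((\<lambda>j. prod_encode (k, j)) -` F)"
      by (rule finite_vimageI[OF F]) (auto simp: inj_on_def)
    then show "lq_le q (B k) (\<lambda>j. P (x k j)) {j. prod_encode (k, j) \<in> F}"
      using x[of k] P by (simp add: seq_ball_def vimage_def)
  qed (use F in \<open>auto intro: S\<close>)
qed

text \<open>An index set far out avoids the initial entries of the first \<open>K0\<close> rows,
  which then contribute little, while all later rows together are small by the tail of
  \<open>s k * B k\<close>.\<close>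

lemma direct_sum_tail:
  assumes q: "1 \<le> q" and hom: "homogeneous \<Psi>" and s: "\<And>k. 0 \<le> s k" and B: "\<And>k. 0 \<le> B k"
    and x: "\<And>k. seq_ball q \<Psi> (B k) (x k)" and xt: "\<And>k. seq_tail q \<Psi> (x k)"
    and St: "\<And>e. e > 0 \<Longrightarrow> \<exists>M. lq_le_from q e (\<lambda>k. s k * B k) M"
  shows "seq_tail q \<Psi> (direct_sum s x)"
  unfolding seq_tail_def
proof (intro allI impI)
  fix e :: real assume e: "e > 0"
  obtain K0 where K0: "\<And>K. finite K \<Longrightarrow> K \<subseteq> {K0..} \<Longrightarrow> lq_le q (e/2) (\<lambda>k. s k * B k) K"
    using St[of "e/2"] e by auto
  \<comment> \<open>The share of \<open>e / 2\<close> allotted to one of the first \<open>K0\<close>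
    rows, with the scaling \<open>s k\<close> undone; the added ones keep the denominators
    positive.\<close>
  define c where "c k = (e / 2) / (real K0 + 1) / (s k + 1)" for k
  have c: "c k > 0" for k using e s[of k] by (simp add: c_def)
  have sc: "s k * c k \<le> (e / 2) / (real K0 + 1)" for k
  proof -
    have "s k * c k \<le> (s k + 1) * c k" using c[of k] by (intro mult_right_mono) auto
    also have "\<dots> = (e / 2) / (real K0 + 1)" using s[of k] by (simp add: c_def)
    finally show ?thesis .
  qed
  have "\<exists>M. \<forall>P\<in>\<Psi>. lq_le_from q (c k) (\<lambda>n. P (x k n)) M" for k
    using xt[of k] c[of k] by (auto simp: seq_tail_def)
  then obtain J where J: "\<And>k P F. P \<in> \<Psi> \<Longrightarrow> finite F \<Longrightarrow> F \<subseteq> {J k..} \<Longrightarrow> lq_le q (c k) (\<lambda>n. P (x k n)) F"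
    by metis
  \<comment> \<open>Beyond the codes of all pairs with \<open>k < K0\<close> and
    \<open>j < J k\<close>.\<close>
  define M where "M = Suc (Max (insert 0 (prod_encode ` (SIGMA k:{..<K0}. {..<J k}))))"
  have M: "J k \<le> j" if "prod_encode (k, j) \<ge> M" "k < K0" for k j
  proof (rule ccontr)
    assume "\<not> J k \<le> j"
    then have "prod_encode (k, j) \<in> prod_encode ` (SIGMA k:{..<K0}. {..<J k})" using that by auto
    then have "prod_encode (k, j) \<le> Max (insert 0 (prod_encode ` (SIGMA k:{..<K0}. {..<J k})))"
      by (intro Max_ge) auto
    then show False using that by (simp add: M_def)
  qed
  define B' where "B' k = (if k < K0 then c k else B k)" for k
  have B': "0 \<le> B' k" for k using c[of k] B[of k] by (simp add: B'_def)
  show "\<exists>M. \<forall>P\<in>\<Psi>. lq_le_from q e (\<lambda>n. P (direct_sum s x n)) M"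
  proof (intro exI[of _ M] ballI allI impI)
    fix P and F :: "nat set" assume P: "P \<in> \<Psi>" and F: "finite F" "F \<subseteq> {M..}"
    show "lq_le q e (\<lambda>n. P (direct_sum s x n)) F"
    proof (rule direct_sum_rows[where B = B', OF q hom P F(1) s B'])
      fix k
      have fin: "finite {j. prod_encode (k, j) \<in> F}"
        using finite_vimageI[OF F(1), of "\<lambda>j. prod_encode (k, j)"] by (auto simp: inj_on_def vimage_def)
      show "lq_le q (B' k) (\<lambda>j. P (x k j)) {j. prod_encode (k, j) \<in> F}"
      proof (cases "k < K0")
        case True
        then have "{j. prod_encode (k, j) \<in> F} \<subseteq> {J k..}" using F(2) M by auto
        then show ?thesis using J[OF P fin] True by (simp add: B'_def)
      next
        case False
        then show ?thesis using x[of k] P fin by (simp add: B'_def seq_ball_def)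
      qed
    next
      let ?K = "fst ` prod_decode ` F"
      have fK: "finite ?K" using F by simp
      have "lq_le q (e/2) (\<lambda>k. s k * B' k) (?K \<inter> {..<K0})"
      proof (rule lq_le_of_sum[OF q])
        have "(\<Sum>k\<in>?K \<inter> {..<K0}. s k * B' k) \<le> (\<Sum>k\<in>?K \<inter> {..<K0}. (e / 2) / (real K0 + 1))"
          using sc by (intro sum_mono) (auto simp: B'_def)
        also have "\<dots> \<le> (\<Sum>k\<in>{..<K0}. (e / 2) / (real K0 + 1))"
          using e by (intro sum_mono2) auto
        also have "\<dots> \<le> e / 2" using e by (simp add: field_simps)
        finally show "(\<Sum>k\<in>?K \<inter> {..<K0}. s k * B' k) \<le> e / 2" .
      qed (use fK s B' in auto)
      moreover have "lq_le q (e/2) (\<lambda>k. s k * B' k) (?K - {..<K0})"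
      proof (rule lq_le_mono[OF q K0])
        show "finite (?K - {..<K0})" "?K - {..<K0} \<subseteq> {K0..}" using fK by auto
      qed (use e s B in \<open>auto simp: B'_def\<close>)
      ultimately have "lq_le q (e/2 + e/2) (\<lambda>k. s k * B' k) ?K"
        using e fK by (intro lq_le_split[OF q]) auto
      then show "lq_le q e (\<lambda>k. s k * B' k) ?K" by simp
    qed
  qed
qed

subsection \<open>Conjugate exponents\<close>

definition conj_exp :: "ennreal \<Rightarrow> ennreal"
  where "conj_exp p = (if p = 1 then \<infinity> else if p = \<infinity> then 1
    else ennreal (enn2real p / (enn2real p - 1)))"

lemma enn2real_gt_1: "1 \<le> p \<Longrightarrow> p \<noteq> 1 \<Longrightarrow> p \<noteq> \<infinity> \<Longrightarrow> 1 < enn2real p"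
  using enn2real_ge_1[of p] by (cases p) (auto simp: less_le)

lemma conj_exp_ge_1: "1 \<le> p \<Longrightarrow> 1 \<le> conj_exp p"
  using enn2real_gt_1[of p] by (auto simp: conj_exp_def ennreal_1[symmetric] simp del: ennreal_1)

lemma conj_exp_finite: "1 \<le> p \<Longrightarrow> p \<noteq> 1 \<Longrightarrow> conj_exp p \<noteq> \<infinity>"
  by (auto simp: conj_exp_def)

lemma enn2real_conj_exp:
  assumes "1 \<le> p" "p \<noteq> 1" "p \<noteq> \<infinity>"
  shows "enn2real (conj_exp p) = enn2real p / (enn2real p - 1)"
    "1 / enn2real p + 1 / enn2real (conj_exp p) = 1" "enn2real (conj_exp p) > 1"
  using enn2real_gt_1[OF assms] assms by (auto simp: conj_exp_def field_simps)

text \<open>Hoelder's inequality from Young's inequality after division by \<open>r\<close> and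
  \<open>s\<close>. A zero bound admits no such normalization and makes all products vanish
  instead.\<close>

lemma lq_le_holder:
  assumes p: "1 \<le> p" and F: "finite F" and u: "\<And>n. n \<in> F \<Longrightarrow> 0 \<le> u n" and w: "\<And>n. n \<in> F \<Longrightarrow> 0 \<le> w n"
    and r: "0 \<le> r" and s: "0 \<le> s" and lu: "lq_le p r u F" and lw: "lq_le (conj_exp p) s w F"
  shows "(\<Sum>n\<in>F. w n * u n) \<le> s * r"
proof -
  consider "p = 1" | "p = \<infinity>" | "p \<noteq> 1" "p \<noteq> \<infinity>" by blast
  then show ?thesis
  proof cases
    case 1
    have "(\<Sum>n\<in>F. w n * u n) \<le> (\<Sum>n\<in>F. s * u n)"
      using lw u 1 by (intro sum_mono mult_right_mono) (auto simp: lq_le_def conj_exp_def)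
    also have "\<dots> = s * (\<Sum>n\<in>F. u n powr 1)" using u by (simp add: sum_distrib_left)
    also have "\<dots> \<le> s * r" using lu 1 s r by (intro mult_left_mono) (auto simp: lq_le_def)
    finally show ?thesis .
  next
    case 2
    have "(\<Sum>n\<in>F. w n * u n) \<le> (\<Sum>n\<in>F. w n * r)"
      using lu w 2 by (intro sum_mono mult_left_mono) (auto simp: lq_le_def)
    also have "\<dots> = (\<Sum>n\<in>F. w n powr 1) * r" using w by (simp add: sum_distrib_right)
    also have "\<dots> \<le> s * r" using lw 2 s r by (intro mult_right_mono) (auto simp: lq_le_def conj_exp_def)
    finally show ?thesis .
  next
    case 3
    define P where "P = enn2real p"
    define Q where "Q = enn2real (conj_exp p)"
    have PQ: "P > 1" "Q > 1" "1 / P + 1 / Q = 1"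
      using enn2real_gt_1[OF p 3] enn2real_conj_exp[OF p 3] by (auto simp: P_def Q_def)
    have su: "(\<Sum>n\<in>F. u n powr P) \<le> r powr P" using lu 3 by (simp add: lq_le_def P_def)
    have sw: "(\<Sum>n\<in>F. w n powr Q) \<le> s powr Q"
      using lw conj_exp_finite[OF p 3(1)] by (simp add: lq_le_def Q_def)
    show ?thesis
    proof (cases "r = 0 \<or> s = 0")
      case True
      have "w n * u n = 0" if "n \<in> F" for n
        using True
      proof
        assume "r = 0"
        then have "(\<Sum>n\<in>F. u n powr P) \<le> 0" using su PQ by simp
        moreover have "u n powr P \<le> (\<Sum>n\<in>F. u n powr P)"
          by (rule member_le_sum) (use that F in auto)
        ultimately have "u n powr P = 0" using powr_ge_zero[of "u n" P] by linarith
        then show ?thesis by simp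
      next
        assume "s = 0"
        then have "(\<Sum>n\<in>F. w n powr Q) \<le> 0" using sw PQ by simp
        moreover have "w n powr Q \<le> (\<Sum>n\<in>F. w n powr Q)"
          by (rule member_le_sum) (use that F in auto)
        ultimately have "w n powr Q = 0" using powr_ge_zero[of "w n" Q] by linarith
        then show ?thesis by simp
      qed
      then have "(\<Sum>n\<in>F. w n * u n) = 0" by (intro sum.neutral) blast
      then show ?thesis using r s by simp
    next
      case False
      then have rs: "r > 0" "s > 0" using r s by auto
      have "(\<Sum>n\<in>F. (w n / s) * (u n / r)) \<le> (\<Sum>n\<in>F. (w n / s) powr Q / Q + (u n / r) powr P / P)"
        using PQ rs u w by (intro sum_mono Youngs_inequality) auto
      also have "\<dots> = (\<Sum>n\<in>F. w n powr Q) / s powr Q / Q + (\<Sum>n\<in>F. u n powr P) / r powr P / P"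
        using rs u w by (simp add: sum.distrib powr_divide sum_divide_distrib)
      also have "\<dots> \<le> 1 / Q + 1 / P"
        using su sw rs PQ by (intro add_mono divide_right_mono) (auto simp: divide_le_eq)
      also have "\<dots> = 1" using PQ by simp
      finally have "(\<Sum>n\<in>F. w n * u n) / (s * r) \<le> 1" by (simp add: sum_divide_distrib)
      then show ?thesis using rs by (simp add: divide_le_eq)
    qed
  qed
qed

text \<open>Each \<open>A k\<close> is split between a vector \<open>1 / s\<close> in the unit ball
  of the conjugate exponent and a vector \<open>s A\<close> of norm at most \<open>S\<close>.
  Prescribing the conjugate power of \<open>1 / s k\<close> as \<open>t k * A k / S\<close>, whose
  sum is 1, leaves the norm \<open>S\<close> for \<open>s A\<close>. This formula also gives the
  weights at \<open>p = \<infinity>\<close>, where the conjugate exponent is 1; at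
  \<open>p = 1\<close> the weights are \<open>t\<close> itself.\<close>

lemma conj_exp_weights:
  fixes A t :: "nat \<Rightarrow> real"
  assumes p: "1 \<le> p" and A: "\<And>k. A k > 0" and t: "\<And>k. t k \<ge> 1" and lim: "filterlim t at_top sequentially"
    and sums: "(\<lambda>k. t k * A k) sums S"
  obtains s where "\<And>k. s k > 0"
    "\<And>K. finite K \<Longrightarrow> lq_le (conj_exp p) 1 (\<lambda>k. 1 / s k) K"
    "\<And>e. e > 0 \<Longrightarrow> \<exists>M. lq_le_from (conj_exp p) e (\<lambda>k. 1 / s k) M"
    "\<And>K. finite K \<Longrightarrow> lq_le p S (\<lambda>k. s k * A k) K"
    "\<And>e. e > 0 \<Longrightarrow> \<exists>M. lq_le_from p e (\<lambda>k. s k * A k) M"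
proof -
  note q = conj_exp_ge_1[OF p]
  have tA: "0 < t k * A k" for k using A[of k] t[of k] by (intro mult_pos_pos) auto
  have sum_le: "(\<Sum>k\<in>K. t k * A k) \<le> S" if "finite K" for K
    using sum_le_suminf[OF sums_summable[OF sums] that] tA sums_unique[OF sums] by (auto intro: less_imp_le)
  have S: "S > 0" using sum_le[of "{0}"] tA[of 0] by simp
  have inv_t: "\<exists>M. \<forall>k\<ge>M. c / t k \<le> e" if "e > 0" "c > 0" for e c :: real
  proof -
    obtain M where "\<And>k. k \<ge> M \<Longrightarrow> t k \<ge> c / e"
      using lim by (auto simp: filterlim_at_top eventually_sequentially)
    then have "c / t k \<le> e" if "k \<ge> M" for k
      using that \<open>e > 0\<close> \<open>c > 0\<close> t[of k] by (simp add: field_simps)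
    then show ?thesis by blast
  qed
  consider "p = 1" | "p = \<infinity>" | "p \<noteq> 1" "p \<noteq> \<infinity>" by blast
  then show thesis
  proof cases
    case 1
    \<comment> \<open>Here \<open>1 / s\<close> has to be a null sequence bounded by 1, and
      \<open>s A\<close> has to have sum at most \<open>S\<close>; with \<open>s = t\<close> these
      are the hypotheses.\<close>
    show ?thesis
    proof (rule that[of t])
      show "t k > 0" for k using t[of k] by simp
      have "1 / t k \<le> 1" for k using t[of k] by simp
      then show "lq_le (conj_exp p) 1 (\<lambda>k. 1 / t k) K" for K using 1 by (auto simp: lq_le_def conj_exp_def)
      show "\<exists>M. lq_le_from (conj_exp p) e (\<lambda>k. 1 / t k) M" if "e > 0" for e
        using inv_t[OF that zero_less_one] 1 by (fastforce simp: lq_le_def conj_exp_def)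
      show *: "lq_le p S (\<lambda>k. t k * A k) K" if "finite K" for K
        using sum_le[OF that] 1 S tA by (simp add: lq_le_def less_imp_le)
      show "\<exists>M. lq_le_from p e (\<lambda>k. t k * A k) M" if "e > 0" for e
        by (rule lq_le_tail[OF p _ * that]) (use 1 in auto)
    qed
  next
    case 2
    \<comment> \<open>Now the sections of \<open>1 / s\<close> sum to at most 1, and
      \<open>s A = S / t\<close> is null because \<open>t\<close> tends to infinity.\<close>
    define s where "s k = S / (t k * A k)" for k
    have sA: "s k * A k = S / t k" for k using A[of k] by (simp add: s_def)
    show ?thesis
    proof (rule that[of s])
      show "s k > 0" for k using S tA[of k] by (simp add: s_def)
      show *: "lq_le (conj_exp p) 1 (\<lambda>k. 1 / s k) K" if "finite K" for K
        using sum_le[OF that] 2 S tA by (simp add: lq_le_def conj_exp_def s_def less_imp_le flip: sum_divide_distrib)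
      show "\<exists>M. lq_le_from (conj_exp p) e (\<lambda>k. 1 / s k) M" if "e > 0" for e
        by (rule lq_le_tail[OF q _ * that]) (use 2 in \<open>auto simp: conj_exp_def\<close>)
      have "S / t k \<le> S" for k using t[of k] S by (simp add: field_simps)
      then show "lq_le p S (\<lambda>k. s k * A k) K" for K using 2 by (simp add: lq_le_def sA)
      show "\<exists>M. lq_le_from p e (\<lambda>k. s k * A k) M" if "e > 0" for e
        using inv_t[OF that S] 2 by (fastforce simp: lq_le_def sA)
    qed
  next
    case 3
    define P where "P = enn2real p"
    define Q where "Q = enn2real (conj_exp p)"
    have PQ: "P > 1" "Q > 1" "P / Q = P - 1"
      using enn2real_gt_1[OF p 3] enn2real_conj_exp[OF p 3] by (auto simp: P_def Q_def)
    have qfin: "conj_exp p \<noteq> \<infinity>" by (rule conj_exp_finite[OF p 3(1)])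
    define s where "s k = (S / (t k * A k)) powr (1 / Q)" for k
    have pos: "S / (t k * A k) > 0" for k using S tA[of k] by simp
    show ?thesis
    proof (rule that[of s])
      show "s k > 0" for k unfolding s_def using pos[of k] by (subst powr_gt_zero) (rule less_imp_neq[symmetric])
      have invQ: "(1 / s k) powr Q = t k * A k / S" for k
      proof -
        have "(1 / s k) powr Q = 1 / (s k powr Q)" using pos[of k] by (simp add: powr_divide s_def)
        also have "s k powr Q = S / (t k * A k)" using PQ S tA[of k] by (simp add: s_def powr_powr del: zero_less_mult_iff)
        finally show ?thesis by simp
      qed
      show *: "lq_le (conj_exp p) 1 (\<lambda>k. 1 / s k) K" if "finite K" for K
        using sum_le[OF that] qfin S unfolding lq_le_def Q_def[symmetric] invQ
        by (simp flip: sum_divide_distrib)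
      show "\<exists>M. lq_le_from (conj_exp p) e (\<lambda>k. 1 / s k) M" if "e > 0" for e
        by (rule lq_le_tail[OF q qfin * that])
      \<comment> \<open>Since \<open>P / Q = P - 1\<close>, the weight contributes
        \<open>(S / (t k * A k)) powr (P - 1)\<close>; replacing \<open>A k\<close> by the larger
        \<open>t k * A k\<close> collapses the powers.\<close>
      have sAP: "(s k * A k) powr P \<le> S powr (P - 1) * (t k * A k)" for k
      proof -
        have "(s k * A k) powr P = (S / (t k * A k)) powr (P - 1) * A k powr P"
          using PQ pos[of k] A[of k] by (simp add: s_def powr_mult powr_powr)
        also have "\<dots> \<le> (S / (t k * A k)) powr (P - 1) * (t k * A k) powr P"
          using PQ A[of k] t[of k] by (intro mult_left_mono powr_mono2) auto
        also have "\<dots> = S powr (P - 1) * (t k * A k)"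
          using tA[of k] S A[of k] t[of k] by (simp add: powr_divide powr_diff)
        finally show ?thesis .
      qed
      show **: "lq_le p S (\<lambda>k. s k * A k) K" if "finite K" for K
      proof -
        have "(\<Sum>k\<in>K. (s k * A k) powr P) \<le> (\<Sum>k\<in>K. S powr (P - 1) * (t k * A k))"
          by (intro sum_mono sAP)
        also have "\<dots> = S powr (P - 1) * (\<Sum>k\<in>K. t k * A k)" by (simp add: sum_distrib_left)
        also have "\<dots> \<le> S powr (P - 1) * S" using sum_le[OF that] by (intro mult_left_mono) auto
        also have "\<dots> = S powr P" using S by (simp add: powr_diff)
        finally show ?thesis using 3 by (simp add: lq_le_def P_def)
      qed
      show "\<exists>M. lq_le_from p e (\<lambda>k. s k * A k) M" if "e > 0" for e
        by (rule lq_le_tail[OF p 3(2) ** that])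
    qed
  qed
qed

subsection \<open>The sequence spaces in terms of finite sections\<close>

lemma seq_ball_infinity: "seq_ball \<infinity> \<Psi> C x \<longleftrightarrow> (\<forall>P\<in>\<Psi>. \<forall>n. P (x n) \<le> C)"
  unfolding seq_ball_def lq_le_def by (auto dest: spec[of _ "{_}"])

lemma seq_tail_infinity:
  "seq_tail \<infinity> \<Psi> x \<longleftrightarrow> (\<forall>e>0. \<exists>M. \<forall>P\<in>\<Psi>. \<forall>n\<ge>M. P (x n) \<le> e)"
proof -
  have "(\<forall>F. finite F \<longrightarrow> F \<subseteq> {M..} \<longrightarrow> lq_le \<infinity> e (\<lambda>n. P (x n)) F) \<longleftrightarrow> (\<forall>n\<ge>M. P (x n) \<le> e)" for P :: "'a \<Rightarrow> real" and e M
    unfolding lq_le_def by (auto dest: spec[of _ "{_}"])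
  then show ?thesis by (simp add: seq_tail_def)
qed

lemmas seq_infinity =
  seq_ball_infinity seq_ball_infinity[unfolded infinity_ennreal_def]
  seq_tail_infinity seq_tail_infinity[unfolded infinity_ennreal_def]

lemma tendsto_0_iff_le:
  fixes x :: "nat \<Rightarrow> 'a::real_normed_vector"
  shows "x \<longlonglongrightarrow> 0 \<longleftrightarrow> (\<forall>e>0. \<exists>M. \<forall>n\<ge>M. norm (x n) \<le> e)"
proof
  assume "x \<longlonglongrightarrow> 0"
  then show "\<forall>e>0. \<exists>M. \<forall>n\<ge>M. norm (x n) \<le> e"
    unfolding LIMSEQ_iff by (metis diff_zero less_imp_le)
next
  assume *: "\<forall>e>0. \<exists>M. \<forall>n\<ge>M. norm (x n) \<le> e"
  show "x \<longlonglongrightarrow> 0"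
    unfolding LIMSEQ_iff
  proof (intro allI impI)
    fix e :: real assume "e > 0"
    then obtain M where "\<And>n. n \<ge> M \<Longrightarrow> norm (x n) \<le> e / 2" using *[rule_format, of "e/2"] by auto
    then show "\<exists>M. \<forall>n\<ge>M. norm (x n - 0) < e"
      using \<open>e > 0\<close> by (intro exI[of _ M]) (fastforce intro: le_less_trans[of _ "e/2"])
  qed
qed

lemma sup_norm_le_iff:
  assumes "\<And>n. norm (x n) \<le> B"
  shows "sup_norm x \<le> C \<longleftrightarrow> (\<forall>n. norm (x n) \<le> C)"
  unfolding sup_norm_def by (subst cSUP_le_iff) (auto intro!: bdd_aboveI2 assms)

lemma lp_norm_nonneg: "0 \<le> lp_norm q x"
  by (simp add: lp_norm_def)

lemma seq_ball_lp_iff: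
  assumes p: "1 \<le> p" "p \<noteq> \<infinity>" and C: "0 \<le> C"
  shows "seq_ball p {norm} C x \<longleftrightarrow> x \<in> lp (enn2real p) \<and> lp_norm (enn2real p) x \<le> C"
proof -
  define P where "P = enn2real p"
  have P: "P \<ge> 1" using enn2real_ge_1[OF p] by (simp add: P_def)
  have "seq_ball p {norm} C x \<longleftrightarrow> (\<forall>F. finite F \<longrightarrow> (\<Sum>n\<in>F. norm (x n) powr P) \<le> C powr P)"
    using p by (simp add: seq_ball_def lq_le_def P_def)
  also have "\<dots> \<longleftrightarrow> x \<in> lp P \<and> lp_norm P x \<le> C"
  proof
    assume *: "\<forall>F. finite F \<longrightarrow> (\<Sum>n\<in>F. norm (x n) powr P) \<le> C powr P"
    then have sm: "summable (\<lambda>n. norm (x n) powr P)"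
      by (intro summableI_nonneg_bounded[of _ "C powr P"]) auto
    have "(\<Sum>n. norm (x n) powr P) \<le> C powr P" using * by (intro suminf_le_const[OF sm]) auto
    then have "lp_norm P x \<le> (C powr P) powr (1 / P)"
      unfolding lp_norm_def using P suminf_nonneg[OF sm] by (intro powr_mono2) auto
    also have "\<dots> = C" using P C by (simp add: powr_powr)
    finally show "x \<in> lp P \<and> lp_norm P x \<le> C" using sm by (simp add: lp_def)
  next
    assume *: "x \<in> lp P \<and> lp_norm P x \<le> C"
    then have sm: "summable (\<lambda>n. norm (x n) powr P)" by (simp add: lp_def)
    have "(\<Sum>n. norm (x n) powr P) = lp_norm P x powr P"
      unfolding lp_norm_def using P suminf_nonneg[OF sm] by (simp add: powr_powr)
    also have "\<dots> \<le> C powr P" using * P by (intro powr_mono2 lp_norm_nonneg) auto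
    finally show "\<forall>F. finite F \<longrightarrow> (\<Sum>n\<in>F. norm (x n) powr P) \<le> C powr P"
      using sum_le_suminf[OF sm] by (metis (no_types, lifting) order_trans powr_ge_zero)
  qed
  finally show ?thesis by (simp add: P_def)
qed

lemma norm_le_iff_dual_ball: "norm x \<le> c \<longleftrightarrow> (\<forall>\<phi>\<in>dual_ball. cmod (\<phi> x) \<le> c)"
  by (meson dual_ball_bound norm_le_dual_ball order_trans)

definition dual_ball_seminorms :: "('a::complex_normed_vector \<Rightarrow> real) set"
  where "dual_ball_seminorms = (\<lambda>\<phi> x. cmod (\<phi> x)) ` dual_ball"

lemma homogeneous_norm: "homogeneous {norm}"
  by (simp add: homogeneous_def)

lemma homogeneous_dual_ball_seminorms: "homogeneous dual_ball_seminorms"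
  by (auto simp: homogeneous_def dual_ball_seminorms_def scaleR_scaleC norm_mult
      clinear_on_scale[OF dual_ball_clinear])

lemma seq_ball_dual_ball_iff:
  "seq_ball p dual_ball_seminorms C x \<longleftrightarrow> (\<forall>\<phi>\<in>dual_ball. seq_ball p {norm} C (\<lambda>n. \<phi> (x n)))"
  by (simp add: seq_ball_def dual_ball_seminorms_def)

lemma lpw_iff:
  assumes p: "1 \<le> p" "p \<noteq> \<infinity>"
  shows "x \<in> lpw (enn2real p) \<longleftrightarrow> (\<exists>C\<ge>0. seq_ball p dual_ball_seminorms C x)"
proof
  assume x: "x \<in> lpw (enn2real p)"
  then obtain C where C: "\<And>\<phi>. \<phi> \<in> dual_ball \<Longrightarrow> lp_norm (enn2real p) (\<lambda>n. \<phi> (x n)) \<le> C"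
    by (auto simp: lpw_def bdd_above_def)
  have "C \<ge> 0" using order_trans[OF lp_norm_nonneg C[OF zero_in_dual_ball]] .
  then show "\<exists>C\<ge>0. seq_ball p dual_ball_seminorms C x"
    using C x by (auto simp: seq_ball_dual_ball_iff seq_ball_lp_iff[OF p] lpw_def)
next
  assume "\<exists>C\<ge>0. seq_ball p dual_ball_seminorms C x"
  then show "x \<in> lpw (enn2real p)"
    by (auto simp: seq_ball_dual_ball_iff seq_ball_lp_iff[OF p] lpw_def intro!: bdd_aboveI2)
qed

lemma lpw_norm_le_iff:
  assumes p: "1 \<le> p" "p \<noteq> \<infinity>" and x: "x \<in> lpw (enn2real p)" and C: "0 \<le> C"
  shows "lpw_norm (enn2real p) x \<le> C \<longleftrightarrow> seq_ball p dual_ball_seminorms C x"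
proof -
  have "lpw_norm (enn2real p) x \<le> C \<longleftrightarrow> (\<forall>\<phi>\<in>dual_ball. lp_norm (enn2real p) (\<lambda>n. \<phi> (x n)) \<le> C)"
    unfolding lpw_norm_def using x zero_in_dual_ball by (subst cSUP_le_iff) (auto simp: lpw_def)
  then show ?thesis
    using x C by (auto simp: seq_ball_dual_ball_iff seq_ball_lp_iff[OF p] lpw_def)
qed

lemma lpw_norm_nonneg:
  assumes x: "x \<in> lpw q"
  shows "0 \<le> lpw_norm q x"
proof -
  have "bdd_above ((\<lambda>\<phi>. lp_norm q (\<lambda>n. \<phi> (x n))) ` dual_ball)" using x by (simp add: lpw_def)
  from cSUP_upper[OF zero_in_dual_ball this]
  have "lp_norm q (\<lambda>n. 0 :: complex) \<le> lpw_norm q x" by (simp add: lpw_norm_def)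
  then show ?thesis using order_trans[OF lp_norm_nonneg] by blast
qed

text \<open>A shift by \<open>m\<close> carries finite sections onto those inside
  \<open>{m..}\<close>, which translates the tail norms in \<open>lpu\<close>.\<close>

lemma seq_ball_shift:
  assumes q: "1 \<le> q"
  shows "seq_ball q \<Psi> C (\<lambda>n. x (n + m)) \<longleftrightarrow>
    (\<forall>P\<in>\<Psi>. lq_le_from q C (\<lambda>n. P (x n)) m)"
  unfolding seq_ball_def
proof (intro ball_cong refl iffI allI impI)
  fix P and F :: "nat set"
  assume *: "\<forall>F. finite F \<longrightarrow> lq_le q C (\<lambda>n. P (x (n + m))) F" and F: "finite F" "F \<subseteq> {m..}"
  have "lq_le q C (\<lambda>n. P (x (n + m))) ((\<lambda>n. n - m) ` F)" using * F by auto
  then have "lq_le q C (\<lambda>n. P (x n)) ((\<lambda>n. n + m) ` (\<lambda>n. n - m) ` F)"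
    by (subst (asm) lq_le_reindex[OF q, where u = "\<lambda>n. P (x n)"]) auto
  moreover have "(\<lambda>n. n + m) ` (\<lambda>n. n - m) ` F = F" using F(2) by (force simp: image_image)
  ultimately show "lq_le q C (\<lambda>n. P (x n)) F" by simp
next
  fix P and F :: "nat set"
  assume *: "lq_le_from q C (\<lambda>n. P (x n)) m" and F: "finite F"
  have "lq_le q C (\<lambda>n. P (x n)) ((\<lambda>n. n + m) ` F)"
  proof (rule *[rule_format])
    show "finite ((\<lambda>n. n + m) ` F)" using F by simp
    show "(\<lambda>n. n + m) ` F \<subseteq> {m..}" by auto
  qed
  then show "lq_le q C (\<lambda>n. P (x (n + m))) F"
    by (subst lq_le_reindex[OF q, where u = "\<lambda>n. P (x n)"]) auto
qed

lemma lpu_iff: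
  assumes p: "1 \<le> p" "p \<noteq> \<infinity>"
  shows "x \<in> lpu (enn2real p) \<longleftrightarrow> x \<in> lpw (enn2real p) \<and> seq_tail p dual_ball_seminorms x"
proof -
  let ?P = "enn2real p"
  have "(\<lambda>m. lpw_norm ?P (\<lambda>n. x (n + m))) \<longlonglongrightarrow> 0 \<longleftrightarrow> seq_tail p dual_ball_seminorms x"
    if x: "x \<in> lpw ?P"
  proof -
    have sh: "(\<lambda>n. x (n + m)) \<in> lpw ?P" for m
    proof -
      obtain C where "C \<ge> 0" "seq_ball p dual_ball_seminorms C x" using x lpw_iff[OF p] by blast
      then have "seq_ball p dual_ball_seminorms C (\<lambda>n. x (n + m))"
        unfolding seq_ball_shift[OF p(1)] by (simp add: seq_ball_def)
      then show ?thesis using \<open>C \<ge> 0\<close> lpw_iff[OF p] by blast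
    qed
    have le: "lpw_norm ?P (\<lambda>n. x (n + m)) \<le> e \<longleftrightarrow>
      (\<forall>P\<in>dual_ball_seminorms. lq_le_from p e (\<lambda>n. P (x n)) m)"
      if "e > 0" for e m
      using lpw_norm_le_iff[OF p sh, of e m] that unfolding seq_ball_shift[OF p(1)] by simp
    show ?thesis
    proof
      assume lim: "(\<lambda>m. lpw_norm ?P (\<lambda>n. x (n + m))) \<longlonglongrightarrow> 0"
      show "seq_tail p dual_ball_seminorms x"
        unfolding seq_tail_def
      proof (intro allI impI)
        fix e :: real assume e: "e > 0"
        then obtain M where "\<And>n. n \<ge> M \<Longrightarrow> norm (lpw_norm ?P (\<lambda>k. x (k + n))) \<le> e"
          using lim unfolding tendsto_0_iff_le by blast
        from this[of M] have "lpw_norm ?P (\<lambda>n. x (n + M)) \<le> e" by simp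
        then show "\<exists>M. \<forall>P\<in>dual_ball_seminorms. lq_le_from p e (\<lambda>n. P (x n)) M"
          using le[OF e] by blast
      qed
    next
      assume t: "seq_tail p dual_ball_seminorms x"
      show "(\<lambda>m. lpw_norm ?P (\<lambda>n. x (n + m))) \<longlonglongrightarrow> 0"
        unfolding tendsto_0_iff_le
      proof (intro allI impI)
        fix e :: real assume e: "e > 0"
        then obtain M where M: "\<forall>P\<in>dual_ball_seminorms. lq_le_from p e (\<lambda>n. P (x n)) M"
          using t unfolding seq_tail_def by blast
        have "lpw_norm ?P (\<lambda>n. x (n + m)) \<le> e" if "m \<ge> M" for m
          unfolding le[OF e] using M that by (meson atLeast_subset_iff subset_trans)
        then show "\<exists>M. \<forall>n\<ge>M. norm (lpw_norm ?P (\<lambda>k. x (k + n))) \<le> e"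
          using lpw_norm_nonneg[OF sh] by auto
      qed
    qed
  qed
  then show ?thesis by (auto simp: lpu_def)
qed

text \<open>\<open>Kwp\<close> and \<open>Kup\<close> share the weak norm and differ in their tail
  conditions alone. At \<open>p = \<infinity>\<close> the choice does not affect the norm, because
  the dual ball is norming.\<close>

definition kind_seminorms :: "ideal_kind \<Rightarrow> ('a::complex_normed_vector \<Rightarrow> real) set"
  where "kind_seminorms I = (if I = Kp then {norm} else dual_ball_seminorms)"

text \<open>A bounded sequence lies in \<open>seq_space I p\<close> iff its tails are small uniformly on each of these
  families. The families are singletons for \<open>Kwp\<close>, where nothing is uniform.\<close>

definition tail_families :: "ideal_kind \<Rightarrow> ('a::complex_normed_vector \<Rightarrow> real) set set"
  where "tail_families I = (if I = Kwp then (\<lambda>P. {P}) ` kind_seminorms I else {kind_seminorms I})"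

lemma homogeneous_kind_seminorms: "homogeneous (kind_seminorms I)"
  by (simp add: kind_seminorms_def homogeneous_norm homogeneous_dual_ball_seminorms)

lemma tail_families_subset: "\<Psi> \<in> tail_families I \<Longrightarrow> \<Psi> \<subseteq> kind_seminorms I"
  by (auto simp: tail_families_def split: if_splits)

lemma homogeneous_subset: "homogeneous \<Psi> \<Longrightarrow> \<Psi>' \<subseteq> \<Psi> \<Longrightarrow> homogeneous \<Psi>'"
  by (auto simp: homogeneous_def)

lemma seq_ball_subset: "seq_ball q \<Psi> r x \<Longrightarrow> \<Psi>' \<subseteq> \<Psi> \<Longrightarrow> seq_ball q \<Psi>' r x"
  by (auto simp: seq_ball_def)

lemma seq_tail_single:
  assumes "1 \<le> q" "q \<noteq> \<infinity>" "seq_ball q {P} r x"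
  shows "seq_tail q {P} x"
  using lq_le_tail[OF assms(1,2), of r "\<lambda>n. P (x n)"] assms(3) by (simp add: seq_tail_def seq_ball_def)

lemma seq_ball_dual_ball_infinity:
  "seq_ball \<infinity> dual_ball_seminorms C x \<longleftrightarrow> (\<forall>n. norm (x n) \<le> C)"
proof -
  have "norm (x n) \<le> C \<longleftrightarrow> (\<forall>\<phi>\<in>dual_ball. cmod (\<phi> (x n)) \<le> C)" for n
    by (rule norm_le_iff_dual_ball)
  then show ?thesis by (auto simp: seq_infinity dual_ball_seminorms_def)
qed

lemma seq_tail_dual_ball_infinity: "seq_tail \<infinity> dual_ball_seminorms x \<longleftrightarrow> x \<longlonglongrightarrow> 0"
proof -
  have "(\<forall>P\<in>dual_ball_seminorms. \<forall>n\<ge>M. P (x n) \<le> e) \<longleftrightarrow> (\<forall>n\<ge>M. norm (x n) \<le> e)" for M e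
  proof -
    have "norm (x n) \<le> e \<longleftrightarrow> (\<forall>\<phi>\<in>dual_ball. cmod (\<phi> (x n)) \<le> e)" for n
      by (rule norm_le_iff_dual_ball)
    then show ?thesis by (auto simp: dual_ball_seminorms_def)
  qed
  then show ?thesis by (simp add: seq_infinity tendsto_0_iff_le)
qed

lemmas dual_ball_infinity =
  seq_ball_dual_ball_infinity seq_ball_dual_ball_infinity[unfolded infinity_ennreal_def]
  seq_tail_dual_ball_infinity seq_tail_dual_ball_infinity[unfolded infinity_ennreal_def]

lemma c0w_iff: "x \<in> c0w \<longleftrightarrow> (\<forall>P\<in>dual_ball_seminorms. seq_tail \<infinity> {P} x)"
proof -
  have "x \<in> c0w \<longleftrightarrow> (\<forall>\<phi>\<in>dual_ball. (\<lambda>n. \<phi> (x n)) \<longlonglongrightarrow> 0)"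
  proof
    assume "x \<in> c0w"
    then show "\<forall>\<phi>\<in>dual_ball. (\<lambda>n. \<phi> (x n)) \<longlonglongrightarrow> 0"
      by (auto simp: c0w_def dual_ball_def unit_ball_def)
  next
    assume *: "\<forall>\<phi>\<in>dual_ball. (\<lambda>n. \<phi> (x n)) \<longlonglongrightarrow> 0"
    show "x \<in> c0w"
      unfolding c0w_def
    proof (intro CollectI ballI)
      fix \<phi> :: "'a \<Rightarrow> complex" assume "\<phi> \<in> dual UNIV norm"
      then obtain c \<psi> where "\<psi> \<in> dual_ball" "\<phi> = (\<lambda>x. complex_of_real c * \<psi> x)"
        by (rule dual_eq_scaled_dual_ball)
      then show "(\<lambda>n. \<phi> (x n)) \<longlonglongrightarrow> 0" using * by (auto intro: tendsto_mult_right_zero)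
    qed
  qed
  then show ?thesis by (simp add: dual_ball_seminorms_def seq_infinity tendsto_0_iff_le)
qed

text \<open>One description by balls and tails for all three kinds and all \<open>p\<close>, so that
  the later estimates need no distinction by kind.\<close>

lemma seq_space_norm:
  fixes x :: "nat \<Rightarrow> 'a::complex_normed_vector"
  assumes p: "1 \<le> p"
  shows seq_space_iff: "x \<in> seq_space I p \<longleftrightarrow>
      (\<exists>C\<ge>0. seq_ball p (kind_seminorms I) C x) \<and> (\<forall>\<Psi>\<in>tail_families I. seq_tail p \<Psi> x)"
    and seq_norm_le_iff: "x \<in> seq_space I p \<Longrightarrow> 0 \<le> C \<Longrightarrow>
      seq_norm I p x \<le> C \<longleftrightarrow> seq_ball p (kind_seminorms I) C x"
    and seq_norm_nonneg: "x \<in> seq_space I p \<Longrightarrow> 0 \<le> seq_norm I p x"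
proof -
  have bdd: "\<exists>C\<ge>0. \<forall>n. norm (x n) \<le> C" if "\<exists>C. \<forall>n. norm (x n) \<le> C" for x :: "nat \<Rightarrow> 'a"
    using that order_trans[OF norm_ge_zero] by blast
  have c0_bdd: "\<exists>C\<ge>0. \<forall>n. norm (x n) \<le> C" if "x \<longlonglongrightarrow> 0"
    using convergent_imp_bounded[OF that] by (intro bdd) (auto simp: bounded_iff)
  \<comment> \<open>The supremum of an unbounded set of reals is an unspecified value, so
    boundedness has to be known first; for weakly null sequences it is the uniform boundedness
    principle.\<close>
  have c0w_bdd: "\<exists>C\<ge>0. \<forall>n. norm (x n) \<le> C" if "x \<in> c0w"
    using that by (intro bdd weakly_null_bounded) (auto simp: c0w_def dual_ball_def unit_ball_def)
  have sup: "(sup_norm x \<le> C \<longleftrightarrow> (\<forall>n. norm (x n) \<le> C)) \<and> 0 \<le> sup_norm x"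
    if B: "\<exists>B\<ge>0. \<forall>n. norm (x n) \<le> B" for C
  proof -
    obtain B where B: "\<And>n. norm (x n) \<le> B" using B by blast
    have "norm (x 0) \<le> sup_norm x" using sup_norm_le_iff[where x = x, OF B, of "sup_norm x"] by simp
    then show ?thesis using sup_norm_le_iff[where x = x, OF B] order_trans[OF norm_ge_zero] by blast
  qed
  have "(x \<in> seq_space I p \<longleftrightarrow>
      (\<exists>C\<ge>0. seq_ball p (kind_seminorms I) C x) \<and> (\<forall>\<Psi>\<in>tail_families I. seq_tail p \<Psi> x)) \<and>
    (x \<in> seq_space I p \<longrightarrow> (\<forall>C\<ge>0. seq_norm I p x \<le> C \<longleftrightarrow> seq_ball p (kind_seminorms I) C x) \<and>
      0 \<le> seq_norm I p x)"
  proof (cases "p = \<infinity>")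
    case True
    have sp: "(seq_space I p :: (nat \<Rightarrow> 'a) set) = (if I = Kwp then c0w else c0)"
      and nm: "seq_norm I p x = sup_norm x"
      using True by (cases I; simp)+
    have ball: "seq_ball p (kind_seminorms I) C x \<longleftrightarrow> (\<forall>n. norm (x n) \<le> C)" for C
      using True by (cases "I = Kp") (simp_all add: kind_seminorms_def dual_ball_infinity, simp add: seq_infinity)
    have bd: "\<exists>C\<ge>0. \<forall>n. norm (x n) \<le> C" if "x \<in> seq_space I p"
      using that c0_bdd c0w_bdd unfolding sp by (auto simp: c0_def split: if_splits)
    have tail: "(\<forall>\<Psi>\<in>tail_families I. seq_tail p \<Psi> x) \<longleftrightarrow> x \<in> seq_space I p"
    proof (cases "I = Kwp")
      case I: True
      then show ?thesis unfolding sp by (simp add: tail_families_def kind_seminorms_def c0w_iff True)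
    next
      case False
      have "seq_tail \<infinity> {norm} x \<longleftrightarrow> x \<longlonglongrightarrow> 0" by (simp add: seq_infinity tendsto_0_iff_le)
      then show ?thesis unfolding sp using False
        by (simp add: tail_families_def kind_seminorms_def c0_def True seq_tail_dual_ball_infinity
            del: infinity_ennreal_def)
    qed
    show ?thesis unfolding ball nm tail using bd sup by blast
  next
    case False
    note lpw = lpw_iff[OF p False, of x] lpw_norm_le_iff[OF p False, of x]
    show ?thesis
    proof (cases I)
      case Kp
      have 1: "x \<in> lp (enn2real p) \<longleftrightarrow> (\<exists>C\<ge>0. seq_ball p {norm} C x)"
        using seq_ball_lp_iff[OF p False, of _ x] lp_norm_nonneg[of "enn2real p" x] by blast
      have "seq_tail p {norm} x" if "x \<in> lp (enn2real p)"
        using that 1 seq_tail_single[OF p False] by blast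
      then show ?thesis
        using Kp False 1 seq_ball_lp_iff[OF p False, of _ x] lp_norm_nonneg[of "enn2real p" x]
        by (auto simp: kind_seminorms_def tail_families_def)
    next
      case Kwp
      have "seq_tail p {P} x" if "x \<in> lpw (enn2real p)" "P \<in> dual_ball_seminorms" for P
        using that lpw(1) seq_tail_single[OF p False] seq_ball_subset[of p dual_ball_seminorms _ x "{P}"]
        by blast
      then show ?thesis
        using Kwp False lpw lpw_norm_nonneg[of x "enn2real p"]
        by (auto simp: kind_seminorms_def tail_families_def)
    next
      case Kup
      then show ?thesis
        using False lpw lpw_norm_nonneg[of x "enn2real p"]
        by (auto simp: kind_seminorms_def tail_families_def lpu_iff[OF p False])
    qed
  qed
  then show "x \<in> seq_space I p \<longleftrightarrow>
      (\<exists>C\<ge>0. seq_ball p (kind_seminorms I) C x) \<and> (\<forall>\<Psi>\<in>tail_families I. seq_tail p \<Psi> x)"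
    "x \<in> seq_space I p \<Longrightarrow> 0 \<le> C \<Longrightarrow> seq_norm I p x \<le> C \<longleftrightarrow> seq_ball p (kind_seminorms I) C x"
    "x \<in> seq_space I p \<Longrightarrow> 0 \<le> seq_norm I p x"
    by blast+
qed

text \<open>For \<open>p = 1\<close> the conjugate exponent is \<open>\<infinity>\<close> and the
  tail condition expresses membership in \<open>c0\<close>; for every other \<open>p\<close> the
  conjugate exponent is finite and small tails are automatic.\<close>

lemma coeff_ball_iff:
  assumes p: "1 \<le> p"
  shows "a \<in> coeff_ball p \<longleftrightarrow> seq_ball (conj_exp p) {norm} 1 a \<and> seq_tail (conj_exp p) {norm} a"
proof (cases "p = 1")
  case True
  show ?thesis
  proof (cases "\<exists>B. \<forall>n. norm (a n) \<le> B")
    case B: True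
    then have "sup_norm a \<le> 1 \<longleftrightarrow> (\<forall>n. norm (a n) \<le> 1)" using sup_norm_le_iff[of a] by blast
    then show ?thesis
      using True by (auto simp: coeff_ball_def conj_exp_def unit_ball_def c0_def seq_infinity tendsto_0_iff_le)
  next
    case False
    \<comment> \<open>The \<open>sup_norm\<close> of an unbounded \<open>a\<close> is unspecified,
      but both sides fail anyway: \<open>a\<close> is not null and no ball contains it.\<close>
    then have "\<not> a \<longlonglongrightarrow> 0" using convergent_imp_bounded[of a 0] by (auto simp: bounded_iff)
    then show ?thesis
      using True False by (auto simp: coeff_ball_def conj_exp_def unit_ball_def c0_def seq_infinity)
  qed
next
  case False
  note q = conj_exp_ge_1[OF p] conj_exp_finite[OF p False]
  have "a \<in> coeff_ball p \<longleftrightarrow> seq_ball (conj_exp p) {norm} 1 a"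
    unfolding seq_ball_lp_iff[OF q zero_le_one]
    using False enn2real_gt_1[OF p False]
    by (auto simp: coeff_ball_def conj_exp_def unit_ball_def Let_def)
  then show ?thesis using seq_tail_single[OF q] by blast
qed

subsection \<open>\<open>p\<close>-convex hulls\<close>

text \<open>Every one of the three norms dominates the weak one. The weak bound is what convergence
  of the series and the norm estimates on hulls use.\<close>

lemma seq_space_weak_ball:
  fixes x :: "nat \<Rightarrow> 'a::complex_normed_vector"
  assumes p: "1 \<le> p" and x: "x \<in> seq_space I p"
  shows "seq_ball p dual_ball_seminorms (seq_norm I p x) x"
proof -
  have N: "0 \<le> seq_norm I p x" by (rule seq_norm_nonneg[OF p x])
  have *: "seq_ball p (kind_seminorms I) (seq_norm I p x) x"
    using seq_norm_le_iff[OF p x N] by simp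
  show ?thesis
  proof (cases "I = Kp")
    case True
    show ?thesis
      unfolding seq_ball_def dual_ball_seminorms_def
    proof (intro ballI allI impI)
      fix P and F :: "nat set" assume P: "P \<in> (\<lambda>\<phi> (x :: 'a). cmod (\<phi> x)) ` dual_ball" and F: "finite F"
      have "lq_le p (seq_norm I p x) (\<lambda>n. norm (x n)) F"
        using * F True by (simp add: seq_ball_def kind_seminorms_def)
      then show "lq_le p (seq_norm I p x) (\<lambda>n. P (x n)) F"
        by (rule lq_le_mono[OF p]) (use N P dual_ball_bound in auto)
    qed
  qed (use * in \<open>simp add: kind_seminorms_def\<close>)
qed

lemma coeff_sum_le:
  assumes p: "1 \<le> p" and x: "x \<in> seq_space I p" and \<phi>: "\<phi> \<in> dual_ball" and F: "finite F"
    and e: "0 \<le> e" and a: "lq_le (conj_exp p) e (\<lambda>n. cmod (a n)) F"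
  shows "(\<Sum>n\<in>F. cmod (a n * \<phi> (x n))) \<le> e * seq_norm I p x"
proof -
  have "lq_le p (seq_norm I p x) (\<lambda>n. cmod (\<phi> (x n))) F"
    using seq_space_weak_ball[OF p x] \<phi> F by (simp add: seq_ball_def dual_ball_seminorms_def)
  then have "(\<Sum>n\<in>F. cmod (a n) * cmod (\<phi> (x n))) \<le> e * seq_norm I p x"
    by (intro lq_le_holder[OF p F _ _ seq_norm_nonneg[OF p x] e _ a]) auto
  then show ?thesis by (simp add: norm_mult)
qed

lemma dual_ball_combination:
  assumes "\<phi> \<in> dual_ball"
  shows "\<phi> (\<Sum>n\<in>F. a n *\<^sub>C x n) = (\<Sum>n\<in>F. a n * \<phi> (x n))"
  using clinear_on_scale[OF dual_ball_clinear[OF assms]]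
  by (simp add: linear_sum[OF bounded_linear.linear[OF dual_ball_bounded_linear[OF assms]]])

lemma coeff_ball_tail:
  assumes "1 \<le> p" "a \<in> coeff_ball p" "e > 0"
  shows "\<exists>M. lq_le_from (conj_exp p) e (\<lambda>n. cmod (a n)) M"
  using assms(2,3) unfolding coeff_ball_iff[OF assms(1)] seq_tail_def by simp

text \<open>Hoelder's inequality after applying a functional, uniformly over the dual ball: a small
  tail of coefficients against the weak norm of \<open>x\<close>. For \<open>p = 1\<close> the
  restriction to null coefficients enters here.\<close>

lemma coeff_summable:
  fixes x :: "nat \<Rightarrow> 'a::cbanach"
  assumes p: "1 \<le> p" and x: "x \<in> seq_space I p" and a: "a \<in> coeff_ball p"
  shows "summable (\<lambda>n. a n *\<^sub>C x n)"
  unfolding summable_Cauchy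
proof (intro allI impI)
  fix e :: real assume e: "e > 0"
  define N where "N = seq_norm I p x"
  have N: "N \<ge> 0" unfolding N_def by (rule seq_norm_nonneg[OF p x])
  define d where "d = e / (2 * (N + 1))"
  have d: "d > 0" using e N by (simp add: d_def)
  have "d * N \<le> d * (N + 1)" using d by simp
  also have "\<dots> = e / 2" using N by (simp add: d_def divide_simps)
  finally have dN: "d * N < e" using e by simp
  obtain M where M: "\<And>F. finite F \<Longrightarrow> F \<subseteq> {M..} \<Longrightarrow> lq_le (conj_exp p) d (\<lambda>n. cmod (a n)) F"
    using coeff_ball_tail[OF p a d] by blast
  have "norm (\<Sum>k = m..<n. a k *\<^sub>C x k) < e" if m: "m \<ge> M" for m n
  proof (rule le_less_trans[OF norm_le_dual_ball dN])
    fix \<phi> :: "'a \<Rightarrow> complex" assume \<phi>: "\<phi> \<in> dual_ball"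
    have "cmod (\<phi> (\<Sum>k = m..<n. a k *\<^sub>C x k)) \<le> (\<Sum>k = m..<n. cmod (a k * \<phi> (x k)))"
      unfolding dual_ball_combination[OF \<phi>] by (rule norm_sum)
    also have "\<dots> \<le> d * N"
      unfolding N_def using m d by (intro coeff_sum_le[OF p x \<phi>] M) auto
    finally show "cmod (\<phi> (\<Sum>k = m..<n. a k *\<^sub>C x k)) \<le> d * N" .
  qed
  then show "\<exists>M. \<forall>m\<ge>M. \<forall>n. norm (\<Sum>k = m..<n. a k *\<^sub>C x k) < e" by blast
qed

text \<open>After a functional is applied the series converges absolutely. The form
  \<open>has_sum\<close> permits regrouping its terms along the pairing of indices.\<close>

lemma coeff_functional:
  fixes x :: "nat \<Rightarrow> 'a::complex_normed_vector"
  assumes p: "1 \<le> p" and x: "x \<in> seq_space I p" and a: "a \<in> coeff_ball p"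
    and y: "(\<lambda>n. a n *\<^sub>C x n) sums y" and \<phi>: "\<phi> \<in> dual_ball"
  shows "((\<lambda>n. a n * \<phi> (x n)) has_sum \<phi> y) UNIV" "cmod (\<phi> y) \<le> seq_norm I p x"
proof -
  have le: "(\<Sum>n\<in>F. cmod (a n * \<phi> (x n))) \<le> seq_norm I p x" if "finite F" for F
    using coeff_sum_le[OF p x \<phi> that zero_le_one] a that unfolding coeff_ball_iff[OF p]
    by (simp add: seq_ball_def)
  have abs: "summable (\<lambda>n. cmod (a n * \<phi> (x n)))"
    by (rule summableI_nonneg_bounded) (auto intro: le)
  have sums: "(\<lambda>n. a n * \<phi> (x n)) sums \<phi> y"
    using bounded_linear.sums[OF dual_ball_bounded_linear[OF \<phi>] y]
    by (simp add: clinear_on_scale[OF dual_ball_clinear[OF \<phi>]])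
  show "((\<lambda>n. a n * \<phi> (x n)) has_sum \<phi> y) UNIV" by (rule norm_summable_imp_has_sum[OF abs sums])
  have "cmod (\<phi> y) \<le> (\<Sum>n. cmod (a n * \<phi> (x n)))"
    unfolding sums_unique[OF sums] by (rule summable_norm[OF abs])
  also have "\<dots> \<le> seq_norm I p x" by (rule suminf_le_const[OF abs le]) simp
  finally show "cmod (\<phi> y) \<le> seq_norm I p x" .
qed

lemma pconv_norm_le:
  fixes x :: "nat \<Rightarrow> 'a::complex_normed_vector"
  assumes p: "1 \<le> p" and x: "x \<in> seq_space I p" and y: "y \<in> pconv p x"
  shows "norm y \<le> seq_norm I p x"
proof -
  obtain a where a: "a \<in> coeff_ball p" "(\<lambda>n. a n *\<^sub>C x n) sums y" using y by (auto simp: pconv_def)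
  show ?thesis by (rule norm_le_dual_ball[OF coeff_functional(2)[OF p x a]])
qed

lemma zero_in_pconv: 
  assumes p: "1 \<le> p"
  shows "0 \<in> pconv p x"
proof -
  have "lq_le (conj_exp p) r (\<lambda>n. cmod 0) F" if "r \<ge> 0" for F :: "nat set" and r
    using that by (simp add: lq_le_def)
  then have "(\<lambda>_. 0) \<in> coeff_ball p"
    unfolding coeff_ball_iff[OF p] by (auto simp: seq_ball_def seq_tail_def)
  then show ?thesis by (auto simp: pconv_def intro!: bexI[of _ "\<lambda>_. 0"])
qed

lemma coeff_ball_convex:
  assumes p: "1 \<le> p" and a: "a \<in> coeff_ball p" and b: "b \<in> coeff_ball p"
    and cd: "cmod c + cmod d \<le> 1"
  shows "(\<lambda>n. c * a n + d * b n) \<in> coeff_ball p"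
proof -
  have le: "lq_le (conj_exp p) r (\<lambda>n. cmod (c * a n + d * b n)) F"
    if "lq_le (conj_exp p) r (\<lambda>n. cmod (a n)) F" "lq_le (conj_exp p) r (\<lambda>n. cmod (b n)) F" "r \<ge> 0" for r F
  proof (rule lq_le_mono[OF conj_exp_ge_1[OF p]])
    show "lq_le (conj_exp p) r (\<lambda>n. cmod c * cmod (a n) + cmod d * cmod (b n)) F"
      using that cd by (intro lq_le_convex[OF conj_exp_ge_1[OF p]]) auto
    show "0 \<le> cmod (c * a n + d * b n) \<and> cmod (c * a n + d * b n) \<le> cmod c * cmod (a n) + cmod d * cmod (b n)" for n
      using norm_triangle_ineq[of "c * a n" "d * b n"] by (simp add: norm_mult)
  qed (use that in auto)
  have "\<exists>M. lq_le_from (conj_exp p) e (\<lambda>n. cmod (c * a n + d * b n)) M"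
    if e: "e > 0" for e
  proof -
    obtain M where M: "\<And>F. finite F \<Longrightarrow> F \<subseteq> {M..} \<Longrightarrow> lq_le (conj_exp p) e (\<lambda>n. cmod (a n)) F"
      using coeff_ball_tail[OF p a e] by blast
    obtain M' where M': "\<And>F. finite F \<Longrightarrow> F \<subseteq> {M'..} \<Longrightarrow> lq_le (conj_exp p) e (\<lambda>n. cmod (b n)) F"
      using coeff_ball_tail[OF p b e] by blast
    have "lq_le (conj_exp p) e (\<lambda>n. cmod (c * a n + d * b n)) F"
      if F: "finite F" "F \<subseteq> {max M M'..}" for F
    proof -
      have "F \<subseteq> {M..}" "F \<subseteq> {M'..}" using F(2) by auto
      then show ?thesis using e by (intro le M M' F(1)) auto
    qed
    then show ?thesis by blast
  qed
  then show ?thesis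
    using a b le[of 1] unfolding coeff_ball_iff[OF p] seq_ball_def seq_tail_def by simp
qed

lemma pconv_convex:
  assumes p: "1 \<le> p" and y: "y \<in> pconv p x" and z: "z \<in> pconv p x" and cd: "cmod c + cmod d \<le> 1"
  shows "c *\<^sub>C y + d *\<^sub>C z \<in> pconv p x"
proof -
  obtain a b where ab: "a \<in> coeff_ball p" "(\<lambda>n. a n *\<^sub>C x n) sums y" "b \<in> coeff_ball p" "(\<lambda>n. b n *\<^sub>C x n) sums z"
    using y z by (auto simp: pconv_def)
  have "(\<lambda>n. c *\<^sub>C a n *\<^sub>C x n + d *\<^sub>C b n *\<^sub>C x n) sums (c *\<^sub>C y + d *\<^sub>C z)"
    by (intro sums_add bounded_linear.sums[OF bounded_linear_scaleC] ab)
  then have "(\<lambda>n. (c * a n + d * b n) *\<^sub>C x n) sums (c *\<^sub>C y + d *\<^sub>C z)"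
    by (simp add: scaleC_scaleC scaleC_add_left)
  then show ?thesis using coeff_ball_convex[OF p ab(1,3) cd] by (auto simp: pconv_def)
qed

lemma pconv_scale: "y \<in> pconv p x \<Longrightarrow> c *\<^sub>C y \<in> pconv p (\<lambda>n. c *\<^sub>C x n)"
proof -
  assume "y \<in> pconv p x"
  then obtain a where a: "a \<in> coeff_ball p" "(\<lambda>n. a n *\<^sub>C x n) sums y" by (auto simp: pconv_def)
  have "(\<lambda>n. c *\<^sub>C a n *\<^sub>C x n) sums (c *\<^sub>C y)" by (rule bounded_linear.sums[OF bounded_linear_scaleC a(2)])
  then have "(\<lambda>n. a n *\<^sub>C c *\<^sub>C x n) sums (c *\<^sub>C y)" by (simp add: scaleC_scaleC mult.commute)
  then show ?thesis using a(1) by (auto simp: pconv_def)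
qed

lemma kind_seminorms_scaleC: "P \<in> kind_seminorms I \<Longrightarrow> P (c *\<^sub>C x) = cmod c * P x"
  by (auto simp: kind_seminorms_def dual_ball_seminorms_def norm_scaleC norm_mult
      clinear_on_scale[OF dual_ball_clinear] split: if_splits)

lemma seq_space_scale:
  assumes p: "1 \<le> p" and x: "x \<in> seq_space I p"
  shows "(\<lambda>n. c *\<^sub>C x n) \<in> seq_space I p" "seq_norm I p (\<lambda>n. c *\<^sub>C x n) \<le> cmod c * seq_norm I p x"
proof -
  have N: "0 \<le> seq_norm I p x" by (rule seq_norm_nonneg[OF p x])
  have sc: "lq_le p (cmod c * r) (\<lambda>n. P (c *\<^sub>C x n)) F"
    if "P \<in> kind_seminorms I" "lq_le p r (\<lambda>n. P (x n)) F" "r \<ge> 0" for P r F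
    unfolding kind_seminorms_scaleC[OF that(1)]
    using that homogeneous_kind_seminorms by (intro lq_le_scale[OF p]) (auto simp: homogeneous_def)
  have ball: "seq_ball p (kind_seminorms I) (cmod c * seq_norm I p x) (\<lambda>n. c *\<^sub>C x n)"
    using seq_norm_le_iff[OF p x N] N by (auto simp: seq_ball_def intro!: sc)
  have "seq_tail p \<Psi> (\<lambda>n. c *\<^sub>C x n)" if \<Psi>: "\<Psi> \<in> tail_families I" for \<Psi>
    unfolding seq_tail_def
  proof (intro allI impI)
    fix e :: real assume e: "e > 0"
    define d where "d = e / (cmod c + 1)"
    have cp: "cmod c + 1 > 0" by (simp add: add_nonneg_pos)
    have d: "d > 0" using e cp by (simp add: d_def)
    have cd: "cmod c * d \<le> e"
    proof -
      have "cmod c * d \<le> (cmod c + 1) * d" using d by simp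
      then show ?thesis using cp by (simp add: d_def)
    qed
    have "seq_tail p \<Psi> x" using x \<Psi> seq_space_iff[OF p, of x I] by blast
    then obtain M where M: "\<And>P F. P \<in> \<Psi> \<Longrightarrow> finite F \<Longrightarrow> F \<subseteq> {M..} \<Longrightarrow> lq_le p d (\<lambda>n. P (x n)) F"
      using d unfolding seq_tail_def by meson
    have "lq_le p e (\<lambda>n. P (c *\<^sub>C x n)) F" if "P \<in> \<Psi>" "finite F" "F \<subseteq> {M..}" for P F
    proof (rule lq_le_mono[OF p sc])
      show "P \<in> kind_seminorms I" using tail_families_subset[OF \<Psi>] that(1) by blast
      then show "0 \<le> P (c *\<^sub>C x n) \<and> P (c *\<^sub>C x n) \<le> P (c *\<^sub>C x n)" for n
        using homogeneous_kind_seminorms by (auto simp: homogeneous_def)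
    qed (use M that d cd in auto)
    then show "\<exists>M. \<forall>P\<in>\<Psi>. lq_le_from p e (\<lambda>n. P (c *\<^sub>C x n)) M" by blast
  qed
  then show mem: "(\<lambda>n. c *\<^sub>C x n) \<in> seq_space I p"
    unfolding seq_space_iff[OF p] using ball N by (meson mult_nonneg_nonneg norm_ge_zero)
  show "seq_norm I p (\<lambda>n. c *\<^sub>C x n) \<le> cmod c * seq_norm I p x"
    using seq_norm_le_iff[OF p mem, of "cmod c * seq_norm I p x"] ball N by simp
qed

text \<open>The \<open>k\<close>-th sequence is multiplied by a weight \<open>s k\<close> and its coefficients by \<open>1 / s k\<close>. The
  weights of \<open>conj_exp_weights\<close> keep the constant \<open>S\<close> sharp; the factors \<open>t k\<close> make the tails small
  at the two end points.\<close>

theorem pconv_countable_sum: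
  fixes x :: "nat \<Rightarrow> nat \<Rightarrow> 'a::cbanach"
  assumes p: "1 \<le> p" and A: "\<And>k. A k > 0" and t: "\<And>k. t k \<ge> 1" "filterlim t at_top sequentially"
    and S: "(\<lambda>k. t k * A k) sums S"
    and x: "\<And>k. x k \<in> seq_space I p" "\<And>k. seq_norm I p (x k) \<le> A k"
  obtains z where "z \<in> seq_space I p" "seq_norm I p z \<le> S"
    "\<And>y w. (\<And>k. y k \<in> pconv p (x k)) \<Longrightarrow> y sums w \<Longrightarrow> w \<in> pconv p z"
proof -
  note q = conj_exp_ge_1[OF p]
  have S0: "S \<ge> 0"
    using sums_le[OF _ sums_zero S] A t(1) by (meson less_imp_le mult_nonneg_nonneg order_trans zero_le_one)
  obtain s where s: "\<And>k. s k > 0"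
    "\<And>K. finite K \<Longrightarrow> lq_le (conj_exp p) 1 (\<lambda>k. 1 / s k) K"
    "\<And>e. e > 0 \<Longrightarrow> \<exists>M. lq_le_from (conj_exp p) e (\<lambda>k. 1 / s k) M"
    "\<And>K. finite K \<Longrightarrow> lq_le p S (\<lambda>k. s k * A k) K"
    "\<And>e. e > 0 \<Longrightarrow> \<exists>M. lq_le_from p e (\<lambda>k. s k * A k) M"
    using conj_exp_weights[OF p A t S] by blast
  define z where "z = direct_sum s x"
  have s0: "0 \<le> s k" "0 \<le> A k" "0 \<le> 1 / s k" for k using s(1)[of k] A[of k] by auto
  have xball: "seq_ball p (kind_seminorms I) (A k) (x k)" for k
    using seq_norm_le_iff[OF p x(1) s0(2)] x(2) by blast
  have zball: "seq_ball p (kind_seminorms I) S z"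
    unfolding z_def by (rule direct_sum_ball[where B = A, OF p homogeneous_kind_seminorms s0(1,2) xball s(4)])
  have "seq_tail p \<Psi> z" if \<Psi>: "\<Psi> \<in> tail_families I" for \<Psi>
    unfolding z_def
  proof (rule direct_sum_tail[where B = A, OF p _ s0(1,2) _ _ s(5)])
    show "homogeneous \<Psi>" by (rule homogeneous_subset[OF homogeneous_kind_seminorms tail_families_subset[OF \<Psi>]])
    show "seq_ball p \<Psi> (A k) (x k)" for k by (rule seq_ball_subset[OF xball tail_families_subset[OF \<Psi>]])
    show "seq_tail p \<Psi> (x k)" for k using x(1) \<Psi> seq_space_iff[OF p] by blast
  qed
  then have z: "z \<in> seq_space I p" using zball S0 unfolding seq_space_iff[OF p] by blast
  have zn: "seq_norm I p z \<le> S" using seq_norm_le_iff[OF p z S0] zball by blast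
  have "w \<in> pconv p z" if y: "\<And>k. y k \<in> pconv p (x k)" and w: "y sums w" for y w
  proof -
    have "\<exists>b. \<forall>k. b k \<in> coeff_ball p \<and> (\<lambda>n. b k n *\<^sub>C x k n) sums y k"
      by (intro choice allI) (use y in \<open>auto simp: pconv_def\<close>)
    then obtain b where b: "\<And>k. b k \<in> coeff_ball p" "\<And>k. (\<lambda>n. b k n *\<^sub>C x k n) sums y k" by blast
    \<comment> \<open>The inverse weights cancel those in \<open>z\<close>, so the terms of
      \<open>c\<close> against \<open>z\<close> are the terms of \<open>b k\<close> against
      \<open>x k\<close>.\<close>
    define c where "c = direct_sum (\<lambda>k. 1 / s k) b"
    have c: "c \<in> coeff_ball p"
      unfolding coeff_ball_iff[OF p] c_def
      by (intro conjI direct_sum_ball[where B = "\<lambda>_. 1", OF q homogeneous_norm]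
          direct_sum_tail[where B = "\<lambda>_. 1", OF q homogeneous_norm])
        (use b(1) s s0 in \<open>auto simp: coeff_ball_iff[OF p]\<close>)
    \<comment> \<open>The sum over \<open>z\<close> exists by \<open>coeff_summable\<close>. That it
      equals \<open>w\<close> is tested with functionals, under which the double series is
      unconditionally summable and may be summed by rows.\<close>
    define w' where "w' = (\<Sum>n. c n *\<^sub>C z n)"
    have w': "(\<lambda>n. c n *\<^sub>C z n) sums w'"
      unfolding w'_def by (rule summable_sums[OF coeff_summable[OF p z c]])
    have "w' = w"
    proof (rule dual_ball_separates)
      fix \<phi> :: "'a \<Rightarrow> complex" assume \<phi>: "\<phi> \<in> dual_ball"
      define g where "g = (\<lambda>(k, j). b k j * \<phi> (x k j))"
      have "c n * \<phi> (z n) = g (prod_decode n)" for n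
      proof -
        obtain k j where kj: "prod_decode n = (k, j)" by (cases "prod_decode n")
        have "\<phi> (s k *\<^sub>R x k j) = complex_of_real (s k) * \<phi> (x k j)"
          by (simp add: scaleR_scaleC clinear_on_scale[OF dual_ball_clinear[OF \<phi>]])
        then show ?thesis using s(1)[of k]
          by (simp add: c_def z_def direct_sum_def kj g_def scaleR_conv_of_real)
      qed
      then have "((\<lambda>n. g (prod_decode n)) has_sum \<phi> w') UNIV"
        using coeff_functional(1)[OF p z c w' \<phi>] by simp
      then have "(g has_sum \<phi> w') (UNIV \<times> UNIV)"
        by (subst (asm) has_sum_reindex_bij_betw[where B = UNIV]) (simp_all add: bij_prod_decode)
      moreover have "((\<lambda>j. g (k, j)) has_sum \<phi> (y k)) UNIV" for k
        using coeff_functional(1)[OF p x(1) b(1) b(2) \<phi>] by (simp add: g_def)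
      ultimately have "((\<lambda>k. \<phi> (y k)) has_sum \<phi> w') UNIV" by (rule has_sum_SigmaD)
      then have "(\<lambda>k. \<phi> (y k)) sums \<phi> w'" by (rule has_sum_imp_sums)
      moreover have "(\<lambda>k. \<phi> (y k)) sums \<phi> w" by (rule bounded_linear.sums[OF dual_ball_bounded_linear[OF \<phi>] w])
      ultimately show "\<phi> w' = \<phi> w" by (rule sums_unique2)
    qed
    then show ?thesis using w' c by (auto simp: pconv_def)
  qed
  then show thesis using that z zn by blast
qed

subsection \<open>Sizes of \<open>p\<close>-compact sets\<close>

lemma size_of_le:
  assumes p: "1 \<le> p" and x: "x \<in> seq_space I p" "K \<subseteq> pconv p x"
  shows "size_of I p K \<le> seq_norm I p x"
  unfolding size_of_def using x seq_norm_nonneg[OF p] by (intro cInf_lower) (auto intro!: bdd_belowI[of _ 0])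

lemma size_of_greatest:
  assumes "rel_compact I p K" "\<And>x. x \<in> seq_space I p \<Longrightarrow> K \<subseteq> pconv p x \<Longrightarrow> c \<le> seq_norm I p x"
  shows "c \<le> size_of I p K"
  unfolding size_of_def using assms by (intro cInf_greatest) (auto simp: rel_compact_def)

lemma size_of_nonneg: "1 \<le> p \<Longrightarrow> rel_compact I p K \<Longrightarrow> 0 \<le> size_of I p K"
  by (rule size_of_greatest) (auto intro: seq_norm_nonneg)

lemma size_of_approx:
  assumes p: "1 \<le> p" and K: "rel_compact I p K" and c: "size_of I p K < c"
  obtains x where "x \<in> seq_space I p" "K \<subseteq> pconv p x" "seq_norm I p x < c"
proof -
  have "\<exists>x. x \<in> seq_space I p \<and> K \<subseteq> pconv p x \<and> seq_norm I p x < c"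
  proof (rule ccontr)
    assume "\<not> ?thesis"
    then have "c \<le> size_of I p K" by (intro size_of_greatest[OF K]) (meson not_less)
    then show False using c by simp
  qed
  then show thesis using that by blast
qed

lemma size_of_norm_le:
  fixes K :: "'a::complex_normed_vector set"
  assumes p: "1 \<le> p" and K: "rel_compact I p K" and y: "y \<in> K"
  shows "norm y \<le> size_of I p K"
  by (rule size_of_greatest[OF K]) (use y pconv_norm_le[OF p] in auto)

lemma size_of_mono:
  assumes p: "1 \<le> p" and K: "rel_compact I p K" and sub: "L \<subseteq> K"
  shows "rel_compact I p L" "size_of I p L \<le> size_of I p K"
proof -
  show "rel_compact I p L" using K sub by (auto simp: rel_compact_def)
  show "size_of I p L \<le> size_of I p K"
  proof (rule size_of_greatest[OF K])
    fix x assume "x \<in> seq_space I p" "K \<subseteq> pconv p x"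
    then show "size_of I p L \<le> seq_norm I p x" using sub by (intro size_of_le[OF p]) auto
  qed
qed

text \<open>Formulated for subsets of zero so as to include the empty range, which occurs when
  \<open>U\<close> is empty.\<close>

lemma size_of_zero:
  assumes p: "1 \<le> p" and K: "K \<subseteq> {0 :: 'a::complex_normed_vector}"
  shows "rel_compact I p K" "size_of I p K = 0"
proof -
  have "lq_le p C (\<lambda>n. P (0 :: 'a)) F" if "P \<in> kind_seminorms I" "0 \<le> C" for P F C
  proof -
    have "P (0 *\<^sub>C (0::'a)) = 0" unfolding kind_seminorms_scaleC[OF that(1)] by simp
    then show ?thesis using that(2) by (simp add: lq_le_def)
  qed
  note le = this
  have ball: "seq_ball p (kind_seminorms I) C (\<lambda>_. 0 :: 'a)" if "C \<ge> 0" for C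
    unfolding seq_ball_def using le that by blast
  have tail: "seq_tail p \<Psi> (\<lambda>_. 0 :: 'a)" if "\<Psi> \<in> tail_families I" for \<Psi>
    unfolding seq_tail_def
    by (intro allI impI exI ballI le[OF subsetD[OF tail_families_subset[OF that]]]) auto
  have z: "(\<lambda>_. 0 :: 'a) \<in> seq_space I p" unfolding seq_space_iff[OF p] using ball[of 0] tail by blast
  have zn: "seq_norm I p (\<lambda>_. 0 :: 'a) \<le> 0" using seq_norm_le_iff[OF p z, of 0] ball[of 0] by simp
  have sub: "K \<subseteq> pconv p (\<lambda>_. 0 :: 'a)" using K zero_in_pconv[OF p] by auto
  then show rc: "rel_compact I p K" using z by (auto simp: rel_compact_def)
  show "size_of I p K = 0"
    using size_of_le[OF p z sub] zn size_of_nonneg[OF p rc] by simp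
qed

text \<open>The upper bound, applied also with \<open>1 / c\<close> to the scaled set, gives
  equality.\<close>

lemma size_of_scale:
  fixes K :: "'a::complex_normed_vector set"
  assumes p: "1 \<le> p" and K: "rel_compact I p K"
  shows "rel_compact I p ((\<lambda>y. c *\<^sub>C y) ` K)" "size_of I p ((\<lambda>y. c *\<^sub>C y) ` K) = cmod c * size_of I p K"
proof -
  have sub: "(\<lambda>y. c *\<^sub>C y) ` K \<subseteq> pconv p (\<lambda>n. c *\<^sub>C x n)" if "K \<subseteq> pconv p x" for c :: complex and K x
    using that by (auto intro: pconv_scale)
  have rc: "rel_compact I p ((\<lambda>y. c *\<^sub>C y) ` K)" if "rel_compact I p K" for c :: complex and K
    using that seq_space_scale(1)[OF p] sub unfolding rel_compact_def by metis
  have le: "size_of I p ((\<lambda>y. c *\<^sub>C y) ` K) \<le> cmod c * size_of I p K" if K: "rel_compact I p K" for c :: complex and K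
  proof (cases "c = 0")
    case True
    then have "size_of I p ((\<lambda>y. c *\<^sub>C y) ` K) = 0" by (intro size_of_zero(2)[OF p]) auto
    then show ?thesis using True by simp
  next
    case False
    have "size_of I p ((\<lambda>y. c *\<^sub>C y) ` K) / cmod c \<le> size_of I p K"
    proof (rule size_of_greatest[OF K])
      fix x assume x: "x \<in> seq_space I p" "K \<subseteq> pconv p x"
      have "size_of I p ((\<lambda>y. c *\<^sub>C y) ` K) \<le> cmod c * seq_norm I p x"
        using size_of_le[OF p seq_space_scale(1)[OF p x(1)] sub[OF x(2)]] seq_space_scale(2)[OF p x(1)]
        by (rule order_trans)
      then show "size_of I p ((\<lambda>y. c *\<^sub>C y) ` K) / cmod c \<le> seq_norm I p x"
        using False by (simp add: divide_le_eq mult.commute)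
    qed
    then show ?thesis using False by (simp add: divide_le_eq mult.commute)
  qed
  show "rel_compact I p ((\<lambda>y. c *\<^sub>C y) ` K)" by (rule rc[OF K])
  show "size_of I p ((\<lambda>y. c *\<^sub>C y) ` K) = cmod c * size_of I p K"
  proof (cases "c = 0")
    case True
    then show ?thesis using size_of_zero(2)[OF p, of "(\<lambda>y. c *\<^sub>C y) ` K"] by auto
  next
    case False
    have "size_of I p ((\<lambda>y. (1/c) *\<^sub>C y) ` (\<lambda>y. c *\<^sub>C y) ` K) \<le> cmod (1/c) * size_of I p ((\<lambda>y. c *\<^sub>C y) ` K)"
      by (rule le[OF rc[OF K]])
    moreover have "(\<lambda>y. (1/c) *\<^sub>C y) ` (\<lambda>y. c *\<^sub>C y) ` K = K"
      using False by (simp add: image_image scaleC_scaleC scaleC_one)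
    ultimately have "cmod c * size_of I p K \<le> size_of I p ((\<lambda>y. c *\<^sub>C y) ` K)"
      using False by (simp add: norm_divide field_simps)
    then show ?thesis using le[OF K, of c] by simp
  qed
qed

text \<open>The bounds \<open>A k\<close> are strict because a size is an infimum that need not be
  attained; each \<open>K k\<close> is first enclosed in a single hull.\<close>

lemma size_of_countable_sum:
  fixes K :: "nat \<Rightarrow> 'a::cbanach set"
  assumes p: "1 \<le> p" and K: "\<And>k. rel_compact I p (K k)" "\<And>k. size_of I p (K k) < A k"
    and t: "\<And>k. t k \<ge> 1" "filterlim t at_top sequentially" and S: "(\<lambda>k. t k * A k) sums S"
    and L: "\<And>w. w \<in> L \<Longrightarrow> \<exists>y. (\<forall>k. y k \<in> K k) \<and> y sums w"
  shows "rel_compact I p L" "size_of I p L \<le> S"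
proof -
  have A: "A k > 0" for k using size_of_nonneg[OF p K(1)] K(2) by (rule le_less_trans)
  have "\<exists>x. \<forall>k. x k \<in> seq_space I p \<and> K k \<subseteq> pconv p (x k) \<and> seq_norm I p (x k) \<le> A k"
    by (intro choice allI) (rule size_of_approx[OF p K], blast intro: less_imp_le)
  then obtain x where x: "\<And>k. x k \<in> seq_space I p" "\<And>k. K k \<subseteq> pconv p (x k)" "\<And>k. seq_norm I p (x k) \<le> A k"
    by blast
  obtain z where z: "z \<in> seq_space I p" "seq_norm I p z \<le> S"
    "\<And>y w. (\<And>k. y k \<in> pconv p (x k)) \<Longrightarrow> y sums w \<Longrightarrow> w \<in> pconv p z"
    using pconv_countable_sum[OF p A t S x(1,3)] by blast
  have sub: "L \<subseteq> pconv p z"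
  proof
    fix w assume "w \<in> L"
    then obtain y where "\<And>k. y k \<in> K k" "y sums w" using L by blast
    then show "w \<in> pconv p z" using x(2) by (intro z(3)[of y]) auto
  qed
  then show "rel_compact I p L" using z(1) by (auto simp: rel_compact_def)
  show "size_of I p L \<le> S" using size_of_le[OF p z(1) sub] z(2) by simp
qed

text \<open>The first two strict bounds cost \<open>e\<close> each, and the later terms sum
  \<open>2 ^ k * (2 * e / 4 ^ k)\<close> to \<open>4 * e\<close>; this is the origin of 6. Two
  leading sets are kept apart so that sums of two sets get a sharp bound as well.\<close>

lemma size_of_series:
  fixes K :: "nat \<Rightarrow> 'a::cbanach set"
  assumes p: "1 \<le> p" and K: "\<And>k. rel_compact I p (K k)" and e: "e > 0"
    and size: "size_of I p (K 0) \<le> a" "size_of I p (K 1) \<le> b"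
      "\<And>k. size_of I p (K (k + 2)) \<le> e / 4 ^ k"
    and L: "\<And>w. w \<in> L \<Longrightarrow> \<exists>y. (\<forall>k. y k \<in> K k) \<and> y sums w"
  shows "rel_compact I p L \<and> size_of I p L \<le> a + b + 6 * e"
proof -
  define A where "A k = (if k = 0 then a + e else if k = 1 then b + e else 2 * e / 4 ^ (k - 2))" for k :: nat
  \<comment> \<open>Truncated subtraction gives \<open>t 0 = t 1 = 1\<close>, so the leading bounds
    \<open>a\<close> and \<open>b\<close> enter with factor 1.\<close>
  define t where "t k = (2 :: real) ^ (k - 2)" for k :: nat
  have lt: "size_of I p (K k) < A k" for k
  proof -
    consider "k = 0" | "k = 1" | j where "k = j + 2"
      by (metis One_nat_def Suc_1 add.commute add_2_eq_Suc not0_implies_Suc)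
    then show ?thesis
    proof cases
      case 3
      have "e / 4 ^ j < 2 * e / 4 ^ j" using e by (simp add: divide_strict_right_mono)
      then show ?thesis using size(3)[of j] 3 by (simp add: A_def)
    qed (use size e in \<open>auto simp: A_def\<close>)
  qed
  have t1: "t k \<ge> 1" for k by (simp add: t_def)
  have "filterlim (\<lambda>k. t (Suc (Suc k))) at_top sequentially"
  proof (rule filterlim_at_top_mono[OF filterlim_real_sequentially], rule always_eventually, rule allI)
    fix k show "real k \<le> t (Suc (Suc k))" using of_nat_less_two_power[of k, where 'a = real] by (simp add: t_def)
  qed
  then have tlim: "filterlim t at_top sequentially" by (simp only: filterlim_sequentially_Suc[of "\<lambda>k. t (Suc k)"] filterlim_sequentially_Suc[of t])
  have "(\<lambda>k. 2 * e * (1 / 2) ^ k) sums (2 * e * (1 / (1 - 1 / 2)))"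
    by (intro sums_mult geometric_sums) simp
  moreover have "t (k + 2) * A (k + 2) = 2 * e * (1 / 2) ^ k" for k
  proof -
    have "(4::real) ^ k = 2 ^ k * 2 ^ k" by (simp flip: power_mult_distrib)
    then show ?thesis by (simp add: t_def A_def power_divide)
  qed
  ultimately have "(\<lambda>k. t (k + 2) * A (k + 2)) sums (4 * e)" by simp
  then have "(\<lambda>k. t k * A k) sums (4 * e + (\<Sum>k<2. t k * A k))" by (subst (asm) sums_iff_shift)
  then have S: "(\<lambda>k. t k * A k) sums (a + b + 6 * e)"
    by (simp add: numeral_2_eq_2 t_def A_def algebra_simps)
  show ?thesis
    using size_of_countable_sum[OF p K lt t1 tlim S L] by auto
qed

text \<open>The series bound with \<open>{0}\<close> in all places from index 2 on, and
  \<open>e\<close> arbitrarily small.\<close>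

lemma size_of_add:
  fixes K L :: "'a::cbanach set"
  assumes p: "1 \<le> p" and K: "rel_compact I p K" and L: "rel_compact I p L"
    and M: "\<And>w. w \<in> M \<Longrightarrow> \<exists>y\<in>K. \<exists>z\<in>L. w = y + z"
  shows "rel_compact I p M" "size_of I p M \<le> size_of I p K + size_of I p L"
proof -
  define Z where "Z k = (if k = 0 then K else if k = 1 then L else {0})" for k :: nat
  have Z: "rel_compact I p (Z k)" for k
    using K L size_of_zero(1)[OF p, of "{0 :: 'a}"] by (simp add: Z_def)
  have ex: "\<exists>y. (\<forall>k. y k \<in> Z k) \<and> y sums w" if w: "w \<in> M" for w
  proof -
    obtain y z where yz: "y \<in> K" "z \<in> L" "w = y + z" using M[OF w] by blast
    define u where "u k = (if k = 0 then y else if k = 1 then z else 0)" for k :: nat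
    have "u sums (\<Sum>k\<in>{0, 1}. u k)" by (rule sums_finite) (auto simp: u_def)
    then have "u sums w" by (simp add: u_def yz)
    moreover have "\<forall>k. u k \<in> Z k" using yz by (simp add: u_def Z_def)
    ultimately show ?thesis by blast
  qed
  have *: "rel_compact I p M \<and> size_of I p M \<le> size_of I p K + size_of I p L + 6 * e" if e: "e > 0" for e
    by (rule size_of_series[where K = Z, OF p Z e _ _ _ ex])
      (use e size_of_zero(2)[OF p, of "{0 :: 'a}"] in \<open>auto simp: Z_def\<close>)
  then show "rel_compact I p M" using zero_less_one by blast
  show "size_of I p M \<le> size_of I p K + size_of I p L"
  proof (rule field_le_epsilon)
    fix e :: real assume "e > 0"
    then show "size_of I p M \<le> size_of I p K + size_of I p L + e" using *[of "e / 6"] by simp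
  qed
qed

text \<open>Spares a separate verification of the norm axioms for the operator ideal.\<close>

lemma cnormed_space_on_transport:
  fixes \<Phi> :: "'a::complex_vector \<Rightarrow> 'b::complex_vector"
  assumes SN: "cnormed_space_on S N" and bij: "bij_betw \<Phi> S S'"
    and add: "\<And>x y. x \<in> S \<Longrightarrow> y \<in> S \<Longrightarrow> \<Phi> (x + y) = \<Phi> x + \<Phi> y"
    and scale: "\<And>c x. x \<in> S \<Longrightarrow> \<Phi> (c *\<^sub>C x) = c *\<^sub>C \<Phi> x"
    and norm: "\<And>x. x \<in> S \<Longrightarrow> N' (\<Phi> x) = N x"
  shows "cnormed_space_on S' N'"
proof -
  have S': "S' = \<Phi> ` S" using bij by (simp add: bij_betw_def)
  note S = cnormed_space_onD[OF SN]
  have lin: "clinear_on S \<Phi>" using add scale by (simp add: clinear_on_def)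
  have \<Phi>0: "\<Phi> 0 = 0" by (rule clinear_on_0[OF S(1) lin])
  have sub: "csubspace S'"
    unfolding csubspace_def S'
    using csubspace_0[OF S(1)] csubspace_add[OF S(1)] csubspace_scale[OF S(1)] \<Phi>0
    by (auto simp: add[symmetric] scale[symmetric] image_iff)
  have "\<Phi> x = 0 \<longleftrightarrow> x = 0" if "x \<in> S" for x
    using bij that csubspace_0[OF S(1)] \<Phi>0 by (metis bij_betw_def inj_onD)
  then show ?thesis
    using sub S(3-6) csubspace_add[OF S(1)] csubspace_scale[OF S(1)]
    unfolding cnormed_space_on_def S'
    by (auto simp: add[symmetric] scale[symmetric] norm)
qed

section \<open>Images of the unit ball of the predual\<close>

context weighted_open_set
begin

abbreviation "range_set f \<equiv> (\<lambda>x. v x *\<^sub>R f x) ` U"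

text \<open>Hulls are absolutely convex: adding an atom with coefficient \<open>c\<close> to a
  combination of mass \<open>m\<close> uses the weights \<open>m / M\<close> and
  \<open>c / M\<close> with \<open>M = m + cmod c\<close>.\<close>

lemma atom_comb_operator_pconv:
  fixes T :: "(('e \<Rightarrow> complex) \<Rightarrow> complex) \<Rightarrow> 'f::cbanach"
  assumes p: "1 \<le> p" and lin: "clinear_on G T"
    and K: "\<And>x. x \<in> U \<Longrightarrow> v x *\<^sub>R T (\<delta> x) \<in> pconv p z" and comb: "atom_comb U v m \<psi>"
  shows "\<exists>y\<in>pconv p z. T \<psi> = complex_of_real m *\<^sub>C y"
  using comb
proof induction
  case zero
  then show ?case using zero_in_pconv[OF p] clinear_on_0[OF csubspace_G lin]
    by (auto simp del: pointwise_simps)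
next
  case (step m \<psi> x c)
  then obtain y where y: "y \<in> pconv p z" "T \<psi> = complex_of_real m *\<^sub>C y" by blast
  note G = atom_comb_G[OF step.hyps(1)] \<delta>_in_G[OF step.hyps(2)]
  define w where "w = v x *\<^sub>R T (\<delta> x)"
  have w: "w \<in> pconv p z" unfolding w_def by (rule K[OF step.hyps(2)])
  have T: "T (\<psi> + (c * complex_of_real (v x)) *\<^sub>C \<delta> x) = complex_of_real m *\<^sub>C y + c *\<^sub>C w"
    using G csubspace_scale[OF csubspace_G]
    by (simp add: clinear_on_add[OF lin] clinear_on_scale[OF lin] y w_def scaleR_scaleC scaleC_scaleC
        del: pointwise_simps)
  define M where "M = m + cmod c"
  show ?case
  proof (cases "M = 0")
    case True
    then have "m = 0" "c = 0" using G by (auto simp: M_def add_nonneg_eq_0_iff)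
    then show ?thesis using y T by (auto simp del: pointwise_simps)
  next
    case False
    then have M: "M > 0" using G by (simp add: M_def less_le)
    have "complex_of_real (m / M) *\<^sub>C y + (c / complex_of_real M) *\<^sub>C w \<in> pconv p z"
    proof (rule pconv_convex[OF p y(1) w])
      have "cmod (complex_of_real (m / M)) + cmod (c / complex_of_real M) = m / M + cmod c / M"
        using M G by (simp add: norm_divide)
      also have "\<dots> = 1" using M by (simp add: M_def flip: add_divide_distrib)
      finally show "cmod (complex_of_real (m / M)) + cmod (c / complex_of_real M) \<le> 1" by simp
    qed
    moreover have "complex_of_real M *\<^sub>C (complex_of_real (m / M) *\<^sub>C y + (c / complex_of_real M) *\<^sub>C w)
        = complex_of_real m *\<^sub>C y + c *\<^sub>C w"
      using M by (simp add: scaleC_add_right scaleC_scaleC)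
    ultimately show ?thesis unfolding T M_def[symmetric] by metis
  qed
qed

text \<open>The k-th terms of the decompositions of all \<open>\<phi>\<close> in the ball lie in the
  same multiple \<open>Z k\<close> of one hull, so \<open>size_of_series\<close> handles the entire
  image at once. Letting \<open>e\<close> tend to 0 removes the slack.\<close>

theorem operator_image_pconv:
  fixes T :: "(('e \<Rightarrow> complex) \<Rightarrow> complex) \<Rightarrow> 'f::cbanach"
  assumes p: "1 \<le> p" and T: "T \<in> bounded_ops G NG"
    and K: "rel_compact I p ((\<lambda>x. v x *\<^sub>R T (\<delta> x)) ` U)"
  shows "rel_compact I p (T ` unit_ball G NG)"
    "size_of I p (T ` unit_ball G NG) \<le> size_of I p ((\<lambda>x. v x *\<^sub>R T (\<delta> x)) ` U)"
proof -
  let ?B = "T ` unit_ball G NG"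
  have lin: "clinear_on G T" using T by (simp add: bounded_ops_iff)
  have main: "rel_compact I p ?B \<and> size_of I p ?B \<le> seq_norm I p z"
    if z: "z \<in> seq_space I p" "(\<lambda>x. v x *\<^sub>R T (\<delta> x)) ` U \<subseteq> pconv p z" for z
  proof -
    define N where "N = seq_norm I p z"
    have N: "N \<ge> 0" unfolding N_def by (rule seq_norm_nonneg[OF p z(1)])
    have rc: "rel_compact I p (pconv p z)" using z(1) by (auto simp: rel_compact_def)
    have sz: "size_of I p (pconv p z) \<le> N" unfolding N_def by (rule size_of_le[OF p z(1)]) simp
    have bound: "rel_compact I p ?B \<and> size_of I p ?B \<le> (1 + e) * N + e * N + 6 * (e * (N + 1))"
      if e: "e > 0" for e
    proof -
      \<comment> \<open>The mass bounds of \<open>atomic_decomposition\<close> for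
        \<open>NG \<phi> \<le> 1\<close>; its bounds are indexed by \<open>Suc n\<close>, hence
        \<open>k - 1\<close>.\<close>
      define M where "M k = (if k = 0 then 1 + e else e / 4 ^ (k - 1))" for k :: nat
      have M: "M k > 0" for k using e by (simp add: M_def)
      define Z where "Z k = (\<lambda>y. complex_of_real (M k) *\<^sub>C y) ` pconv p z" for k
      have Z: "rel_compact I p (Z k)" "size_of I p (Z k) \<le> M k * N" for k
        unfolding Z_def using size_of_scale[OF p rc] sz M[of k] by (auto intro: mult_left_mono)
      have ex: "\<exists>y. (\<forall>k. y k \<in> Z k) \<and> y sums w" if "w \<in> ?B" for w
      proof -
        obtain \<phi> where \<phi>: "\<phi> \<in> G" "NG \<phi> \<le> 1" "w = T \<phi>" using \<open>w \<in> ?B\<close> by (auto simp: unit_ball_def)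
        obtain m \<psi> where \<psi>: "\<And>n. atom_comb U v (m n) (\<psi> n)" "m 0 \<le> NG \<phi> + e" "\<And>n. m (Suc n) \<le> e / 4 ^ n"
          "(\<lambda>n. NG (\<phi> - (\<Sum>k<n. \<psi> k))) \<longlonglongrightarrow> 0"
          using atomic_decomposition[OF \<phi>(1) e] by blast
        have "T (\<psi> k) \<in> Z k" for k
        proof -
          obtain y where y: "y \<in> pconv p z" "T (\<psi> k) = complex_of_real (m k) *\<^sub>C y"
            using atom_comb_operator_pconv[OF p lin _ \<psi>(1)[of k], of z] z(2) by blast
          have mk: "0 \<le> m k" "m k \<le> M k"
            using atom_comb_G[OF \<psi>(1)[of k]] \<psi>(2) \<psi>(3)[of "k - 1"] \<phi>(2)
            by (auto simp: M_def split: if_splits)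
          \<comment> \<open>Hulls are balanced, so the actual mass \<open>m k\<close> may be
            replaced by its bound \<open>M k\<close>; the summand with coefficient 0 fits the form
            of \<open>pconv_convex\<close>.\<close>
          let ?y = "complex_of_real (m k / M k) *\<^sub>C y + 0 *\<^sub>C y"
          have "?y \<in> pconv p z"
            using mk M[of k] by (intro pconv_convex[OF p y(1) y(1)]) (simp add: norm_divide divide_le_eq)
          moreover have "T (\<psi> k) = complex_of_real (M k) *\<^sub>C ?y"
            using y(2) M[of k] by (simp add: scaleC_scaleC)
          ultimately show ?thesis unfolding Z_def by blast
        qed
        moreover have "(\<lambda>k. T (\<psi> k)) sums w"
          unfolding \<phi>(3) using atom_comb_G[OF \<psi>(1)] by (intro operator_sums[OF \<phi>(1) _ \<psi>(4) T]) blast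
        ultimately show ?thesis by (intro exI[of _ "\<lambda>k. T (\<psi> k)"]) simp
      qed
      \<comment> \<open>\<open>N + 1\<close> in place of \<open>N\<close> keeps the parameter of the
        series bound positive when \<open>N = 0\<close>.\<close>
      have small: "M (k + 2) * N \<le> e * (N + 1) / 4 ^ k" for k
      proof -
        have "M (k + 2) * N = e * N / 4 / 4 ^ k" by (simp add: M_def)
        also have "\<dots> \<le> e * (N + 1) / 4 ^ k" using e N by (intro divide_right_mono) (auto simp: field_simps)
        finally show ?thesis .
      qed
      show ?thesis
      proof (rule size_of_series[where K = Z, OF p Z(1) _ _ _ order_trans[OF Z(2) small] ex])
        show "size_of I p (Z 0) \<le> (1 + e) * N" "size_of I p (Z 1) \<le> e * N"
          using Z(2)[of 0] Z(2)[of 1] by (auto simp: M_def)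
        show "e * (N + 1) > 0" using e N by simp
      qed
    qed
    have "((\<lambda>e. (1 + e) * N + e * N + 6 * (e * (N + 1))) \<longlongrightarrow> (1 + 0) * N + 0 * N + 6 * (0 * (N + 1))) (at_right 0)"
      by (intro tendsto_intros)
    moreover have "\<forall>\<^sub>F e in at_right 0. size_of I p ?B \<le> (1 + e) * N + e * N + 6 * (e * (N + 1))"
      using bound by (intro eventually_at_rightI[of 0 1]) auto
    ultimately have "size_of I p ?B \<le> (1 + 0) * N + 0 * N + 6 * (0 * (N + 1))"
      by (rule tendsto_lowerbound) simp
    then show ?thesis using bound[of 1] by (simp add: N_def)
  qed
  show "rel_compact I p ?B" using K main by (auto simp: rel_compact_def)
  show "size_of I p ?B \<le> size_of I p ((\<lambda>x. v x *\<^sub>R T (\<delta> x)) ` U)"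
    by (rule size_of_greatest[OF K]) (use main in blast)
qed

lemma range_set_subset_operator_image:
  assumes T: "T \<in> bounded_ops G NG"
  shows "(\<lambda>x. v x *\<^sub>R T (\<delta> x)) ` U \<subseteq> T ` unit_ball G NG"
proof
  fix w assume "w \<in> (\<lambda>x. v x *\<^sub>R T (\<delta> x)) ` U"
  then obtain x where x: "x \<in> U" "w = v x *\<^sub>R T (\<delta> x)" by blast
  have "T (complex_of_real (v x) *\<^sub>C \<delta> x) = w"
    using T x \<delta>_in_G[OF x(1)] by (simp add: bounded_ops_def scaleR_scaleC)
  moreover have "complex_of_real (v x) *\<^sub>C \<delta> x \<in> unit_ball G NG"
    using csubspace_scale[OF csubspace_G \<delta>_in_G[OF x(1)]] NG_\<delta>[OF x(1)] v_pos[OF x(1)]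
      cnormed_space_onD(6)[OF normed_G \<delta>_in_G[OF x(1)]] by (simp add: unit_ball_def del: pointwise_simps)
  ultimately show "w \<in> T ` unit_ball G NG" by blast
qed

text \<open>Monotonicity of sizes gives one direction, as the atoms \<open>v x \<delta> x\<close>
  lie in the unit ball of \<open>G\<close>; \<open>operator_image_pconv\<close> gives the
  other.\<close>

lemma operator_ideal_iff:
  fixes T :: "(('e \<Rightarrow> complex) \<Rightarrow> complex) \<Rightarrow> 'f::cbanach"
  assumes p: "1 \<le> p" and T: "T \<in> bounded_ops G NG" and K: "K = (\<lambda>x. v x *\<^sub>R T (\<delta> x)) ` U"
  shows "rel_compact I p K \<longleftrightarrow> T \<in> op_ideal I p G NG"
    "rel_compact I p K \<Longrightarrow> size_of I p K = op_ideal_norm I p G NG T"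
proof -
  have sub: "K \<subseteq> T ` unit_ball G NG" unfolding K by (rule range_set_subset_operator_image[OF T])
  show "rel_compact I p K \<longleftrightarrow> T \<in> op_ideal I p G NG"
    using operator_image_pconv(1)[OF p T] size_of_mono(1)[OF p _ sub] T K by (auto simp: op_ideal_def)
  assume "rel_compact I p K"
  then show "size_of I p K = op_ideal_norm I p G NG T"
    using operator_image_pconv[OF p T, of I] size_of_mono(2)[OF p _ sub, of I] unfolding op_ideal_norm_def K
    by (meson antisym)
qed

lemma linearization_range_set:
  fixes f :: "'e \<Rightarrow> 'f::cbanach"
  assumes "f \<in> Hv U v"
  shows "range_set f = (\<lambda>x. v x *\<^sub>R linearization U v f (\<delta> x)) ` U"
  using linearization_spec(2)[OF assms] by (intro image_cong) auto

theorem linearization_ideal: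
  fixes f :: "'e \<Rightarrow> 'f::cbanach"
  assumes p: "1 \<le> p" and f: "f \<in> Hv U v"
  shows "f \<in> HvI I p U v \<longleftrightarrow> linearization U v f \<in> op_ideal I p G NG"
    "f \<in> HvI I p U v \<Longrightarrow> HvI_norm I p U v f = op_ideal_norm I p G NG (linearization U v f)"
  using operator_ideal_iff[OF p linearization_spec(1)[OF f] linearization_range_set[OF f]] f
  by (auto simp: HvI_def HvI_norm_def)

lemma HvI_Hv: "f \<in> HvI I p U v \<Longrightarrow> f \<in> Hv U v"
  and HvI_rel_compact: "f \<in> HvI I p U v \<Longrightarrow> rel_compact I p (range_set f)"
  by (auto simp: HvI_def)

lemma HvI_norm_bound:
  fixes f :: "'e \<Rightarrow> 'f::cbanach"
  assumes p: "1 \<le> p" and f: "f \<in> HvI I p U v" and x: "x \<in> U"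
  shows "v x * norm (f x) \<le> HvI_norm I p U v f"
  using size_of_norm_le[OF p HvI_rel_compact[OF f], of "v x *\<^sub>R f x"] x v_pos[OF x]
  by (simp add: HvI_norm_def)

section \<open>Norm, isometry and completeness of the holomorphic ideal\<close>

lemma cnormed_space_HvI:
  assumes p: "1 \<le> p"
  shows "cnormed_space_on (HvI I p U v :: ('e \<Rightarrow> 'f::cbanach) set) (HvI_norm I p U v)"
proof -
  let ?S = "HvI I p U v :: ('e \<Rightarrow> 'f) set"
  note Hv = cnormed_space_onD(1)[OF cnormed_space_Hv[OF weight_v, where 'f = 'f]]
  have zero: "0 \<in> ?S" "HvI_norm I p U v (0 :: 'e \<Rightarrow> 'f) = 0"
    using csubspace_0[OF Hv] size_of_zero[OF p, of "range_set (0 :: 'e \<Rightarrow> 'f)"]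
    by (auto simp: HvI_def HvI_norm_def)
  have add: "f + g \<in> ?S \<and> HvI_norm I p U v (f + g) \<le> HvI_norm I p U v f + HvI_norm I p U v g"
    if fg: "f \<in> ?S" "g \<in> ?S" for f g
  proof -
    have "\<exists>y\<in>range_set f. \<exists>z\<in>range_set g. w = y + z" if "w \<in> range_set (f + g)" for w
      using that by (auto simp: scaleR_add_right)
    from size_of_add[OF p HvI_rel_compact[OF fg(1)] HvI_rel_compact[OF fg(2)] this]
    show ?thesis using csubspace_add[OF Hv HvI_Hv[OF fg(1)] HvI_Hv[OF fg(2)]]
      by (simp add: HvI_def HvI_norm_def)
  qed
  have scale: "c *\<^sub>C f \<in> ?S \<and> HvI_norm I p U v (c *\<^sub>C f) = cmod c * HvI_norm I p U v f"
    if f: "f \<in> ?S" for c f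
  proof -
    have "range_set (c *\<^sub>C f) = (\<lambda>y. c *\<^sub>C y) ` range_set f"
      by (auto simp: image_image scaleR_scaleC scaleC_scaleC mult.commute)
    then show ?thesis
      using size_of_scale[OF p HvI_rel_compact[OF f], of c] csubspace_scale[OF Hv HvI_Hv[OF f], of c]
      by (simp add: HvI_def HvI_norm_def)
  qed
  have zero_iff: "HvI_norm I p U v f = 0 \<longleftrightarrow> f = 0" if f: "f \<in> ?S" for f
  proof
    assume 0: "HvI_norm I p U v f = 0"
    have "f x = 0" for x
    proof (cases "x \<in> U")
      case True
      then show ?thesis using HvI_norm_bound[OF p f True] v_pos[OF True] 0 by (simp add: mult_le_0_iff)
    qed (use Hv_outside[OF HvI_Hv[OF f]] in auto)
    then show "f = 0" by (simp add: fun_eq_iff)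
  qed (use zero in simp)
  have nonneg: "0 \<le> HvI_norm I p U v f" if "f \<in> ?S" for f
    unfolding HvI_norm_def by (rule size_of_nonneg[OF p HvI_rel_compact[OF that]])
  show ?thesis
    unfolding cnormed_space_on_def csubspace_def
    by (intro conjI ballI allI zero nonneg zero_iff add[THEN conjunct1] add[THEN conjunct2]
        scale[THEN conjunct1] scale[THEN conjunct2])
qed

lemma linearization_add:
  fixes f g :: "'e \<Rightarrow> 'f::cbanach"
  assumes f: "f \<in> Hv U v" and g: "g \<in> Hv U v"
  shows "linearization U v (f + g) = linearization U v f + linearization U v g"
  by (rule linearization_eqI)
    (use csubspace_add[OF cnormed_space_onD(1)[OF cnormed_space_Hv[OF weight_v]] f g]
      csubspace_add[OF cnormed_space_onD(1)[OF cnormed_space_bounded_ops[OF normed_G]]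
        linearization_spec(1)[OF f] linearization_spec(1)[OF g]]
      linearization_spec(2)[OF f] linearization_spec(2)[OF g] in auto)

lemma linearization_scale:
  fixes f :: "'e \<Rightarrow> 'f::cbanach"
  assumes f: "f \<in> Hv U v"
  shows "linearization U v (c *\<^sub>C f) = c *\<^sub>C linearization U v f"
  by (rule linearization_eqI)
    (use csubspace_scale[OF cnormed_space_onD(1)[OF cnormed_space_Hv[OF weight_v]] f]
      csubspace_scale[OF cnormed_space_onD(1)[OF cnormed_space_bounded_ops[OF normed_G]]
        linearization_spec(1)[OF f]]
      linearization_spec(2)[OF f] in auto)

theorem linearization_isometry:
  assumes p: "1 \<le> p"
  shows "isometric_isomorphism (HvI I p U v :: ('e \<Rightarrow> 'f::cbanach) set) (HvI_norm I p U v)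
    (op_ideal I p G NG) (op_ideal_norm I p G NG) (linearization U v)"
proof -
  let ?S = "HvI I p U v :: ('e \<Rightarrow> 'f) set"
  let ?S' = "op_ideal I p G NG :: ((('e \<Rightarrow> complex) \<Rightarrow> complex) \<Rightarrow> 'f) set"
  have bij: "bij_betw (linearization U v) ?S ?S'"
    unfolding bij_betw_def
  proof
    show "inj_on (linearization U v) ?S"
    proof (rule inj_onI)
      fix f g assume fg: "f \<in> ?S" "g \<in> ?S" "linearization U v f = linearization U v g"
      show "f = g"
      proof
        fix x show "f x = g x"
          using linearization_spec(2)[OF HvI_Hv[OF fg(1)], of x] linearization_spec(2)[OF HvI_Hv[OF fg(2)], of x]
            Hv_outside[OF HvI_Hv[OF fg(1)], of x] Hv_outside[OF HvI_Hv[OF fg(2)], of x] fg(3)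
          by (cases "x \<in> U") auto
      qed
    qed
    show "linearization U v ` ?S = ?S'"
    proof
      show "linearization U v ` ?S \<subseteq> ?S'" using linearization_ideal(1)[OF p] HvI_Hv by blast
      show "?S' \<subseteq> linearization U v ` ?S"
      proof
        fix T assume T: "T \<in> ?S'"
        then have Tb: "T \<in> bounded_ops G NG" by (simp add: op_ideal_def)
        \<comment> \<open>Surjectivity: \<open>T\<close> is the linearization of the holomorphic
          function \<open>T \<circ> \<delta>\<close>.\<close>
        define f where "f x = (if x \<in> U then T (\<delta> x) else 0)" for x
        have f: "f \<in> Hv U v" unfolding f_def by (rule operator_comp_\<delta>_in_Hv[OF Tb])
        have eq: "linearization U v f = T" by (rule linearization_eqI[OF f Tb]) (simp add: f_def)
        then have "f \<in> ?S" using linearization_ideal(1)[OF p f] T by simp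
        then show "T \<in> linearization U v ` ?S" using eq by blast
      qed
    qed
  qed
  have add: "linearization U v (f + g) = linearization U v f + linearization U v g"
    if "f \<in> ?S" "g \<in> ?S" for f g using that by (intro linearization_add HvI_Hv)
  have scale: "linearization U v (c *\<^sub>C f) = c *\<^sub>C linearization U v f"
    if "f \<in> ?S" for c f using that by (intro linearization_scale HvI_Hv)
  have norm: "op_ideal_norm I p G NG (linearization U v f) = HvI_norm I p U v f"
    if "f \<in> ?S" for f using linearization_ideal(2)[OF p HvI_Hv[OF that] that] by simp
  have "cnormed_space_on ?S' (op_ideal_norm I p G NG)"
    by (rule cnormed_space_on_transport[OF cnormed_space_HvI[OF p] bij]) (fact add scale norm)+
  then show ?thesis
    unfolding isometric_isomorphism_def
    using cnormed_space_HvI[OF p, where I = I and 'f = 'f] bij add scale norm by blast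
qed

text \<open>The limit is found among operators: sizes dominate norms, so the linearizations converge
  pointwise to a bounded operator \<open>R\<close>, and \<open>R \<circ> \<delta>\<close> is
  holomorphic. Convergence in the ideal norm follows from \<open>size_of_series\<close>, applied to
  the telescoping series of a fast subsequence.\<close>

theorem cbanach_space_HvI:
  assumes p: "1 \<le> p"
  shows "cbanach_space_on (HvI I p U v :: ('e \<Rightarrow> 'f::cbanach) set) (HvI_norm I p U v)"
proof -
  let ?S = "HvI I p U v :: ('e \<Rightarrow> 'f) set"
  let ?N = "HvI_norm I p U v :: ('e \<Rightarrow> 'f) \<Rightarrow> real"
  note SN = cnormed_space_HvI[OF p, where 'f = 'f and I = I]
  note S = cnormed_space_onD[OF SN]
  have "\<exists>f\<in>?S. (\<lambda>n. ?N (F n - f)) \<longlonglongrightarrow> 0"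
    if F: "range F \<subseteq> ?S" and Cauchy: "\<forall>e>0. \<exists>M. \<forall>m\<ge>M. \<forall>n\<ge>M. ?N (F m - F n) < e" for F :: "nat \<Rightarrow> 'e \<Rightarrow> 'f"
  proof -
    have FS: "F n \<in> ?S" for n using F by auto
    have dS: "F m - F n \<in> ?S" for m n by (rule csubspace_diff[OF S(1) FS FS])
    define T where "T n = linearization U v (F n)" for n
    have Tb: "T n \<in> bounded_ops G NG" for n
      unfolding T_def by (rule linearization_spec(1)[OF HvI_Hv[OF FS]])
    have T\<delta>: "T n (\<delta> x) = F n x" if "x \<in> U" for n x
      unfolding T_def by (rule linearization_spec(2)[OF HvI_Hv[OF FS] that])
    have Tlin: "clinear_on G (T n)" for n using Tb by (simp add: bounded_ops_iff)
    note sub = cnormed_space_onD(1)[OF cnormed_space_bounded_ops[OF normed_G, where 'b = 'f]]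
    have Tdiff: "norm (T m \<phi> - T n \<phi>) \<le> ?N (F m - F n) * NG \<phi>" if \<phi>: "\<phi> \<in> G" for m n \<phi>
    proof -
      have D: "T m - T n \<in> bounded_ops G NG" by (rule csubspace_diff[OF sub Tb Tb])
      have eq: "range_set (F m - F n) = (\<lambda>x. v x *\<^sub>R (T m - T n) (\<delta> x)) ` U"
        by (intro image_cong) (auto simp: T\<delta>)
      have rc: "rel_compact I p (range_set (F m - F n))" by (rule HvI_rel_compact[OF dS])
      have rcB: "rel_compact I p ((T m - T n) ` unit_ball G NG)"
        using operator_ideal_iff(1)[OF p D eq] rc by (simp add: op_ideal_def)
      have "op_norm G NG (T m - T n) \<le> ?N (F m - F n)"
      proof (rule op_norm_leI[OF normed_G])
        fix \<phi> assume "\<phi> \<in> G" "NG \<phi> \<le> 1"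
        then have "norm ((T m - T n) \<phi>) \<le> size_of I p ((T m - T n) ` unit_ball G NG)"
          by (intro size_of_norm_le[OF p rcB] imageI) (simp add: unit_ball_def)
        then show "norm ((T m - T n) \<phi>) \<le> ?N (F m - F n)"
          using operator_ideal_iff(2)[OF p D eq rc] by (simp add: HvI_norm_def op_ideal_norm_def)
      qed
      then show ?thesis
        using op_norm_bound[OF normed_G D \<phi>] cnormed_space_onD(3)[OF normed_G \<phi>]
        by (simp, meson mult_right_mono order_trans)
    qed
    have "Cauchy (\<lambda>n. T n \<phi>)" for \<phi>
    proof (cases "\<phi> \<in> G")
      case True
      show ?thesis
        unfolding Cauchy_def dist_norm
      proof (intro allI impI)
        fix e :: real assume e: "e > 0"
        note N0 = cnormed_space_onD(3)[OF normed_G True]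
        then have "e / (NG \<phi> + 1) > 0" using e by simp
        then obtain M where M: "\<And>m n. m \<ge> M \<Longrightarrow> n \<ge> M \<Longrightarrow> ?N (F m - F n) < e / (NG \<phi> + 1)"
          using Cauchy by blast
        have "norm (T m \<phi> - T n \<phi>) < e" if "m \<ge> M" "n \<ge> M" for m n
        proof -
          have "norm (T m \<phi> - T n \<phi>) \<le> ?N (F m - F n) * NG \<phi>" by (rule Tdiff[OF True])
          also have "\<dots> \<le> ?N (F m - F n) * (NG \<phi> + 1)" using S(3)[OF dS] by (intro mult_left_mono) auto
          also have "\<dots> < e" using M[OF that] N0 by (simp add: less_divide_eq)
          finally show ?thesis .
        qed
        then show "\<exists>M. \<forall>m\<ge>M. \<forall>n\<ge>M. norm (T m \<phi> - T n \<phi>) < e" by blast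
      qed
    next
      case False
      then have "(\<lambda>n. T n \<phi>) = (\<lambda>_. 0)" using Tb by (auto simp: bounded_ops_iff)
      then show ?thesis by (simp add: Cauchy_def)
    qed
    then have "\<exists>R. \<forall>\<phi>. (\<lambda>n. T n \<phi>) \<longlonglongrightarrow> R \<phi>"
      by (intro choice allI) (simp add: Cauchy_convergent_iff convergent_def)
    then obtain R where R: "\<And>\<phi>. (\<lambda>n. T n \<phi>) \<longlonglongrightarrow> R \<phi>" by blast
    have Rb: "R \<in> bounded_ops G NG"
      unfolding bounded_ops_def
    proof (intro CollectI conjI ballI allI impI)
      fix \<phi> \<psi> assume "\<phi> \<in> G" "\<psi> \<in> G"
      then have "(\<lambda>n. T n (\<phi> + \<psi>)) = (\<lambda>n. T n \<phi> + T n \<psi>)" using clinear_on_add[OF Tlin] by blast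
      then show "R (\<phi> + \<psi>) = R \<phi> + R \<psi>"
        using LIMSEQ_unique[OF R[of "\<phi> + \<psi>"]] tendsto_add[OF R[of \<phi>] R[of \<psi>]] by simp
    next
      fix c \<phi> assume "\<phi> \<in> G"
      then have "(\<lambda>n. T n (c *\<^sub>C \<phi>)) = (\<lambda>n. c *\<^sub>C T n \<phi>)" using clinear_on_scale[OF Tlin] by blast
      then show "R (c *\<^sub>C \<phi>) = c *\<^sub>C R \<phi>"
        using LIMSEQ_unique[OF R[of "c *\<^sub>C \<phi>"]] bounded_linear.tendsto[OF bounded_linear_scaleC R[of \<phi>]] by simp
    next
      fix \<phi> assume "\<phi> \<notin> G"
      then have "(\<lambda>n. T n \<phi>) = (\<lambda>_. 0)" using Tb by (auto simp: bounded_ops_iff)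
      then show "R \<phi> = 0" using LIMSEQ_unique[OF R[of \<phi>]] by simp
    next
      obtain M where M: "\<And>m n. m \<ge> M \<Longrightarrow> n \<ge> M \<Longrightarrow> ?N (F m - F n) < 1" using Cauchy zero_less_one by blast
      have "norm (R \<phi>) \<le> (op_norm G NG (T M) + 1) * NG \<phi>" if \<phi>: "\<phi> \<in> G" for \<phi>
      proof (rule LIMSEQ_le_const2[OF tendsto_norm[OF R[of \<phi>]]], intro exI[of _ M] allI impI)
        fix n assume "n \<ge> M"
        note N0 = cnormed_space_onD(3)[OF normed_G \<phi>]
        have "norm (T n \<phi>) \<le> norm (T M \<phi>) + norm (T n \<phi> - T M \<phi>)" by (rule norm_triangle_sub)
        also have "\<dots> \<le> op_norm G NG (T M) * NG \<phi> + 1 * NG \<phi>"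
        proof (rule add_mono[OF op_norm_bound[OF normed_G Tb \<phi>]])
          have "norm (T n \<phi> - T M \<phi>) \<le> ?N (F n - F M) * NG \<phi>" by (rule Tdiff[OF \<phi>])
          also have "\<dots> \<le> 1 * NG \<phi>" using M[OF \<open>n \<ge> M\<close> order_refl] N0 by (intro mult_right_mono) auto
          finally show "norm (T n \<phi> - T M \<phi>) \<le> 1 * NG \<phi>" .
        qed
        finally show "norm (T n \<phi>) \<le> (op_norm G NG (T M) + 1) * NG \<phi>" by (simp add: distrib_right)
      qed
      then show "\<exists>C. \<forall>\<phi>\<in>G. norm (R \<phi>) \<le> C * NG \<phi>" by blast
    qed
    define f where "f x = (if x \<in> U then R (\<delta> x) else 0)" for x
    have fHv: "f \<in> Hv U v" unfolding f_def by (rule operator_comp_\<delta>_in_Hv[OF Rb])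
    have Ff: "(\<lambda>n. F n x) \<longlonglongrightarrow> f x" if "x \<in> U" for x
      using R[of "\<delta> x"] that by (simp add: f_def T\<delta>)
    have "\<exists>M. \<forall>k::nat. \<forall>m\<ge>M k. \<forall>n\<ge>M k. ?N (F m - F n) < 1 / 4 ^ k"
      by (intro choice allI Cauchy[rule_format]) simp
    then obtain M where M: "\<And>k m n. m \<ge> M k \<Longrightarrow> n \<ge> M k \<Longrightarrow> ?N (F m - F n) < 1 / 4 ^ k" by blast
    \<comment> \<open>Cumulative sums make \<open>r\<close> monotone and at least \<open>M\<close>,
      and the summand \<open>k\<close> makes it unbounded.\<close>
    define r where "r k = k + (\<Sum>j\<le>k. M j)" for k
    have rM: "M k \<le> r k" for k
      unfolding r_def using member_le_sum[of k "{..k}" M] by simp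
    have rmono: "r k \<le> r l" if "k \<le> l" for k l
      unfolding r_def using that by (intro add_mono sum_mono2) auto
    have rk: "k \<le> r k" for k by (simp add: r_def)
    \<comment> \<open>The constant is \<open>1 + 1 + 6\<close>, from \<open>size_of_series\<close>
      with \<open>a\<close>, \<open>b\<close> and \<open>e\<close> all equal to
      \<open>1 / 4 ^ j\<close>.\<close>
    have tail: "rel_compact I p (range_set (f - F (r j))) \<and> size_of I p (range_set (f - F (r j))) \<le> 8 / 4 ^ j" for j
    proof -
      define g where "g k = F (r (j + Suc k)) - F (r (j + k))" for k
      have gS: "g k \<in> ?S" for k unfolding g_def by (rule dS)
      have gN: "size_of I p (range_set (g k)) \<le> 1 / 4 ^ (j + k)" for k
      proof -
        have "M (j + k) \<le> r (j + Suc k)" using rM[of "j + k"] rmono[of "j + k" "j + Suc k"] by simp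
        from M[OF this rM] show ?thesis unfolding g_def HvI_norm_def by simp
      qed
      have ex: "\<exists>y. (\<forall>k. y k \<in> range_set (g k)) \<and> y sums w"
        if w: "w \<in> range_set (f - F (r j))" for w
      proof -
        obtain x where x: "x \<in> U" "w = v x *\<^sub>R (f x - F (r j) x)" using w by auto
        have "filterlim (\<lambda>k. r (j + k)) at_top sequentially"
        proof (rule filterlim_at_top_mono[OF filterlim_ident], rule always_eventually, rule allI)
          fix k show "k \<le> r (j + k)" using rk[of "j + k"] by simp
        qed
        then have "(\<lambda>k. F (r (j + k)) x) \<longlonglongrightarrow> f x" by (rule filterlim_compose[OF Ff[OF x(1)]])
        from telescope_sums[OF this]
        have "(\<lambda>k. F (r (j + Suc k)) x - F (r (j + k)) x) sums (f x - F (r j) x)" by simp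
        from bounded_linear.sums[OF bounded_linear_scaleR_right this]
        have "(\<lambda>k. v x *\<^sub>R g k x) sums w" by (simp add: g_def x(2))
        then show ?thesis using x(1) by (intro exI[of _ "\<lambda>k. v x *\<^sub>R g k x"]) auto
      qed
      have "rel_compact I p (range_set (f - F (r j))) \<and>
          size_of I p (range_set (f - F (r j))) \<le> 1 / 4 ^ j + 1 / 4 ^ j + 6 * (1 / 4 ^ j)"
      proof (rule size_of_series[where K = "\<lambda>k. range_set (g k)", OF p HvI_rel_compact[OF gS] _ _ _ _ ex])
        show "size_of I p (range_set (g 0)) \<le> 1 / 4 ^ j" using gN[of 0] by simp
        show "size_of I p (range_set (g 1)) \<le> 1 / 4 ^ j"
          using gN[of 1] by (rule order_trans) (simp add: field_simps)
        show "size_of I p (range_set (g (k + 2))) \<le> 1 / 4 ^ j / 4 ^ k" for k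
          using gN[of "k + 2"] by (rule order_trans) (simp add: power_add field_simps)
      qed simp
      then show ?thesis by simp
    qed
    have tailS: "f - F (r j) \<in> ?S" for j
      using tail csubspace_diff[OF cnormed_space_onD(1)[OF cnormed_space_Hv[OF weight_v]] fHv HvI_Hv[OF FS]]
      by (simp add: HvI_def)
    have fS: "f \<in> ?S"
      using csubspace_add[OF S(1) tailS[of 0] FS[of "r 0"]] by simp
    have "(\<lambda>n. ?N (F n - f)) \<longlonglongrightarrow> 0"
      unfolding LIMSEQ_iff
    proof (intro allI impI)
      fix e :: real assume e: "e > 0"
      \<comment> \<open>The constant is \<open>1 + 8\<close>: the distance from \<open>F n\<close>
        to \<open>F (r j)\<close> plus the tail bound.\<close>
      have "(\<lambda>j. 9 * (1 / 4) ^ j :: real) \<longlonglongrightarrow> 9 * 0" by (intro tendsto_mult_left LIMSEQ_realpow_zero) auto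
      then have "\<forall>\<^sub>F j in sequentially. 9 * (1 / 4) ^ j < e" using e by (intro order_tendstoD) auto
      then obtain j where j: "9 * (1 / 4) ^ j < e" by (auto simp: eventually_sequentially)
      have "norm (?N (F n - f) - 0) < e" if n: "n \<ge> r j" for n
      proof -
        have "?N (F n - f) = ?N ((F n - F (r j)) - (f - F (r j)))" by (simp del: pointwise_simps)
        also have "\<dots> \<le> ?N (F n - F (r j)) + ?N (f - F (r j))" by (rule cnormed_space_on_diff[OF SN dS tailS])
        also have "\<dots> \<le> 1 / 4 ^ j + 8 / 4 ^ j"
          using M[of j n "r j"] n rM[of j] tail[of j] by (intro add_mono) (auto simp: HvI_norm_def)
        also have "\<dots> < e" using j by (simp add: power_divide)
        finally show ?thesis using S(3)[OF csubspace_diff[OF S(1) FS fS]] by simp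
      qed
      then show "\<exists>M. \<forall>n\<ge>M. norm (?N (F n - f) - 0) < e" by blast
    qed
    then show ?thesis using fS by blast
  qed
  then show ?thesis using SN unfolding cbanach_space_on_def by blast
qed

end

theorem theorem2p9:
  fixes U :: "'e::cbanach set"
    and v :: "'e \<Rightarrow> real"
    and p :: ennreal
    and I :: ideal_kind
    and f :: "'e \<Rightarrow> 'f::cbanach"
  assumes "open U" and "weight_on U v" and "1 \<le> p" and "f \<in> Hv U v"
  shows "(f \<in> HvI I p U v \<longleftrightarrow> linearization U v f \<in> op_ideal I p (Gv U v) (Gv_norm U v))
    \<and> (f \<in> HvI I p U v \<longrightarrow>
        HvI_norm I p U v f = op_ideal_norm I p (Gv U v) (Gv_norm U v) (linearization U v f))
    \<and> isometric_isomorphism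
        (HvI I p U v :: ('e \<Rightarrow> 'f) set) (HvI_norm I p U v)
        (op_ideal I p (Gv U v) (Gv_norm U v)) (op_ideal_norm I p (Gv U v) (Gv_norm U v))
        (linearization U v)
    \<and> cbanach_space_on (HvI I p U v :: ('e \<Rightarrow> 'f) set) (HvI_norm I p U v)"
proof -
  interpret weighted_open_set U v using assms(1,2) by unfold_locales
  show ?thesis
    using linearization_ideal[OF assms(3,4)] linearization_isometry[OF assms(3)]
      cbanach_space_HvI[OF assms(3)] by blast
qed

end
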